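(* Consider a two-phase composite with isotropic phases $\mathsf L_j=\sigma_j\otimes I_2+r_j\mathsf T$, $j=1,2$, where $\sigma_1,\sigma_2$ are not scalar multiples of one another and \[ |r_1-r_2|<\big|\sqrt{\det\sigma_1}-\sqrt{\det\sigma_2}\big|,\qquad |r_1-r_2|^2=\det(\sigma_1-\sigma_2). \] Let $\lambda_1,\lambda_2$ be the two roots of $\det(\sigma_2-\lambda\sigma_1)=0$ and \[ S_1=\frac{\sigma_2-\lambda_1\sigma_1}{\lambda_2-\lambda_1},\qquad S_2=\frac{\sigma_2-\lambda_2\sigma_1}{\lambda_1-\lambda_2}. \] (i) If $r_1\ne r_2$, put $\rho=\dfrac{r_2-r_1}{\sqrt{\det\sigma_1}}$, $a_0=\dfrac{\lambda_1-1}{\rho}$, $\sigma^*=\Sigma(\lambda_1/\lambda_2)$, $x^*=\frac12\mathrm{Tr}\,\sigma^*$. Then \[ \mathsf L^*=\left(r_1+a_0\left(\frac{(1-a_0^2)(x^*-a_0^2)}{\det(\sigma^*-a_0^2I_2)}-1\right)\sqrt{\det\sigma_1}\right)\mathsf T+\frac{1-a_0^2}{\det(\sigma^*-a_0^2I_2)}\,\mathsf N, \] \[ \mathsf N=S_1\otimes(\sigma^*-a_0^2I_2)+S_2\otimes\big((\det\sigma^* )I_2-a_0^2\sigma^*\big)+a_0\sqrt{\det\sigma_1}\;\mathsf T\big[\sigma_1^{-1}(S_1-S_2)\otimes(\sigma^*-x^*I_2)\big]. \] (ii) If $r_1=r_2=r_0$, so that $\det(\sigma_1-\sigma_2)=0$,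 and the roots are ordered so that $\lambda_1\neq1=\lambda_2$, then \[ \mathsf L^*=r_0\mathsf T+S_1\otimes I_2+S_2\otimes\Sigma(\lambda_1). \]
   Context: Let $R_\perp=\begin{pmatrix}0&-1\\1&0\end{pmatrix}$ and let $I_2$ be the $2\times2$ identity. Let $\mathcal T=\mathbb R^2\oplus\mathbb R^2$. Operators on $\mathcal T$ are written as $2\times2$ block matrices with real $2\times 2$ blocks, and $A\otimes B$ is the block matrix with blocks $A_{ij}B$. Put $\mathsf T=R_\perp\otimes R_\perp$. The phases $\mathsf L_j$ are assumed positive definite: $\sigma_j$ is a real symmetric positive definite $2\times2$ matrix and $r_j\in\mathbb R$ with $r_j^2<\det\sigma_j$. A two-phase composite is given by a measurable partition of the period cell $[0,1]^2=A_1\cup A_2$ (the microstructure) and the periodic tensor field $\mathsf L(x)=\mathsf L_j$ for $x\in A_j$. Its effective tensor $\mathsf L^*$ is defined by $\mathsf L^*E_0=\int_{[0,1]^2}\mathsf L(x)E(x)\,dx$ for $E_0\in\mathcal T$, where $E=E_0+(\nabla\varphi_1,\nabla\varphi_2)$ with $\varphi_1,\varphi_2\in H^1_{\rm per}$ is the unique such field for which both $\mathbb R^2$-components of $\mathsf L E$ are divergence-free. For $h>0$, $\Sigma(h)$ is the effective ($2\times2$ symmetric) conductivity of the two-dimensional conducting composite with the same microstructure and conductivities $I_2$ on $A_1$ and $hI_2$ on $A_2$: $\Sigma(h)e_0=\int\sigma(e_0+\nabla\varphi)\,dx$ with $\nabla\cdot\sigma(e_0+\nabla\varphi)=0$, $\varphi\in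 H^1_{\rm per}$. *)

theory Defs
  imports "HOL-Analysis.Analysis"
begin

section \<open>Periodic Sobolev functions on the unit cell\<close>

abbreviation cell :: "(real^2) set" where
  "cell \<equiv> cbox 0 1"

definition L2_cell :: "(real^2 \<Rightarrow> 'a::euclidean_space) \<Rightarrow> bool" where
  "L2_cell f \<longleftrightarrow> f \<in> borel_measurable (lebesgue_on cell) \<and>
     integrable (lebesgue_on cell) (\<lambda>x. (norm (f x))\<^sup>2)"

definition partial :: "2 \<Rightarrow> (real^2 \<Rightarrow> real) \<Rightarrow> real^2 \<Rightarrow> real" where
  "partial k f x = frechet_derivative f (at x) (axis k 1)"

definition grad :: "(real^2 \<Rightarrow> real) \<Rightarrow> real^2 \<Rightarrow> real^2" where
  "grad f x = (\<chi> k. partial k f x)"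

primrec Ck :: "nat \<Rightarrow> (real^2 \<Rightarrow> real) \<Rightarrow> bool" where
  "Ck 0 f \<longleftrightarrow> continuous_on UNIV f"
| "Ck (Suc n) f \<longleftrightarrow> (\<forall>x. f differentiable (at x)) \<and> (\<forall>k. Ck n (partial k f))"

definition smooth_per :: "(real^2 \<Rightarrow> real) \<Rightarrow> bool" where
  "smooth_per f \<longleftrightarrow> (\<forall>n. Ck n f) \<and> (\<forall>x k. f (x + axis k 1) = f x)"

text \<open>The space \<open>H\<^sup>1\<close> of periodic functions is the closure of the smooth periodic functions in the
  \<open>H\<^sup>1\<close>-norm of the cell. The following relation says that \<open>\<phi>\<close> belongs to it and that \<open>g\<close> is its
  (weak) gradient. Only the values on the cell, up to null sets, matter.\<close>

definition H1_per_grad :: "(real^2 \<Rightarrow> real) \<Rightarrow> (real^2 \<Rightarrow> real^2) \<Rightarrow> bool" where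
  "H1_per_grad \<phi> g \<longleftrightarrow> L2_cell \<phi> \<and> L2_cell g \<and>
     (\<exists>u. (\<forall>n. smooth_per (u n)) \<and>
        (\<lambda>n. LINT x|lebesgue_on cell. (u n x - \<phi> x)\<^sup>2) \<longlonglongrightarrow> 0 \<and>
        (\<lambda>n::nat. LINT x|lebesgue_on cell. (norm (grad (u n) x - g x))\<^sup>2) \<longlonglongrightarrow> 0)"

text \<open>Periodic test functions make this the distributional divergence on the plane of the periodic
  extension of \<open>J\<close>; compactly supported test functions on the cell would not see its boundary.\<close>

definition div_free :: "(real^2 \<Rightarrow> real^2) \<Rightarrow> bool" where
  "div_free J \<longleftrightarrow> L2_cell J \<and>
     (\<forall>\<psi>. smooth_per \<psi> \<longrightarrow> (LINT x|lebesgue_on cell. J x \<bullet> grad \<psi> x) = 0)"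

section \<open>The space \<open>\<T> = \<real>\<^sup>2 \<oplus> \<real>\<^sup>2\<close> and its operators\<close>

text \<open>The index \<open>(i, k)\<close> denotes the \<open>k\<close>-th entry of the \<open>i\<close>-th \<open>\<real>\<^sup>2\<close>-component; in an operator,
  \<open>i\<close> and \<open>j\<close> in the indices \<open>(i, k)\<close>, \<open>(j, l)\<close> select the block.\<close>

type_synonym \<T> = "real^(2 \<times> 2)"
type_synonym op\<T> = "real^(2 \<times> 2)^(2 \<times> 2)"

definition component :: "2 \<Rightarrow> \<T> \<Rightarrow> real^2" where
  "component i E = (\<chi> k. E $ (i, k))"

definition kron :: "real^2^2 \<Rightarrow> real^2^2 \<Rightarrow> op\<T>" (infixl "\<otimes>" 75) where
  "A \<otimes> B = (\<chi> p q. A $ fst p $ fst q * B $ snd p $ snd q)"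

definition R_perp :: "real^2^2" where
  "R_perp = vector [vector [0, -1], vector [1, 0]]"

definition TT :: op\<T> where
  "TT = R_perp \<otimes> R_perp"

definition sym_pos_def :: "real^'n^'n \<Rightarrow> bool" where
  "sym_pos_def A \<longleftrightarrow> transpose A = A \<and> (\<forall>x. x \<noteq> 0 \<longrightarrow> 0 < x \<bullet> (A *v x))"

section \<open>Two-phase composites and effective tensors\<close>

definition two_phase_cell :: "(real^2) set \<Rightarrow> (real^2) set \<Rightarrow> bool" where
  "two_phase_cell A1 A2 \<longleftrightarrow> A1 \<in> sets lebesgue \<and> A2 \<in> sets lebesgue \<and>
     A1 \<union> A2 = cell \<and> A1 \<inter> A2 = {}"

definition two_phase ::
    "(real^2) set \<Rightarrow> (real^2) set \<Rightarrow> 'a::real_vector \<Rightarrow> 'a \<Rightarrow> real^2 \<Rightarrow> 'a" where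
  "two_phase A1 A2 a b x = indicator A1 x *\<^sub>R a + indicator A2 x *\<^sub>R b"

definition cell_field :: "(real^2 \<Rightarrow> op\<T>) \<Rightarrow> \<T> \<Rightarrow> (real^2 \<Rightarrow> \<T>) \<Rightarrow> bool" where
  "cell_field L E0 E \<longleftrightarrow>
     (\<forall>i. \<exists>\<phi>. H1_per_grad \<phi> (\<lambda>x. component i (E x - E0))) \<and>
     (\<forall>i. div_free (\<lambda>x. component i (L x *v E x)))"

text \<open>The field \<open>E\<close> in the definition of the effective tensor exists and is unique up to null sets
  for bounded, measurable, uniformly positive definite coefficients, so that the description below
  is then well defined. The same applies to the effective conductivity.\<close>

definition effective_tensor :: "(real^2 \<Rightarrow> op\<T>) \<Rightarrow> op\<T>" where
  "effective_tensor L = (THE M. \<forall>E0. \<exists>E. cell_field L E0 E \<and>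
     M *v E0 = (LINT x|lebesgue_on cell. L x *v E x))"

definition conduction_field ::
    "(real^2 \<Rightarrow> real^2^2) \<Rightarrow> real^2 \<Rightarrow> (real^2 \<Rightarrow> real^2) \<Rightarrow> bool" where
  "conduction_field \<sigma> e0 e \<longleftrightarrow>
     (\<exists>\<phi>. H1_per_grad \<phi> (\<lambda>x. e x - e0)) \<and> div_free (\<lambda>x. \<sigma> x *v e x)"

definition effective_conductivity :: "(real^2 \<Rightarrow> real^2^2) \<Rightarrow> real^2^2" where
  "effective_conductivity \<sigma> = (THE M. \<forall>e0. \<exists>e. conduction_field \<sigma> e0 e \<and>
     M *v e0 = (LINT x|lebesgue_on cell. \<sigma> x *v e x))"

definition Sigma_eff :: "(real^2) set \<Rightarrow> (real^2) set \<Rightarrow> real \<Rightarrow> real^2^2" where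
  "Sigma_eff A1 A2 h = effective_conductivity (two_phase A1 A2 (mat 1) (h *\<^sub>R mat 1))"

end

theory Submission
  imports Defs
begin

text \<open>
  Existence of the fields follows by minimising the energy in \<open>L\<^sup>2\<close> over gradients of smooth
  periodic functions, and uniqueness from coercivity.

  Choose a basis of the component space that is orthonormal for \<open>\<sigma>\<^sub>1\<close> and diagonalises \<open>\<sigma>\<^sub>2\<close>.
  Rotated gradients are divergence-free, so subtracting \<open>r\<^sub>1 TT\<close> from both phases only shifts the
  effective tensor. The first phase then becomes the identity, and the second one couples the two
  components only through \<open>\<rho>\<close>. The condition on \<open>det (\<sigma>\<^sub>1 - \<sigma>\<^sub>2)\<close> says that the difference of
  the phases is degenerate, and this produces a field that is both divergence-free and curl-free,
  hence constant (all its nonconstant Fourier coefficients vanish). Eliminating one component by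
  means of this constant leaves the scalar problem with contrast \<open>\<mu>\<^sub>1 / \<mu>\<^sub>2\<close>, from whose
  effective conductivity the averages of all fields are recovered.
\<close>

section \<open>Square-integrable functions on the cell\<close>

text \<open>Write \<open>d1 = \<mu>2\<close> and \<open>d2 = \<mu>1\<close> for the two roots, which
  are the diagonal entries of the normalised second phase. Degeneracy reads
  \<open>(d1 - 1) * (d2 - 1) = \<rho>\<^sup>2\<close>, so the number
  \<open>a = (d2 - 1) / \<rho>\<close> also satisfies \<open>\<rho> = a * (d1 - 1)\<close>. Because
  of this double meaning one combination of fluxes and rotated fields can be written in two ways,
  and \<open>a\<close> is the constant a_0 of the statement. Two obstacles shape the rest. The
  effective coefficients are given by \<open>THE\<close>, so nothing can be computed from them
  before solvability, uniqueness almost everywhere and linear dependence on the mean field are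
  known. And the formula divides by \<open>det (s - a\<^sup>2 *\<^sub>R mat 1)\<close>: the averages
  are expressed through two auxiliary vectors, whose elimination means inverting this matrix. It is
  invertible because \<open>a\<^sup>2 = (d2 - 1) / (d1 - 1)\<close> lies strictly outside the
  interval between 1 and the contrast \<open>d2 / d1\<close>, which contains the spectrum of
  \<open>s\<close>. For equal \<open>r1\<close> and \<open>r2\<close> the number \<open>a\<close>
  makes no sense, but then the components decouple.\<close>

abbreviation \<mu> :: "(real^2) measure" where
  "\<mu> \<equiv> lebesgue_on cell"

lemma measure_cell: "measure \<mu> (space \<mu>) = 1"
proof -
  have "measure lborel cell = (\<Prod>i\<in>UNIV. (1::real^2) $ i - 0 $ i)"
    by (rule content_cbox_cart) (simp add: interval_eq_empty_cart)
  then show ?thesis by (simp add: measure_restrict_space space_restrict_space)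
qed

interpretation cell: finite_measure \<mu>
  by standard (simp add: emeasure_restrict_space space_restrict_space emeasure_lborel_cbox_eq)

lemma LINT_cell_const: "(LINT x|\<mu>. c) = (c::'a::{banach,second_countable_topology})"
  using measure_cell by simp

text \<open>The L^2 norm is kept squared throughout: parallelogram estimates with a factor 2 replace
  the triangle inequality, and no square roots enter the limits.\<close>

definition sqn :: "(real^2 \<Rightarrow> 'a::euclidean_space) \<Rightarrow> real" where
  "sqn f = (LINT x|\<mu>. (norm (f x))\<^sup>2)"

lemma sqn_nonneg: "0 \<le> sqn f"
  unfolding sqn_def by (rule integral_nonneg_AE) simp

lemma L2_cell_measurable: "L2_cell f \<Longrightarrow> f \<in> borel_measurable \<mu>"
  by (simp add: L2_cell_def)

lemma L2_cell_sq_integrable: "L2_cell f \<Longrightarrow> integrable \<mu> (\<lambda>x. (norm (f x))\<^sup>2)"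
  by (simp add: L2_cell_def)

lemma L2_cell_bound:
  assumes "f \<in> borel_measurable \<mu>" "integrable \<mu> h" "\<And>x. x \<in> cell \<Longrightarrow> (norm (f x))\<^sup>2 \<le> h x"
  shows "L2_cell f"
  unfolding L2_cell_def
proof (intro conjI assms(1))
  show "integrable \<mu> (\<lambda>x. (norm (f x))\<^sup>2)"
  proof (rule Bochner_Integration.integrable_bound[OF assms(2)])
    show "AE x in \<mu>. norm ((norm (f x))\<^sup>2) \<le> norm (h x)"
      using assms(3) by (intro AE_I2) (force simp: space_restrict_space intro: order_trans[OF _ abs_ge_self])
  qed (use assms(1) in measurable)
qed

lemma L2_cell_const: "L2_cell (\<lambda>x. c)"
  by (rule L2_cell_bound[where h="\<lambda>x. (norm c)\<^sup>2"]) auto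

lemma norm_add_sq_le: "(norm (a + b))\<^sup>2 \<le> 2 * (norm a)\<^sup>2 + 2 * (norm (b::'a::real_inner))\<^sup>2"
proof -
  have "(norm (a + b))\<^sup>2 + (norm (a - b))\<^sup>2 = 2 * (norm a)\<^sup>2 + 2 * (norm b)\<^sup>2"
    by (simp add: power2_norm_eq_inner inner_simps inner_commute)
  then show ?thesis by (smt (verit) zero_le_power2)
qed

lemma L2_cell_add: "L2_cell f \<Longrightarrow> L2_cell g \<Longrightarrow> L2_cell (\<lambda>x. f x + g x)"
  by (rule L2_cell_bound[where h="\<lambda>x. 2 * (norm (f x))\<^sup>2 + 2 * (norm (g x))\<^sup>2"])
    (auto simp: L2_cell_def norm_add_sq_le)

lemma L2_cell_linear:
  assumes "L2_cell f" "bounded_linear h" shows "L2_cell (\<lambda>x. h (f x))"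
proof -
  obtain K where K: "\<And>x. norm (h x) \<le> norm x * K" "K > 0"
    using bounded_linear.pos_bounded[OF assms(2)] by blast
  have "h \<in> borel_measurable borel"
    by (intro borel_measurable_continuous_onI linear_continuous_on assms)
  then have m: "(\<lambda>x. h (f x)) \<in> borel_measurable \<mu>"
    using measurable_compose[OF L2_cell_measurable[OF assms(1)]] by blast
  show ?thesis
  proof (rule L2_cell_bound[OF m, where h="\<lambda>x. K\<^sup>2 * (norm (f x))\<^sup>2"])
    show "(norm (h (f x)))\<^sup>2 \<le> K\<^sup>2 * (norm (f x))\<^sup>2" for x
      using power_mono[OF K(1)[of "f x"], of 2] by (simp add: power_mult_distrib mult.commute)
  qed (use assms(1) in \<open>simp add: L2_cell_def\<close>)
qed

lemma L2_cell_scaleR: "L2_cell f \<Longrightarrow> L2_cell (\<lambda>x. c *\<^sub>R f x)"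
  using L2_cell_linear bounded_linear_scaleR_right by blast

lemma L2_cell_uminus: "L2_cell f \<Longrightarrow> L2_cell (\<lambda>x. - f x)"
  using L2_cell_scaleR[of f "-1"] by simp

lemma L2_cell_diff: "L2_cell f \<Longrightarrow> L2_cell g \<Longrightarrow> L2_cell (\<lambda>x. f x - g x)"
  using L2_cell_add[of f "\<lambda>x. - g x"] L2_cell_uminus[of g] by simp

lemma L2_cell_indicator:
  assumes "L2_cell f" "A \<in> sets lebesgue" shows "L2_cell (\<lambda>x. indicator A x *\<^sub>R f x)"
proof (rule L2_cell_bound[where h="\<lambda>x. (norm (f x))\<^sup>2"])
  have "(indicator A :: _ \<Rightarrow> real) \<in> borel_measurable \<mu>"
    using assms(2) by (intro measurable_restrict_space1 borel_measurable_indicator)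
  then show "(\<lambda>x. indicator A x *\<^sub>R f x) \<in> borel_measurable \<mu>"
    using assms(1) by (intro borel_measurable_scaleR) (auto simp: L2_cell_def)
qed (use assms(1) in \<open>auto simp: L2_cell_def indicator_def\<close>)

lemma L2_cell_continuous: "continuous_on cell f \<Longrightarrow> L2_cell f"
  unfolding L2_cell_def
  by (intro conjI continuous_imp_measurable_on_sets_lebesgue continuous_imp_integrable
      continuous_intros) auto

lemma L2_cell_integrable: "L2_cell f \<Longrightarrow> integrable \<mu> f"
proof (rule Bochner_Integration.integrable_bound)
  assume f: "L2_cell f"
  then show "integrable \<mu> (\<lambda>x. 1 + (norm (f x))\<^sup>2)" "f \<in> borel_measurable \<mu>"
    by (simp_all add: L2_cell_def)
  have "a \<le> 1 + a\<^sup>2" for a :: real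
  proof -
    have "2 * a \<le> a\<^sup>2 + 1" using sum_squares_bound[of a 1] by simp
    then show ?thesis using zero_le_power2[of a] by linarith
  qed
  then show "AE x in \<mu>. norm (f x) \<le> norm (1 + (norm (f x))\<^sup>2)" by simp
qed

lemma L2_cell_inner_integrable:
  assumes "L2_cell f" "L2_cell g" shows "integrable \<mu> (\<lambda>x. f x \<bullet> g x)"
proof (rule Bochner_Integration.integrable_bound)
  show "integrable \<mu> (\<lambda>x. (norm (f x))\<^sup>2 + (norm (g x))\<^sup>2)"
    using assms by (simp add: L2_cell_def)
  have "\<bar>f x \<bullet> g x\<bar> \<le> (norm (f x))\<^sup>2 + (norm (g x))\<^sup>2" for x
  proof -
    have "0 \<le> norm (f x) * norm (g x)" by simp
    then show ?thesis
      using Cauchy_Schwarz_ineq2[of "f x" "g x"] sum_squares_bound[of "norm (f x)" "norm (g x)"]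
      by linarith
  qed
  then show "AE x in \<mu>. norm (f x \<bullet> g x) \<le> norm ((norm (f x))\<^sup>2 + (norm (g x))\<^sup>2)"
    by auto
qed (use assms in \<open>auto simp: L2_cell_def\<close>)

lemmas L2_cell_intros = L2_cell_const L2_cell_add L2_cell_scaleR L2_cell_uminus L2_cell_diff

lemma norm_add_scaled_sq: "(norm (a + t *\<^sub>R b))\<^sup>2 = a \<bullet> a + 2 * t * (a \<bullet> b) + t\<^sup>2 * (b \<bullet> b)"
  unfolding power2_norm_eq_inner
  unfolding inner_add_left inner_add_right inner_scaleR_left inner_scaleR_right
    inner_commute[of b a] by algebra

lemma sqn_add_scaled:
  assumes "L2_cell f" "L2_cell g"
  shows "sqn (\<lambda>x. f x + t *\<^sub>R g x) = sqn f + 2 * t * (LINT x|\<mu>. f x \<bullet> g x) + t\<^sup>2 * sqn g"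
proof -
  have i: "integrable \<mu> (\<lambda>x. f x \<bullet> f x)" "integrable \<mu> (\<lambda>x. f x \<bullet> g x)" "integrable \<mu> (\<lambda>x. g x \<bullet> g x)"
    using assms by (auto intro: L2_cell_inner_integrable)
  have "sqn (\<lambda>x. f x + t *\<^sub>R g x)
      = (LINT x|\<mu>. f x \<bullet> f x + 2 * t * (f x \<bullet> g x) + t\<^sup>2 * (g x \<bullet> g x))"
    unfolding sqn_def
    by (simp only: norm_add_scaled_sq)
  also have "\<dots> = sqn f + 2 * t * (LINT x|\<mu>. f x \<bullet> g x) + t\<^sup>2 * sqn g"
    unfolding sqn_def power2_norm_eq_inner using i by simp
  finally show ?thesis .
qed

text \<open>For \<open>c \<noteq> 0\<close> the minimiser \<open>t = - b / c\<close> is inserted;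
  for \<open>c = 0\<close> an affine function bounded below has slope zero. Besides both
  Cauchy-Schwarz inequalities this yields the Euler-Lagrange equation of the energy, where
  \<open>a = 0\<close> forces \<open>b = 0\<close>.\<close>

lemma nonneg_quadratic_imp_discriminant:
  fixes a b c :: real
  assumes "\<And>t. 0 \<le> a + 2 * t * b + t\<^sup>2 * c" "0 \<le> c" shows "b\<^sup>2 \<le> a * c"
proof (cases "c = 0")
  case True
  have "b = 0"
  proof (rule ccontr)
    assume "b \<noteq> 0"
    then have t: "2 * (-(a + 1) / (2 * b)) * b = -(a + 1)" by (simp add: field_simps)
    have "0 \<le> a + 2 * (-(a + 1) / (2 * b)) * b" using assms(1)[of "-(a + 1) / (2 * b)"] unfolding True by simp
    then show False unfolding t by simp
  qed
  then show ?thesis using True by simp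
next
  case False
  then have "0 \<le> (a + 2 * (- b / c) * b + (- b / c)\<^sup>2 * c) * c"
    using assms by (intro mult_nonneg_nonneg assms)
  also have "\<dots> = a * c - b\<^sup>2" using False by (simp add: field_simps power2_eq_square)
  finally show ?thesis by simp
qed

lemma Cauchy_Schwarz_cell:
  assumes "L2_cell f" "L2_cell g"
  shows "(LINT x|\<mu>. f x \<bullet> g x)\<^sup>2 \<le> sqn f * sqn g"
  by (rule nonneg_quadratic_imp_discriminant)
    (auto simp flip: sqn_add_scaled[OF assms] intro: sqn_nonneg)

lemma tendsto_LINT_inner:
  assumes "\<And>n. L2_cell (f n)" "L2_cell f'" "L2_cell g"
    and "(\<lambda>n. sqn (\<lambda>x. f n x - f' x)) \<longlonglongrightarrow> 0"
  shows "(\<lambda>n. LINT x|\<mu>. f n x \<bullet> g x) \<longlonglongrightarrow> (LINT x|\<mu>. f' x \<bullet> g x)"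
proof -
  have "(\<lambda>n. ((LINT x|\<mu>. f n x \<bullet> g x) - (LINT x|\<mu>. f' x \<bullet> g x))\<^sup>2) \<longlonglongrightarrow> 0"
  proof (rule tendsto_sandwich[OF _ _ tendsto_const])
    have "(LINT x|\<mu>. f n x \<bullet> g x) - (LINT x|\<mu>. f' x \<bullet> g x) = (LINT x|\<mu>. (f n x - f' x) \<bullet> g x)" for n
      using assms by (simp add: inner_diff_left L2_cell_inner_integrable)
    then show "\<forall>\<^sub>F n in sequentially. ((LINT x|\<mu>. f n x \<bullet> g x) - (LINT x|\<mu>. f' x \<bullet> g x))\<^sup>2
        \<le> sqn (\<lambda>x. f n x - f' x) * sqn g"
      using assms by (auto intro!: Cauchy_Schwarz_cell always_eventually L2_cell_diff)
    show "(\<lambda>n. sqn (\<lambda>x. f n x - f' x) * sqn g) \<longlonglongrightarrow> 0"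
      using tendsto_mult_left_zero[OF assms(4)] by simp
  qed auto
  then have "(\<lambda>n. (LINT x|\<mu>. f n x \<bullet> g x) - (LINT x|\<mu>. f' x \<bullet> g x)) \<longlonglongrightarrow> 0"
    by (drule_tac tendsto_real_sqrt) (simp add: tendsto_rabs_zero_iff)
  then show ?thesis by (simp add: LIM_zero_iff)
qed

lemma sqn_add_le:
  assumes "L2_cell f" "L2_cell g"
  shows "sqn (\<lambda>x. f x + g x) \<le> 2 * sqn f + 2 * sqn g"
proof -
  have "sqn (\<lambda>x. f x + g x) \<le> (LINT x|\<mu>. 2 * (norm (f x))\<^sup>2 + 2 * (norm (g x))\<^sup>2)"
    unfolding sqn_def
    using assms by (intro integral_mono norm_add_sq_le) (auto simp: L2_cell_sq_integrable L2_cell_add)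
  also have "\<dots> = 2 * sqn f + 2 * sqn g"
    using assms by (simp add: sqn_def L2_cell_sq_integrable)
  finally show ?thesis .
qed

lemma sqn_eq_0_iff:
  assumes "L2_cell f" shows "sqn f = 0 \<longleftrightarrow> (AE x in \<mu>. f x = 0)"
  unfolding sqn_def
  by (subst integral_nonneg_eq_0_iff_AE) (auto simp: L2_cell_sq_integrable assms)

lemma L2_cell_component:
  fixes f :: "real^2 \<Rightarrow> real^'n"
  shows "L2_cell f \<Longrightarrow> L2_cell (\<lambda>x. f x $ i)"
  using L2_cell_linear bounded_linear_vec_nth by blast

text \<open>The Riesz-Fischer argument for a rapidly converging sequence. Squared increments of size
  \<open>(1/8)^n\<close> stay summable after weighting by \<open>4^n\<close>, so almost everywhere
  the weighted increments are bounded; hence the increments themselves are of order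
  \<open>(1/2)^n\<close>, and the sequence converges pointwise.\<close>

lemma L2_complete_summable:
  fixes f :: "nat \<Rightarrow> real^2 \<Rightarrow> 'a::euclidean_space"
  assumes L2: "\<And>n. L2_cell (f n)"
    and fast: "\<And>n m. n \<le> m \<Longrightarrow> sqn (\<lambda>x. f m x - f n x) \<le> (1/8)^n"
  shows "\<exists>g. L2_cell g \<and> (\<forall>n. sqn (\<lambda>x. f n x - g x) \<le> (1/8)^n)"
proof -
  define d where "d n x = (norm (f (Suc n) x - f n x))\<^sup>2" for n x
  have fm[measurable]: "f n \<in> borel_measurable \<mu>" for n using L2 by (simp add: L2_cell_def)
  have L2d: "L2_cell (\<lambda>x. f m x - f n x)" for m n using L2 by (intro L2_cell_diff)
  have dm[measurable]: "d n \<in> borel_measurable \<mu>" for n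
    unfolding d_def by measurable
  have nn: "(\<integral>\<^sup>+x. ennreal ((norm (f m x - f n x))\<^sup>2) \<partial>\<mu>) \<le> ennreal ((1/8)^n)" if "n \<le> m" for n m
    using fast[OF that] L2_cell_sq_integrable[OF L2d]
    by (subst nn_integral_eq_integral) (auto simp: sqn_def intro: ennreal_leI)
  have "(\<integral>\<^sup>+x. (\<Sum>n. ennreal (4^n * d n x)) \<partial>\<mu>) = (\<Sum>n. \<integral>\<^sup>+x. ennreal (4^n * d n x) \<partial>\<mu>)"
    by (rule nn_integral_suminf) measurable
  also have "\<dots> \<le> (\<Sum>n. ennreal ((1/2)^n))"
  proof (rule suminf_le)
    fix n
    have "(\<integral>\<^sup>+x. ennreal (4^n * d n x) \<partial>\<mu>) = ennreal (4^n) * (\<integral>\<^sup>+x. ennreal (d n x) \<partial>\<mu>)"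
      by (simp add: ennreal_mult' nn_integral_cmult)
    also have "\<dots> \<le> ennreal (4^n) * ennreal ((1/8)^n)"
      unfolding d_def by (intro mult_left_mono nn) auto
    also have "\<dots> = ennreal ((1/2)^n)"
      by (simp add: ennreal_mult' [symmetric] power_mult_distrib[symmetric])
    finally show "(\<integral>\<^sup>+x. ennreal (4^n * d n x) \<partial>\<mu>) \<le> ennreal ((1/2)^n)" .
  qed auto
  also have "\<dots> < \<infinity>"
    by (subst suminf_ennreal2) (auto simp: summable_geometric)
  finally have "(\<integral>\<^sup>+x. (\<Sum>n. ennreal (4^n * d n x)) \<partial>\<mu>) \<noteq> \<infinity>" by simp
  then have ae: "AE x in \<mu>. (\<Sum>n. ennreal (4^n * d n x)) \<noteq> \<infinity>"
    by (intro nn_integral_noteq_infinite) measurable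
  have conv: "convergent (\<lambda>n. f n x)" if "(\<Sum>n. ennreal (4^n * d n x)) \<noteq> \<infinity>" for x
  proof -
    have "summable (\<lambda>n. 4^n * d n x)"
      by (rule summable_suminf_not_top) (use that in \<open>auto simp: d_def\<close>)
    then have "(\<lambda>n. 4^n * d n x) \<longlonglongrightarrow> 0" by (rule summable_LIMSEQ_zero)
    then have "Bseq (\<lambda>n. 4^n * d n x)" by (intro convergent_imp_Bseq) (auto simp: convergent_def)
    then obtain K where K: "K > 0" "\<And>n. norm (4^n * d n x) \<le> K" unfolding Bseq_def by blast
    have "norm (f (Suc n) x - f n x) \<le> sqrt K * (1/2)^n" for n
    proof -
      have "d n x \<le> K * (1/4)^n"
        using K(2)[of n] by (simp add: d_def field_simps power_divide)
      also have "\<dots> = (sqrt K * (1/2)^n)\<^sup>2"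
      proof -
        have "((1/2::real)^n)\<^sup>2 = (1/4)^n"
          by (simp add: power2_eq_square flip: power_mult_distrib)
        then show ?thesis using K(1) by (simp add: power_mult_distrib)
      qed
      finally show ?thesis
        unfolding d_def by (rule power2_le_imp_le) (use K(1) in simp)
    qed
    then have "summable (\<lambda>n. f (Suc n) x - f n x)"
      by (rule_tac summable_comparison_test'[where g="\<lambda>n. sqrt K * (1/2)^n" and N=0, rotated])
        (simp_all add: summable_mult summable_geometric)
    then have "convergent (\<lambda>n. f n x - f 0 x)"
      by (simp add: summable_iff_convergent sum_lessThan_telescope[of "\<lambda>n. f n x"])
    then obtain l where "(\<lambda>n. f n x - f 0 x) \<longlonglongrightarrow> l" unfolding convergent_def by blast
    from tendsto_add[OF this tendsto_const[of "f 0 x"]] show ?thesis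
      unfolding convergent_def diff_add_cancel by blast
  qed
  define g where "g x = lim (\<lambda>n. f n x)" for x
  have gm: "g \<in> borel_measurable \<mu>"
  proof -
    have "f n \<in> borel_measurable \<mu>" for n using L2 by (simp add: L2_cell_def)
    then show ?thesis unfolding g_def by (rule borel_measurable_lim_metric)
  qed
  have lim: "AE x in \<mu>. (\<lambda>n. f n x) \<longlonglongrightarrow> g x"
    using ae by eventually_elim (simp only: g_def flip: convergent_LIMSEQ_iff, rule conv)
  \<comment> \<open>Fatou's lemma in the index \<open>m\<close> carries the bound between two
    members of the sequence over to the pointwise limit.\<close>
  have key: "(\<integral>\<^sup>+x. ennreal ((norm (g x - f n x))\<^sup>2) \<partial>\<mu>) \<le> ennreal ((1/8)^n)" for n
  proof -
    have "(\<integral>\<^sup>+x. ennreal ((norm (g x - f n x))\<^sup>2) \<partial>\<mu>)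
        = (\<integral>\<^sup>+x. liminf (\<lambda>m. ennreal ((norm (f m x - f n x))\<^sup>2)) \<partial>\<mu>)"
    proof (rule nn_integral_cong_AE, use lim in eventually_elim)
      fix x assume "(\<lambda>n. f n x) \<longlonglongrightarrow> g x"
      then have "(\<lambda>m. ennreal ((norm (f m x - f n x))\<^sup>2)) \<longlonglongrightarrow> ennreal ((norm (g x - f n x))\<^sup>2)"
        by (intro tendsto_intros tendsto_ennrealI)
      then show "ennreal ((norm (g x - f n x))\<^sup>2) = liminf (\<lambda>m. ennreal ((norm (f m x - f n x))\<^sup>2))"
        by (metis lim_imp_Liminf sequentially_bot)
    qed
    also have "\<dots> \<le> liminf (\<lambda>m. \<integral>\<^sup>+x. ennreal ((norm (f m x - f n x))\<^sup>2) \<partial>\<mu>)"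
      by (intro nn_integral_liminf) measurable
    also have "\<dots> \<le> ennreal ((1/8)^n)"
      by (rule Liminf_le) (auto intro!: eventually_sequentiallyI[of n] nn)
    finally show ?thesis .
  qed
  have gfm: "(\<lambda>x. g x - f n x) \<in> borel_measurable \<mu>" for n
    using gm by measurable
  have gi: "integrable \<mu> (\<lambda>x. (norm (g x - f n x))\<^sup>2)" for n
    using gfm key[of n] by (intro integrableI_bounded) (auto simp: le_less_trans)
  then have "L2_cell (\<lambda>x. g x - f 0 x)" using gfm by (simp add: L2_cell_def)
  then have "L2_cell (\<lambda>x. (g x - f 0 x) + f 0 x)" using L2 by (rule L2_cell_add)
  then have "L2_cell g" by simp
  moreover have "sqn (\<lambda>x. f n x - g x) \<le> (1/8)^n" for n
  proof -
    have "ennreal (sqn (\<lambda>x. g x - f n x)) \<le> ennreal ((1/8)^n)"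
      using key[of n] gi[of n] unfolding sqn_def by (subst (asm) nn_integral_eq_integral) auto
    then show ?thesis by (simp add: sqn_def norm_minus_commute)
  qed
  ultimately show ?thesis by blast
qed

lemma sqn_minus_commute: "sqn (\<lambda>x. f x - g x) = sqn (\<lambda>x. g x - f x)"
  by (simp add: sqn_def norm_minus_commute)

text \<open>A strictly increasing choice of indices \<open>N k\<close> extracts a subsequence with
  the rate \<open>(1/8)^k\<close> required above; the Cauchy property then makes the whole sequence
  follow its subsequence.\<close>

lemma L2_cell_complete:
  fixes f :: "nat \<Rightarrow> real^2 \<Rightarrow> 'a::euclidean_space"
  assumes L2: "\<And>n. L2_cell (f n)"
    and cauchy: "\<And>e. e > 0 \<Longrightarrow> \<exists>N. \<forall>m\<ge>N. \<forall>n\<ge>N. sqn (\<lambda>x. f m x - f n x) < e"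
  shows "\<exists>g. L2_cell g \<and> (\<lambda>n. sqn (\<lambda>x. f n x - g x)) \<longlonglongrightarrow> 0"
proof -
  have "\<exists>N. \<forall>k. (\<forall>m\<ge>N k. \<forall>n\<ge>N k. sqn (\<lambda>x. f m x - f n x) < (1/8)^k) \<and> N k < N (Suc k)"
  proof (rule dependent_nat_choice)
    show "\<exists>N. \<forall>m\<ge>N. \<forall>n\<ge>N. sqn (\<lambda>x. f m x - f n x) < (1/8)^0" using cauchy[of 1] by simp
    fix N k
    obtain N' where "\<forall>m\<ge>N'. \<forall>n\<ge>N'. sqn (\<lambda>x. f m x - f n x) < (1/8)^Suc k"
      using cauchy[of "(1/8)^Suc k"] by auto
    then show "\<exists>N'. (\<forall>m\<ge>N'. \<forall>n\<ge>N'. sqn (\<lambda>x. f m x - f n x) < (1/8)^Suc k) \<and> N < N'"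
      by (intro exI[of _ "max N' (Suc N)"]) auto
  qed
  then obtain N where N: "\<And>k m n. m \<ge> N k \<Longrightarrow> n \<ge> N k \<Longrightarrow> sqn (\<lambda>x. f m x - f n x) < (1/8)^k"
    and sm: "strict_mono N" by (auto simp: strict_mono_Suc_iff)
  have "sqn (\<lambda>x. f (N m) x - f (N n) x) \<le> (1/8)^n" if "n \<le> m" for m n
    using that strict_mono_less_eq[OF sm, of n m] by (intro less_imp_le[OF N]) simp_all
  then obtain g where g: "L2_cell g" "\<And>n. sqn (\<lambda>x. f (N n) x - g x) \<le> (1/8)^n"
    using L2_complete_summable[of "\<lambda>n. f (N n)"] L2 by blast
  have "(\<lambda>n. sqn (\<lambda>x. f n x - g x)) \<longlonglongrightarrow> 0"
  proof (rule LIMSEQ_I)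
    fix r :: real assume "r > 0"
    \<comment> \<open>The quarter absorbs two errors of size at most \<open>(1/8)^k\<close>, each of
      which is doubled by \<open>sqn_add_le\<close>.\<close>
    then obtain k where k: "(1/8)^k < r / 4"
      using real_arch_pow_inv[of "r/4" "1/8"] by auto
    have "sqn (\<lambda>x. f n x - g x) < r" if "n \<ge> N k" for n
    proof -
      have "sqn (\<lambda>x. f n x - g x) = sqn (\<lambda>x. (f n x - f (N k) x) + (f (N k) x - g x))" by simp
      also have "\<dots> \<le> 2 * sqn (\<lambda>x. f n x - f (N k) x) + 2 * sqn (\<lambda>x. f (N k) x - g x)"
        using L2 g(1) by (intro sqn_add_le L2_cell_diff)
      also have "\<dots> < r" using N[of k n "N k"] that g(2)[of k] k by simp
      finally show ?thesis .
    qed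
    then show "\<exists>no. \<forall>n\<ge>no. norm (sqn (\<lambda>x. f n x - g x) - 0) < r"
      by (intro exI[of _ "N k"]) (simp add: sqn_nonneg)
  qed
  with g(1) show ?thesis by (intro exI conjI)
qed

section \<open>Smooth periodic functions\<close>

lemma partial_eqI: "(f has_derivative f') (at x) \<Longrightarrow> partial k f x = f' (axis k 1)"
  unfolding partial_def using frechet_derivative_at by metis

lemma has_derivative_grad:
  assumes "f differentiable (at x)"
  shows "(f has_derivative (\<lambda>h. grad f x \<bullet> h)) (at x)"
proof -
  let ?D = "frechet_derivative f (at x)"
  have D: "(f has_derivative ?D) (at x)" using assms by (simp add: frechet_derivative_works)
  then interpret bounded_linear ?D by (rule has_derivative_bounded_linear)
  have "?D h = grad f x \<bullet> h" for h
  proof -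
    have "?D h = ?D (h $ 1 *\<^sub>R axis 1 1 + h $ 2 *\<^sub>R axis 2 1)"
      by (rule arg_cong[where f="?D"]) (simp add: vec_eq_iff forall_2 axis_def)
    also have "\<dots> = grad f x \<bullet> h"
      by (simp add: add scaleR grad_def partial_def inner_vec_def sum_2 mult.commute)
    finally show ?thesis .
  qed
  then have "?D = (\<lambda>h. grad f x \<bullet> h)" by (rule ext)
  then show ?thesis using D by simp
qed

lemma has_real_derivative_along_axis:
  assumes "f differentiable (at (x + t *\<^sub>R axis k 1))"
  shows "((\<lambda>s. f (x + s *\<^sub>R axis k 1)) has_real_derivative partial k f (x + t *\<^sub>R axis k 1)) (at t within S)"
proof -
  have "((\<lambda>s. x + s *\<^sub>R axis k 1) has_derivative (\<lambda>s. s *\<^sub>R axis k 1)) (at t within S)"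
    by (auto intro!: derivative_eq_intros)
  from has_derivative_compose[OF this has_derivative_grad[OF assms]]
  show ?thesis
    by (simp add: has_field_derivative_def grad_def inner_axis mult_commute_abs mult.commute)
qed

section \<open>Product coordinates and iterated integrals over the cell\<close>

definition pt :: "real \<Rightarrow> real \<Rightarrow> real^2" where
  "pt s t = vector [s, t]"

lemma pt_nth [simp]: "pt s t $ 1 = s" "pt s t $ 2 = t"
  by (simp_all add: pt_def)

lemma pt_eta [simp]: "pt (x $ 1) (x $ 2) = x"
  by (simp add: vec_eq_iff forall_2)

lemma pt_add_axis: "pt s t = pt 0 t + s *\<^sub>R axis 1 1" "pt s t = pt s 0 + t *\<^sub>R axis 2 1"
  by (simp_all add: vec_eq_iff forall_2 axis_def)

lemma continuous_on_pt [continuous_intros]: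
  assumes "continuous_on A f" "continuous_on A g"
  shows "continuous_on A (\<lambda>x. pt (f x) (g x))"
proof -
  have "(\<lambda>x. pt (f x) (g x)) = (\<lambda>x. f x *\<^sub>R axis 1 1 + g x *\<^sub>R axis 2 1)"
    by (simp add: fun_eq_iff vec_eq_iff forall_2 axis_def)
  then show ?thesis by (simp only:) (intro continuous_intros assms)
qed

lemma continuous_on_compose_pt:
  assumes "continuous_on UNIV F" "continuous_on A f" "continuous_on A g"
  shows "continuous_on A (\<lambda>x. F (pt (f x) (g x)))"
  by (rule continuous_on_compose2[OF assms(1)]) (auto intro: continuous_on_pt assms)

lemma cbox_pt: "(\<lambda>(s, t). pt s t) ` cbox (a, b) (c, d) = cbox (pt a b) (pt c d)"
proof -
  have "x \<in> (\<lambda>(s, t). pt s t) ` cbox (a, b) (c, d)" if "x \<in> cbox (pt a b) (pt c d)" for x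
    using that by (intro image_eqI[of _ _ "(x $ 1, x $ 2)"]) (auto simp: mem_box_cart forall_2 cbox_Pair_eq)
  then show ?thesis by (auto simp: mem_box_cart forall_2 cbox_Pair_eq)
qed

lemma image_pt:
  fixes u v :: "real^2"
  shows "(\<lambda>x. (x $ 1, x $ 2)) ` cbox u v = cbox (u $ 1, u $ 2) (v $ 1, v $ 2)"
proof -
  have "p \<in> (\<lambda>x. (x $ 1, x $ 2)) ` cbox u v"
    if "p \<in> cbox (u $ 1, u $ 2) (v $ 1, v $ 2)" for p
    using that by (intro image_eqI[of _ _ "pt (fst p) (snd p)"])
      (auto simp: mem_box_cart forall_2 cbox_Pair_eq)
  then show ?thesis by (auto simp: mem_box_cart cbox_Pair_eq)
qed

lemma content_cbox_pt: "measure lborel (cbox (pt a b) (pt c d)) = measure lborel (cbox (a, b) (c, d))"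
proof (cases "a \<le> c \<and> b \<le> d")
  case True
  then have "cbox (pt a b) (pt c d) \<noteq> {}" by (auto simp: interval_ne_empty_cart forall_2)
  then show ?thesis using True by (simp add: content_cbox_cart UNIV_2 content_Pair)
next
  case False
  then have "\<exists>i. pt c d $ i < pt a b $ i" by (metis not_le pt_nth)
  then have "cbox (pt a b) (pt c d) = {}" by (simp add: interval_eq_empty_cart)
  then show ?thesis using False by (auto simp: content_Pair)
qed

text \<open>The bijection between vectors and pairs maps boxes to boxes of the same area, so the
  integral is transported with factor 1. Continuity identifies the Lebesgue integral with the gauge
  integral, for which the transport and the exchange of iterated integrals are carried out.\<close>

lemma LINT_cell_eq_integral:
  assumes "continuous_on UNIV F"
  shows "(LINT x|\<mu>. F x) = integral (cbox (0, 0) (1, 1)) (\<lambda>(s, t). F (pt s t :: real^2) :: real)"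
proof -
  have c: "continuous_on cell F" using assms continuous_on_subset by blast
  have FI: "(F has_integral (LINT x|\<mu>. F x)) cell"
    using c by (intro has_integral_integral_lebesgue_on L2_cell_integrable L2_cell_continuous) auto
  have "((\<lambda>p. F ((\<lambda>(s, t). pt s t) p)) has_integral (1 / 1) *\<^sub>R (LINT x|\<mu>. F x)) ((\<lambda>x. (x $ 1, x $ 2)) ` cell)"
  proof (rule has_integral_twiddle[where r=1])
    show "((case p of (s, t) \<Rightarrow> pt s t) $ 1, (case p of (s, t) \<Rightarrow> pt s t) $ 2) = p" for p
      by (cases p) simp
    show "(case (x $ 1, x $ 2) of (s, t) \<Rightarrow> pt s t) = x" for x :: "real^2" by simp
    show "continuous (at p) (\<lambda>(s, t). pt s t)" for p
      unfolding case_prod_beta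
      by (rule continuous_on_interior[of UNIV]) (intro continuous_on_pt continuous_on_fst continuous_on_snd continuous_on_id, simp)
    show "\<exists>w z. (\<lambda>(s, t). pt s t) ` cbox u v = cbox w z" for u v
      by (cases u, cases v) (auto simp: cbox_pt)
    show "\<exists>w z. (\<lambda>x. (x $ 1, x $ 2)) ` cbox u v = cbox w z" for u v :: "real^2"
      by (auto simp: image_pt)
    show "measure lborel ((\<lambda>(s, t). pt s t) ` cbox u v) = 1 * measure lborel (cbox u v)" for u v
      by (cases u, cases v) (simp add: cbox_pt content_cbox_pt)
    show "(F has_integral (LINT x|\<mu>. F x)) cell" by (rule FI)
  qed simp
  moreover have "(\<lambda>x. (x $ 1, x $ 2)) ` cell = cbox (0, 0) (1, 1::real)"
    by (simp add: image_pt)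
  ultimately show ?thesis by (intro integral_unique[symmetric]) (simp add: case_prod_unfold)
qed

lemma LINT_cell_iterated:
  assumes "continuous_on UNIV F"
  shows "(LINT x|\<mu>. F x) = integral {0..1} (\<lambda>s. integral {0..1} (\<lambda>t. F (pt s t) :: real))"
    and "(LINT x|\<mu>. F x) = integral {0..1} (\<lambda>t. integral {0..1} (\<lambda>s. F (pt s t)))"
proof -
  have c: "continuous_on A (\<lambda>(s, t). F (pt s t))" for A
    unfolding case_prod_beta by (intro continuous_on_compose_pt continuous_intros assms)
  show 1: "(LINT x|\<mu>. F x) = integral {0..1} (\<lambda>s. integral {0..1} (\<lambda>t. F (pt s t)))"
    unfolding LINT_cell_eq_integral[OF assms] by (subst integral_prod_continuous[OF c]) simp
  show "(LINT x|\<mu>. F x) = integral {0..1} (\<lambda>t. integral {0..1} (\<lambda>s. F (pt s t)))"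
    using integral_swap_continuous[OF c, where a=0 and b=1 and c=0 and d=1] by (simp add: 1)
qed

lemma FTC_along_axis:
  assumes "\<And>x. f differentiable (at x)" "a \<le> b"
  shows "((\<lambda>s. partial k f (x + s *\<^sub>R axis k 1)) has_integral
    f (x + b *\<^sub>R axis k 1) - f (x + a *\<^sub>R axis k 1)) {a..b}"
  by (rule fundamental_theorem_of_calculus[OF assms(2)])
    (auto intro!: has_real_derivative_along_axis assms(1)
      simp flip: has_real_derivative_iff_has_vector_derivative)

lemma FTC_pt:
  assumes "\<And>x. f differentiable (at x)" "a \<le> b"
  shows "((\<lambda>s. partial 1 f (pt s t)) has_integral f (pt b t) - f (pt a t)) {a..b}"
    and "((\<lambda>t. partial 2 f (pt s t)) has_integral f (pt s b) - f (pt s a)) {a..b}"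
  using FTC_along_axis[OF assms, of 1 "pt 0 t"] FTC_along_axis[OF assms, of 2 "pt s 0"]
  by (simp_all flip: pt_add_axis)

text \<open>With the variable of differentiation innermost, the inner integral is a difference of
  values on opposite sides of the cell, which periodicity cancels.\<close>

lemma LINT_partial_eq_0:
  assumes d: "\<And>x. f differentiable (at x)" and c: "continuous_on UNIV (partial k f)"
    and per: "\<And>x. f (x + axis k 1) = f x"
  shows "(LINT x|\<mu>. partial k f x) = 0"
proof (cases "k = 1")
  case True
  have "f (pt 1 t) = f (pt 0 t)" for t
    using per[of "pt 0 t"] pt_add_axis(1)[of 1 t] True by simp
  then have "integral {0..1} (\<lambda>s. partial 1 f (pt s t)) = 0" for t
    using FTC_pt(1)[OF d, of 0 1 t] by (simp add: integral_unique)
  then show ?thesis using c by (simp add: LINT_cell_iterated(2) True)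
next
  case False
  then have k: "k = 2" using exhaust_2 by blast
  have "f (pt s 1) = f (pt s 0)" for s
    using per[of "pt s 0"] pt_add_axis(2)[of s 1] k by simp
  then have "integral {0..1} (\<lambda>t. partial 2 f (pt s t)) = 0" for s
    using FTC_pt(2)[OF d, of 0 1 s] by (simp add: integral_unique)
  then show ?thesis using c by (simp add: LINT_cell_iterated(1) k)
qed

lemma smooth_per_partial:
  assumes "smooth_per f" shows "smooth_per (partial k f)"
  unfolding smooth_per_def
proof (intro conjI allI)
  show "Ck n (partial k f)" for n using assms unfolding smooth_per_def by (metis Ck.simps(2))
  fix x j
  have d: "f differentiable (at y)" for y using assms unfolding smooth_per_def by (metis Ck.simps(2))
  have "((\<lambda>y. f (y + axis j 1)) has_derivative (\<lambda>h. grad f (x + axis j 1) \<bullet> h)) (at x)"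
  proof (rule has_derivative_compose[where g=f])
    show "((\<lambda>y. y + axis j 1) has_derivative (\<lambda>h. h)) (at x)" by (auto intro!: derivative_eq_intros)
  qed (rule has_derivative_grad[OF d])
  moreover have "(\<lambda>y. f (y + axis j 1)) = f" using assms by (auto simp: smooth_per_def)
  ultimately have "partial k f x = grad f (x + axis j 1) \<bullet> axis k 1"
    by (simp add: partial_eqI)
  then show "partial k f (x + axis j 1) = partial k f x" by (simp add: inner_axis grad_def)
qed

lemma smooth_per_differentiable: "smooth_per f \<Longrightarrow> f differentiable (at x)"
  unfolding smooth_per_def by (metis Ck.simps(2))

lemma smooth_per_continuous: "smooth_per f \<Longrightarrow> continuous_on A f"
  using smooth_per_differentiable differentiable_imp_continuous_within
  by (metis continuous_at_imp_continuous_on)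

lemma smooth_per_continuous_grad:
  assumes "smooth_per f" shows "continuous_on A (grad f)"
proof -
  have "grad f = (\<lambda>x. partial 1 f x *\<^sub>R axis 1 1 + partial 2 f x *\<^sub>R axis 2 1)"
    by (simp add: fun_eq_iff vec_eq_iff forall_2 axis_def grad_def)
  then show ?thesis
    by (simp only:) (intro continuous_intros smooth_per_continuous smooth_per_partial assms)
qed

lemma partial_lincomb:
  assumes "f differentiable (at x)" "g differentiable (at x)"
  shows "partial k (\<lambda>x. a * f x + b * g x) x = a * partial k f x + b * partial k g x"
  by (subst partial_eqI[OF has_derivative_add[OF
        has_derivative_mult_right[OF has_derivative_grad[OF assms(1)]]
        has_derivative_mult_right[OF has_derivative_grad[OF assms(2)]]]])
    (simp add: inner_axis grad_def)

lemma partial_mult: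
  assumes "f differentiable (at x)" "g differentiable (at x)"
  shows "partial k (\<lambda>x. f x * g x) x = f x * partial k g x + partial k f x * g x"
  by (subst partial_eqI[OF has_derivative_mult[OF
        has_derivative_grad[OF assms(1)] has_derivative_grad[OF assms(2)]]])
    (simp add: inner_axis grad_def)

lemma Ck_lincomb: "Ck n f \<Longrightarrow> Ck n g \<Longrightarrow> Ck n (\<lambda>x. a * f x + b * g x)"
proof (induction n arbitrary: f g)
  case 0
  then show ?case by (auto intro!: continuous_intros)
next
  case (Suc n)
  then have "partial k (\<lambda>x. a * f x + b * g x) = (\<lambda>x. a * partial k f x + b * partial k g x)" for k
    by (intro ext partial_lincomb) auto
  with Suc show ?case by (auto intro!: derivative_intros)
qed

lemma smooth_per_lincomb:
  "smooth_per f \<Longrightarrow> smooth_per g \<Longrightarrow> smooth_per (\<lambda>x. a * f x + b * g x)"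
  unfolding smooth_per_def by (auto intro: Ck_lincomb)

lemma grad_lincomb:
  assumes "smooth_per f" "smooth_per g"
  shows "grad (\<lambda>x. a * f x + b * g x) x = a *\<^sub>R grad f x + b *\<^sub>R grad g x"
  using assms by (simp add: grad_def vec_eq_iff partial_lincomb smooth_per_differentiable)

text \<open>A real Fourier mode with a free phase. The phase \<open>- pi / 2\<close> gives sines,
  \<open>m = n = 0\<close> gives constants and \<open>c = 0\<close> the zero function; a derivative
  only changes the amplitude and adds \<open>pi / 2\<close> to the phase. One family thus covers all
  trigonometric functions needed.\<close>

definition wave :: "real \<Rightarrow> int \<Rightarrow> int \<Rightarrow> real \<Rightarrow> real^2 \<Rightarrow> real" where
  "wave c m n t x = c * cos (2 * pi * (m * x $ 1 + n * x $ 2) + t)"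

lemma has_derivative_wave:
  "(wave c m n t has_derivative
     (\<lambda>h. - c * sin (2 * pi * (m * x $ 1 + n * x $ 2) + t) * (2 * pi * (m * h $ 1 + n * h $ 2)))) (at x)"
  unfolding wave_def
  by (auto intro!: derivative_eq_intros bounded_linear_imp_has_derivative bounded_linear_vec_nth
      simp: algebra_simps)

lemma partial_wave:
  "partial 1 (wave c m n t) = wave (2 * pi * m * c) m n (t + pi / 2)"
  "partial 2 (wave c m n t) = wave (2 * pi * n * c) m n (t + pi / 2)"
proof -
  have s: "cos (\<theta> + (t + pi / 2)) = - sin (\<theta> + t)" for \<theta>
    unfolding add.assoc[symmetric] cos_add[of _ "pi / 2"] by simp
  show "partial 1 (wave c m n t) = wave (2 * pi * m * c) m n (t + pi / 2)"
    "partial 2 (wave c m n t) = wave (2 * pi * n * c) m n (t + pi / 2)"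
    unfolding fun_eq_iff partial_eqI[OF has_derivative_wave]
    unfolding wave_def s by (simp_all add: axis_def)
qed

lemma Ck_wave: "Ck k (wave c m n t)"
proof (induction k arbitrary: c t)
  case 0
  show ?case by (simp add: wave_def) (intro continuous_intros)
next
  case (Suc k)
  then have "Ck k (partial j (wave c m n t))" for j
    using exhaust_2[of j] by (elim disjE) (simp_all only: partial_wave)
  then show ?case using differentiableI[OF has_derivative_wave] by simp
qed

lemma smooth_per_wave: "smooth_per (wave c m n t)"
proof -
  have "wave c m n t (x + axis k 1) = wave c m n t x" for x k
  proof -
    have c: "cos (\<theta> + 2 * pi * of_int j) = cos \<theta>" for \<theta> :: real and j
      unfolding cos_add by (simp add: cos_int_2pin sin_int_2pin)
    define \<theta> where "\<theta> = 2 * pi * (m * x $ 1 + n * x $ 2) + t"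
    have "2 * pi * (m * (x + axis 1 1) $ 1 + n * (x + axis 1 1) $ 2) + t = \<theta> + 2 * pi * m"
      "2 * pi * (m * (x + axis 2 1) $ 1 + n * (x + axis 2 1) $ 2) + t = \<theta> + 2 * pi * n"
      by (simp_all add: \<theta>_def axis_def distrib_left)
    then show ?thesis
      using exhaust_2[of k] unfolding wave_def by (elim disjE) (simp_all only: c \<theta>_def)
  qed
  then show ?thesis by (simp add: smooth_per_def Ck_wave)
qed

section \<open>Integration by parts and the Poincare inequality\<close>

text \<open>The second difference on the left is symmetric in \<open>i\<close> and \<open>j\<close>,
  while the right side singles out an order of differentiation. Dividing by \<open>h\<^sup>2\<close>
  and letting \<open>h\<close> tend to 0 therefore makes mixed derivatives commute.\<close>

lemma double_difference_MVT:
  assumes u: "smooth_per u" and h: "h > 0"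
  shows "\<exists>\<xi> \<eta>. 0 < \<xi> \<and> \<xi> < h \<and> 0 < \<eta> \<and> \<eta> < h \<and>
    u (x + h *\<^sub>R axis i 1 + h *\<^sub>R axis j 1) - u (x + h *\<^sub>R axis i 1) - u (x + h *\<^sub>R axis j 1) + u x
      = h\<^sup>2 * partial j (partial i u) (x + \<xi> *\<^sub>R axis i 1 + \<eta> *\<^sub>R axis j 1)"
proof -
  \<comment> \<open>The difference in direction \<open>j\<close>, as a function of the displacement
    in direction \<open>i\<close>; the mean value theorem is applied to it first, and then to the
    resulting derivative along \<open>j\<close>.\<close>
  let ?\<phi> = "\<lambda>s. u ((x + h *\<^sub>R axis j 1) + s *\<^sub>R axis i 1) - u (x + s *\<^sub>R axis i 1)"
  have "DERIV ?\<phi> s :> partial i u ((x + h *\<^sub>R axis j 1) + s *\<^sub>R axis i 1) - partial i u (x + s *\<^sub>R axis i 1)" for s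
    by (intro DERIV_diff has_real_derivative_along_axis smooth_per_differentiable u)
  from MVT2[OF h this] obtain \<xi> where \<xi>: "0 < \<xi>" "\<xi> < h"
    "?\<phi> h - ?\<phi> 0 = h * (partial i u (x + h *\<^sub>R axis j 1 + \<xi> *\<^sub>R axis i 1) - partial i u (x + \<xi> *\<^sub>R axis i 1))"
    by auto
  let ?\<psi> = "\<lambda>t. partial i u ((x + \<xi> *\<^sub>R axis i 1) + t *\<^sub>R axis j 1)"
  have "DERIV ?\<psi> t :> partial j (partial i u) ((x + \<xi> *\<^sub>R axis i 1) + t *\<^sub>R axis j 1)" for t
    by (intro has_real_derivative_along_axis smooth_per_differentiable smooth_per_partial u)
  from MVT2[OF h this] obtain \<eta> where \<eta>: "0 < \<eta>" "\<eta> < h"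
    "?\<psi> h - ?\<psi> 0 = h * partial j (partial i u) (x + \<xi> *\<^sub>R axis i 1 + \<eta> *\<^sub>R axis j 1)"
    by auto
  have "u (x + h *\<^sub>R axis i 1 + h *\<^sub>R axis j 1) - u (x + h *\<^sub>R axis i 1) - u (x + h *\<^sub>R axis j 1) + u x
      = ?\<phi> h - ?\<phi> 0"
    by (simp add: add_ac)
  also have "\<dots> = h * (?\<psi> h - ?\<psi> 0)" unfolding \<xi>(3) by (simp add: add_ac)
  also have "\<dots> = h\<^sup>2 * partial j (partial i u) (x + \<xi> *\<^sub>R axis i 1 + \<eta> *\<^sub>R axis j 1)"
    unfolding \<eta>(3) by (simp add: power2_eq_square)
  finally show ?thesis using \<xi>(1,2) \<eta>(1,2) by blast
qed

lemma double_difference_tendsto: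
  assumes u: "smooth_per u"
  shows "((\<lambda>h. (u (x + h *\<^sub>R axis i 1 + h *\<^sub>R axis j 1) - u (x + h *\<^sub>R axis i 1)
      - u (x + h *\<^sub>R axis j 1) + u x) / h\<^sup>2) \<longlongrightarrow> partial j (partial i u) x) (at_right 0)"
    (is "((\<lambda>h. ?D h / h\<^sup>2) \<longlongrightarrow> ?p x) _")
proof (rule tendstoI)
  fix e :: real assume "e > 0"
  have "isCont ?p x"
    using smooth_per_continuous[OF smooth_per_partial[OF smooth_per_partial[OF u]], of UNIV]
    by (simp add: continuous_on_eq_continuous_at)
  then obtain d where d: "d > 0" "\<And>y. dist y x < d \<Longrightarrow> dist (?p y) (?p x) < e"
    using \<open>e > 0\<close> unfolding continuous_at_eps_delta by blast
  have "dist (?D h / h\<^sup>2) (?p x) < e" if "0 < h" "h < d / 2" for h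
  proof -
    obtain \<xi> \<eta> where b: "0 < \<xi>" "\<xi> < h" "0 < \<eta>" "\<eta> < h"
      and D: "?D h = h\<^sup>2 * ?p (x + \<xi> *\<^sub>R axis i 1 + \<eta> *\<^sub>R axis j 1)"
      using double_difference_MVT[OF u \<open>0 < h\<close>, of x i j] by blast
    have "norm (\<xi> *\<^sub>R axis i 1 + \<eta> *\<^sub>R axis j 1 :: real^2) \<le> \<xi> + \<eta>"
      using norm_triangle_ineq[of "\<xi> *\<^sub>R axis i 1 :: real^2" "\<eta> *\<^sub>R axis j 1"] b by simp
    then have "dist (x + \<xi> *\<^sub>R axis i 1 + \<eta> *\<^sub>R axis j 1) x < d"
      using b that by (simp add: dist_norm add.assoc)
    then show ?thesis using d(2) D \<open>0 < h\<close> by simp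
  qed
  then show "\<forall>\<^sub>F h in at_right 0. dist (?D h / h\<^sup>2) (?p x) < e"
    using \<open>d > 0\<close> by (intro eventually_at_rightI[of 0 "d / 2"]) auto
qed

lemma partial_commute:
  assumes "smooth_per u" shows "partial i (partial j u) x = partial j (partial i u) x"
proof -
  have "((\<lambda>h. (u (x + h *\<^sub>R axis i 1 + h *\<^sub>R axis j 1) - u (x + h *\<^sub>R axis i 1)
      - u (x + h *\<^sub>R axis j 1) + u x) / h\<^sup>2) \<longlongrightarrow> partial i (partial j u) x) (at_right 0)"
    using double_difference_tendsto[OF assms, of x j i] by (simp add: algebra_simps)
  from tendsto_unique[OF _ this double_difference_tendsto[OF assms]] show ?thesis by simp
qed

lemma R_perp_mult: "R_perp *v a = vector [- (a $ 2), a $ 1]"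
  by (simp add: R_perp_def vec_eq_iff forall_2 matrix_vector_mult_def sum_2)

lemma LINT_smooth_per_partial:
  assumes "smooth_per f" shows "(LINT x|\<mu>. partial k f x) = 0"
proof (rule LINT_partial_eq_0)
  show "f (x + axis k 1) = f x" for x using assms by (simp add: smooth_per_def)
qed (intro smooth_per_differentiable smooth_per_continuous smooth_per_partial assms)+

lemma LINT_smooth_per_partial_mult:
  assumes "smooth_per f" "smooth_per g"
  shows "(LINT x|\<mu>. f x * partial k g x) = - (LINT x|\<mu>. partial k f x * g x)"
proof -
  have p: "partial k (\<lambda>x. f x * g x) = (\<lambda>x. f x * partial k g x + partial k f x * g x)"
    by (intro ext partial_mult smooth_per_differentiable assms)
  have c: "continuous_on A f" "continuous_on A g" "continuous_on A (partial k f)" "continuous_on A (partial k g)" for A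
    by (intro smooth_per_continuous smooth_per_partial assms)+
  have "(LINT x|\<mu>. partial k (\<lambda>x. f x * g x) x) = 0"
  proof (rule LINT_partial_eq_0)
    show "(\<lambda>x. f x * g x) differentiable at x" for x
      by (intro differentiable_mult smooth_per_differentiable assms)
    show "continuous_on UNIV (partial k (\<lambda>x. f x * g x))"
      unfolding p by (intro continuous_on_add continuous_on_mult c)
  qed (use assms in \<open>simp add: smooth_per_def\<close>)
  moreover have "integrable \<mu> (\<lambda>x. f x * partial k g x)" "integrable \<mu> (\<lambda>x. partial k f x * g x)"
    by (intro L2_cell_integrable L2_cell_continuous continuous_on_mult c)+
  ultimately show ?thesis unfolding p by simp
qed

text \<open>The integrand is the Jacobian determinant of \<open>(u, v)\<close>, a null Lagrangian:
  integrating by parts twice turns each of its two products into the other. This is the reason why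
  rotated gradients are divergence-free.\<close>

lemma LINT_rotated_grad_inner_grad:
  assumes u: "smooth_per u" and v: "smooth_per v"
  shows "(LINT x|\<mu>. (R_perp *v grad u x) \<bullet> grad v x) = 0"
proof -
  note s = u v smooth_per_partial[OF u] smooth_per_partial[OF v]
  have i: "integrable \<mu> (\<lambda>x. partial j u x * partial k v x)" for j k
    by (intro L2_cell_integrable L2_cell_continuous continuous_on_mult smooth_per_continuous s)
  have "(LINT x|\<mu>. (R_perp *v grad u x) \<bullet> grad v x)
      = (LINT x|\<mu>. partial 1 u x * partial 2 v x - partial 2 u x * partial 1 v x)"
    by (simp add: R_perp_mult inner_vec_def sum_2 grad_def)
  also have "\<dots> = (LINT x|\<mu>. partial 1 u x * partial 2 v x) - (LINT x|\<mu>. partial 2 u x * partial 1 v x)"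
    using i by simp
  also have "\<dots> = 0"
    by (simp add: LINT_smooth_per_partial_mult s partial_commute[OF u, of 2 1])
  finally show ?thesis .
qed

text \<open>Cauchy-Schwarz against the constant 1 on an interval of length at most 1. The bound uses
  the full unit interval so that it no longer depends on the endpoints.\<close>

lemma integral_square_le:
  fixes g :: "real \<Rightarrow> real"
  assumes g: "continuous_on {0..1} g" and ab: "0 \<le> a" "a \<le> b" "b \<le> 1"
  shows "(integral {a..b} g)\<^sup>2 \<le> integral {0..1} (\<lambda>x. (g x)\<^sup>2)"
proof -
  have g': "continuous_on {a..b} g" using g ab by (rule_tac continuous_on_subset) auto
  have i: "g integrable_on {a..b}" "(\<lambda>x. (g x)\<^sup>2) integrable_on {a..b}"
    by (intro integrable_continuous_real continuous_intros g')+
  have "(integral {a..b} g)\<^sup>2 \<le> integral {a..b} (\<lambda>x. (g x)\<^sup>2) * (b - a)"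
  proof (rule nonneg_quadratic_imp_discriminant)
    fix t
    have "0 \<le> integral {a..b} (\<lambda>x. (g x + t)\<^sup>2)"
      by (intro integral_nonneg integrable_continuous_real continuous_intros g') auto
    also have "(\<lambda>x. (g x + t)\<^sup>2) = (\<lambda>x. (g x)\<^sup>2 + (2 * t * g x + t\<^sup>2))"
      by (simp add: fun_eq_iff power2_sum algebra_simps)
    also have "integral {a..b} \<dots> = integral {a..b} (\<lambda>x. (g x)\<^sup>2) + (2 * t * integral {a..b} g + t\<^sup>2 * (b - a))"
      using ab has_integral_const_real[of "t\<^sup>2" a b]
      by (intro integral_unique has_integral_add integrable_integral i has_integral_mult_right)
        (simp add: mult.commute)
    finally show "0 \<le> integral {a..b} (\<lambda>x. (g x)\<^sup>2) + 2 * t * integral {a..b} g + t\<^sup>2 * (b - a)"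
      by simp
  qed (use ab in simp)
  also have "\<dots> \<le> integral {a..b} (\<lambda>x. (g x)\<^sup>2) * 1"
    using ab by (intro mult_left_mono integral_nonneg i) auto
  also have "\<dots> \<le> integral {0..1} (\<lambda>x. (g x)\<^sup>2)"
    using ab by (simp, intro integral_subset_le i integrable_continuous_real continuous_intros g) auto
  finally show ?thesis .
qed

lemma variation_along_axis_le:
  assumes u: "smooth_per u" and "a \<in> {0..1}" "b \<in> {0..1}"
  shows "(u (pt b t) - u (pt a t))\<^sup>2 \<le> integral {0..1} (\<lambda>s. (partial 1 u (pt s t))\<^sup>2)"
    and "(u (pt s b) - u (pt s a))\<^sup>2 \<le> integral {0..1} (\<lambda>t. (partial 2 u (pt s t))\<^sup>2)"
proof -
  note d = smooth_per_differentiable[OF u]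
  have c: "continuous_on A (\<lambda>s. partial 1 u (pt s t))" "continuous_on A (\<lambda>t. partial 2 u (pt s t))" for A
    by (rule continuous_on_compose_pt[OF smooth_per_continuous[OF smooth_per_partial[OF u]]];
        intro continuous_on_id continuous_on_const)+
  have 1: "(u (pt b t) - u (pt a t))\<^sup>2 \<le> integral {0..1} (\<lambda>s. (partial 1 u (pt s t))\<^sup>2)"
    "(u (pt s b) - u (pt s a))\<^sup>2 \<le> integral {0..1} (\<lambda>t. (partial 2 u (pt s t))\<^sup>2)"
    if "0 \<le> a" "a \<le> b" "b \<le> 1" for a b
    using integral_square_le[OF c(1) that] integral_square_le[OF c(2) that]
      integral_unique[OF FTC_pt(1)[OF d that(2)]] integral_unique[OF FTC_pt(2)[OF d that(2)]]
    by simp_all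
  show "(u (pt b t) - u (pt a t))\<^sup>2 \<le> integral {0..1} (\<lambda>s. (partial 1 u (pt s t))\<^sup>2)"
    using 1(1)[of a b] 1(1)[of b a] assms(2,3) by (cases "a \<le> b") (auto simp: power2_commute)
  show "(u (pt s b) - u (pt s a))\<^sup>2 \<le> integral {0..1} (\<lambda>t. (partial 2 u (pt s t))\<^sup>2)"
    using 1(2)[of a b] 1(2)[of b a] assms(2,3) by (cases "a \<le> b") (auto simp: power2_commute)
qed

lemma sqn_grad:
  assumes "smooth_per u"
  shows "sqn (grad u) = (LINT x|\<mu>. (partial 1 u x)\<^sup>2) + (LINT x|\<mu>. (partial 2 u x)\<^sup>2)"
proof -
  have "integrable \<mu> (\<lambda>x. (partial k u x)\<^sup>2)" for k
    by (intro L2_cell_integrable L2_cell_continuous continuous_intros smooth_per_continuous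
        smooth_per_partial assms)
  moreover have "(norm (grad u x))\<^sup>2 = (partial 1 u x)\<^sup>2 + (partial 2 u x)\<^sup>2" for x
    unfolding power2_norm_eq_inner by (simp add: inner_vec_def sum_2 grad_def power2_eq_square)
  ultimately show ?thesis by (simp add: sqn_def)
qed

text \<open>The point from which \<open>u\<close> is compared with its other values lies on the vertical line
  carrying the least energy of the vertical derivative.\<close>

lemma Poincare_some_constant:
  assumes u: "smooth_per u"
  shows "\<exists>c. sqn (\<lambda>x. u x - c) \<le> 2 * sqn (grad u)"
proof -
  define G1 where "G1 t = integral {0..1} (\<lambda>s. (partial 1 u (pt s t))\<^sup>2)" for t
  define G2 where "G2 s = integral {0..1} (\<lambda>t. (partial 2 u (pt s t))\<^sup>2)" for s
  note sc = smooth_per_continuous[OF u, of UNIV] smooth_per_continuous[OF smooth_per_partial[OF u], of UNIV]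
  have "continuous_on {0..1} (\<lambda>t. integral (cbox 0 1) (\<lambda>s. (partial 1 u (pt s t))\<^sup>2))"
    "continuous_on {0..1} (\<lambda>s. integral (cbox 0 1) (\<lambda>t. (partial 2 u (pt s t))\<^sup>2))"
    by (rule integral_continuous_on_param; simp add: case_prod_beta;
        intro continuous_intros continuous_on_compose_pt sc)+
  then have cG: "continuous_on {0..1} G1" "continuous_on {0..1} G2"
    by (simp_all add: G1_def[abs_def] G2_def[abs_def])
  obtain a where a: "a \<in> {0..1}" "\<And>s. s \<in> {0..1} \<Longrightarrow> G2 a \<le> G2 s"
    using continuous_attains_inf[OF _ _ cG(2)] by auto
  have "G2 a = integral {0..1} (\<lambda>s::real. G2 a)" by simp
  also have "\<dots> \<le> integral {0..1} G2"
    using a by (intro integral_le integrable_continuous_real cG continuous_intros) auto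
  also have "\<dots> = (LINT x|\<mu>. (partial 2 u x)\<^sup>2)"
    unfolding G2_def by (intro LINT_cell_iterated(1)[symmetric] continuous_intros sc)
  finally have G2a: "G2 a \<le> (LINT x|\<mu>. (partial 2 u x)\<^sup>2)" .
  define c where "c = u (pt a 0)"
  \<comment> \<open>The path runs vertically from \<open>pt a 0\<close> to \<open>pt a t\<close> and
    then horizontally to \<open>pt s t\<close>. The horizontal cost depends only on
    \<open>t\<close>, and the vertical one is the fixed number \<open>G2 a\<close>.\<close>
  have ptw: "(u (pt s t) - c)\<^sup>2 \<le> 2 * G1 t + 2 * G2 a" if "s \<in> {0..1}" "t \<in> {0..1}" for s t
  proof -
    have "(u (pt s t) - c)\<^sup>2 \<le> 2 * (u (pt s t) - u (pt a t))\<^sup>2 + 2 * (u (pt a t) - u (pt a 0))\<^sup>2"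
      using norm_add_sq_le[of "u (pt s t) - u (pt a t)" "u (pt a t) - u (pt a 0)"] by (simp add: c_def)
    also have "\<dots> \<le> 2 * G1 t + 2 * G2 a"
      using variation_along_axis_le[OF u, of a s t] variation_along_axis_le[OF u, of 0 t a] that a(1)
      unfolding G1_def G2_def by (intro add_mono mult_left_mono) auto
    finally show ?thesis .
  qed
  have cu: "continuous_on A (\<lambda>s. (u (pt s t) - c)\<^sup>2)" for A t
    by (intro continuous_on_power continuous_on_diff continuous_on_const
        continuous_on_compose_pt sc(1) continuous_on_id)
  have inner: "integral {0..1} (\<lambda>s. (u (pt s t) - c)\<^sup>2) \<le> 2 * G1 t + 2 * G2 a" if "t \<in> {0..1}" for t
  proof -
    have "integral {0..1} (\<lambda>s. (u (pt s t) - c)\<^sup>2) \<le> integral {0..1} (\<lambda>s::real. 2 * G1 t + 2 * G2 a)"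
    proof (rule integral_le)
      show "(\<lambda>s. (u (pt s t) - c)\<^sup>2) integrable_on {0..1}"
        by (intro integrable_continuous_real cu)
    qed (use ptw that in auto)
    then show ?thesis by simp
  qed
  have "continuous_on {0..1} (\<lambda>t. integral (cbox 0 1) (\<lambda>s. (u (pt s t) - c)\<^sup>2))"
    by (rule integral_continuous_on_param; simp add: case_prod_beta;
        intro continuous_intros continuous_on_compose_pt sc)
  then have co: "continuous_on {0..1} (\<lambda>t. integral {0..1} (\<lambda>s. (u (pt s t) - c)\<^sup>2))" by simp
  have "sqn (\<lambda>x. u x - c) = (LINT x|\<mu>. (u x - c)\<^sup>2)" by (simp add: sqn_def)
  also have "\<dots> = integral {0..1} (\<lambda>t. integral {0..1} (\<lambda>s. (u (pt s t) - c)\<^sup>2))"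
    by (intro LINT_cell_iterated(2) continuous_intros sc)
  also have "\<dots> \<le> integral {0..1} (\<lambda>t. 2 * G1 t + 2 * G2 a)"
  proof (rule integral_le)
    show "(\<lambda>t. 2 * G1 t + 2 * G2 a) integrable_on {0..1}"
      by (intro integrable_continuous_real continuous_intros cG)
  qed (use inner integrable_continuous_real[OF co] in auto)
  also have "\<dots> = 2 * integral {0..1} G1 + 2 * G2 a"
    using has_integral_add[OF has_integral_mult_right[OF integrable_integral[OF
          integrable_continuous_real[OF cG(1)]]] has_integral_const_real[of "2 * G2 a" 0 1], of 2]
    by (simp add: integral_unique)
  also have "integral {0..1} G1 = (LINT x|\<mu>. (partial 1 u x)\<^sup>2)"
    unfolding G1_def by (intro LINT_cell_iterated(2)[symmetric] continuous_intros sc)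
  finally have "sqn (\<lambda>x. u x - c) \<le> 2 * sqn (grad u)"
    using G2a by (simp add: sqn_grad[OF u])
  then show ?thesis by blast
qed

text \<open>Pythagoras: after subtraction of its mean, \<open>u\<close> is orthogonal to constants,
  so any other constant adds a nonnegative term. This replaces the unspecified constant of the
  previous lemma by the mean.\<close>

lemma sqn_diff_mean_le:
  fixes u :: "real^2 \<Rightarrow> real"
  assumes "L2_cell u" shows "sqn (\<lambda>x. u x - (LINT y|\<mu>. u y)) \<le> sqn (\<lambda>x. u x - c)"
proof -
  define m where "m = (LINT y|\<mu>. u y)"
  have L: "L2_cell (\<lambda>x. u x - m)" "L2_cell (\<lambda>x. 1::real)"
    by (rule L2_cell_diff[OF assms L2_cell_const], rule L2_cell_const)
  have "(LINT x|\<mu>. (u x - m) \<bullet> 1) = (LINT x|\<mu>. u x) - (LINT x|\<mu>. m)"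
    using L2_cell_integrable[OF assms] by simp
  then have 0: "(LINT x|\<mu>. (u x - m) \<bullet> 1) = 0" by (simp only: LINT_cell_const m_def[symmetric])
  have "(\<lambda>x. u x - c) = (\<lambda>x. (u x - m) + (m - c) *\<^sub>R 1)" by (simp add: fun_eq_iff)
  then have "sqn (\<lambda>x. u x - c) = sqn (\<lambda>x. u x - m) + (m - c)\<^sup>2 * sqn (\<lambda>x. 1::real)"
    using sqn_add_scaled[OF L, of "m - c"] unfolding 0 by simp
  moreover have "(m - c)\<^sup>2 * sqn (\<lambda>x. 1::real) \<ge> 0" by (intro mult_nonneg_nonneg sqn_nonneg) simp
  ultimately show ?thesis unfolding m_def by linarith
qed

lemma Poincare:
  assumes "smooth_per u" shows "sqn (\<lambda>x. u x - (LINT y|\<mu>. u y)) \<le> 2 * sqn (grad u)"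
proof -
  obtain c where c: "sqn (\<lambda>x. u x - c) \<le> 2 * sqn (grad u)" using Poincare_some_constant[OF assms] by blast
  have "L2_cell u" by (intro L2_cell_continuous smooth_per_continuous assms)
  from order_trans[OF sqn_diff_mean_le[OF this] c] show ?thesis .
qed

section \<open>Variational problems for two-phase coefficients\<close>

lemma two_phase_mult:
  "two_phase A1 A2 L1 L2 x *v v = indicator A1 x *\<^sub>R (L1 *v v) + indicator A2 x *\<^sub>R (L2 *v v)"
  for v :: "real^'n"
  by (simp add: two_phase_def matrix_vector_mult_add_rdistrib flip: scaleR_matrix_vector_assoc)

lemma two_phase_simps:
  assumes "two_phase_cell A1 A2"
  shows "x \<in> A1 \<Longrightarrow> two_phase A1 A2 a b x = a" "x \<in> A2 \<Longrightarrow> two_phase A1 A2 a b x = b"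
  using assms by (auto simp: two_phase_def two_phase_cell_def indicator_def)

lemma L2_cell_two_phase_mult:
  fixes f :: "real^2 \<Rightarrow> real^'n"
  assumes "two_phase_cell A1 A2" "L2_cell f"
  shows "L2_cell (\<lambda>x. two_phase A1 A2 L1 L2 x *v f x)"
  unfolding two_phase_mult
  using assms(1) by (intro L2_cell_add L2_cell_indicator L2_cell_linear[OF assms(2)]
      matrix_vector_mul_bounded_linear) (auto simp: two_phase_cell_def)

lemma sym_pos_def_commute:
  fixes u v :: "real^'n"
  assumes "sym_pos_def A" shows "(A *v u) \<bullet> v = u \<bullet> (A *v v)"
proof -
  have "(transpose A *v u) \<bullet> v = u \<bullet> (A *v v)"
    unfolding transpose_matrix_vector dot_lmul_matrix ..
  moreover have "transpose A = A" using assms by (simp add: sym_pos_def_def)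
  ultimately show ?thesis by (simp only:)
qed

lemma sym_pos_def_coercive:
  fixes A :: "real^'n^'n"
  assumes "sym_pos_def A" shows "\<exists>c>0. \<forall>v. c * (norm v)\<^sup>2 \<le> v \<bullet> (A *v v)"
proof -
  have cont: "continuous_on (sphere 0 1) (\<lambda>v. v \<bullet> (A *v v))"
    by (intro continuous_intros linear_continuous_on matrix_vector_mul_bounded_linear)
  obtain e :: "real^'n" where "norm e = 1" using vector_choose_size[of 1] by auto
  then have "sphere (0::real^'n) 1 \<noteq> {}" by auto
  then obtain a where a: "norm a = 1" "\<And>v. norm v = 1 \<Longrightarrow> a \<bullet> (A *v a) \<le> v \<bullet> (A *v v)"
    using continuous_attains_inf[OF compact_sphere _ cont] by auto
  have "(a \<bullet> (A *v a)) * (norm v)\<^sup>2 \<le> v \<bullet> (A *v v)" for v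
  proof (cases "v = 0")
    case False
    define w where "w = v /\<^sub>R norm v"
    have w: "v = norm v *\<^sub>R w" "norm w = 1" using False by (simp_all add: w_def)
    have "v \<bullet> (A *v v) = (norm v *\<^sub>R w) \<bullet> (A *v (norm v *\<^sub>R w))" using w(1) by simp
    also have "\<dots> = (w \<bullet> (A *v w)) * (norm v)\<^sup>2"
      by (simp add: matrix_vector_mult_scaleR power2_eq_square)
    finally show ?thesis using a(2)[OF w(2)] by (simp only: mult_right_mono zero_le_power2)
  qed simp
  moreover have "a \<bullet> (A *v a) > 0"
  proof -
    have "a \<noteq> 0" using a(1) by auto
    then show ?thesis using assms by (simp add: sym_pos_def_def)
  qed
  ultimately show ?thesis by blast
qed

lemma two_phase_commute:
  fixes u v :: "real^'n"
  assumes "sym_pos_def L1" "sym_pos_def L2"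
  shows "(two_phase A1 A2 L1 L2 x *v u) \<bullet> v = u \<bullet> (two_phase A1 A2 L1 L2 x *v v)"
  by (simp add: two_phase_mult inner_simps sym_pos_def_commute[OF assms(1)] sym_pos_def_commute[OF assms(2)])

lemma two_phase_coercive:
  fixes L1 L2 :: "real^'n^'n"
  assumes "two_phase_cell A1 A2" "sym_pos_def L1" "sym_pos_def L2"
  shows "\<exists>c>0. \<forall>f. L2_cell f \<longrightarrow> c * sqn f \<le> (LINT x|\<mu>. (two_phase A1 A2 L1 L2 x *v f x) \<bullet> f x)"
proof -
  obtain c1 where c1: "c1 > 0" "\<And>v. c1 * (norm v)\<^sup>2 \<le> v \<bullet> (L1 *v v)"
    using sym_pos_def_coercive[OF assms(2)] by blast
  obtain c2 where c2: "c2 > 0" "\<And>v. c2 * (norm v)\<^sup>2 \<le> v \<bullet> (L2 *v v)"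
    using sym_pos_def_coercive[OF assms(3)] by blast
  have ptw: "min c1 c2 * (norm v)\<^sup>2 \<le> (two_phase A1 A2 L1 L2 x *v v) \<bullet> v" if "x \<in> cell" for x v
  proof -
    have m: "min c1 c2 * (norm v)\<^sup>2 \<le> c1 * (norm v)\<^sup>2" "min c1 c2 * (norm v)\<^sup>2 \<le> c2 * (norm v)\<^sup>2"
      by (intro mult_right_mono; simp)+
    have "x \<in> A1 \<or> x \<in> A2" using that assms(1) by (auto simp: two_phase_cell_def)
    then have "two_phase A1 A2 L1 L2 x = L1 \<or> two_phase A1 A2 L1 L2 x = L2"
      using two_phase_simps[OF assms(1)] by blast
    then show ?thesis
      using order_trans[OF m(1) c1(2)] order_trans[OF m(2) c2(2)]
      by (elim disjE) (simp_all only: inner_commute[of _ v])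
  qed
  show ?thesis
  proof (intro exI[of _ "min c1 c2"] conjI allI impI)
    fix f :: "real^2 \<Rightarrow> real^'n" assume f: "L2_cell f"
    have "min c1 c2 * sqn f = (LINT x|\<mu>. min c1 c2 * (norm (f x))\<^sup>2)" by (simp add: sqn_def)
    also have "\<dots> \<le> (LINT x|\<mu>. (two_phase A1 A2 L1 L2 x *v f x) \<bullet> f x)"
      using f by (intro integral_mono L2_cell_inner_integrable L2_cell_two_phase_mult[OF assms(1)]
          integrable_mult_right L2_cell_sq_integrable ptw) (simp_all add: space_restrict_space)
    finally show "min c1 c2 * sqn f \<le> (LINT x|\<mu>. (two_phase A1 A2 L1 L2 x *v f x) \<bullet> f x)" .
  qed (use c1(1) c2(1) in simp)
qed

lemma two_phase_form_expand:
  fixes L1 L2 :: "real^'n^'n"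
  assumes "two_phase_cell A1 A2" "sym_pos_def L1" "sym_pos_def L2" "L2_cell f" "L2_cell g"
  defines "L \<equiv> two_phase A1 A2 L1 L2"
  shows "(LINT x|\<mu>. (L x *v (f x + t *\<^sub>R g x)) \<bullet> (f x + t *\<^sub>R g x))
    = (LINT x|\<mu>. (L x *v f x) \<bullet> f x) + 2 * t * (LINT x|\<mu>. (L x *v f x) \<bullet> g x)
      + t\<^sup>2 * (LINT x|\<mu>. (L x *v g x) \<bullet> g x)"
proof -
  note Lm = L2_cell_two_phase_mult[OF assms(1)]
  have i: "integrable \<mu> (\<lambda>x. (L x *v f x) \<bullet> f x)" "integrable \<mu> (\<lambda>x. (L x *v f x) \<bullet> g x)"
    "integrable \<mu> (\<lambda>x. (L x *v g x) \<bullet> g x)"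
    unfolding L_def by (intro L2_cell_inner_integrable Lm assms(4,5))+
  have s: "(L x *v g x) \<bullet> f x = (L x *v f x) \<bullet> g x" for x
    unfolding L_def two_phase_commute[OF assms(2,3), where u="g x" and v="f x"] by (rule inner_commute)
  have "(L x *v (f x + t *\<^sub>R g x)) \<bullet> (f x + t *\<^sub>R g x)
      = (L x *v f x) \<bullet> f x + 2 * t * ((L x *v f x) \<bullet> g x) + t\<^sup>2 * ((L x *v g x) \<bullet> g x)" for x
    unfolding matrix_vector_right_distrib matrix_vector_mult_scaleR
      inner_add_left inner_add_right inner_scaleR_left inner_scaleR_right s
    by (simp add: power2_eq_square algebra_simps)
  then show ?thesis using i by simp
qed

text \<open>The direct method on a space \<open>W\<close> that need not be complete. The minimiser
  is therefore sought in the closure, as the limit \<open>g\<close> of a minimising sequence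
  \<open>w\<close> in \<open>W\<close>; the sequence is part of the conclusion because membership in
  the Sobolev space is read off from it.\<close>

lemma variational_solution:
  fixes L1 L2 :: "real^'n^'n" and W :: "(real^2 \<Rightarrow> real^'n) set"
  assumes cell: "two_phase_cell A1 A2" and L1: "sym_pos_def L1" and L2: "sym_pos_def L2"
    and W: "\<And>w. w \<in> W \<Longrightarrow> L2_cell w" "W \<noteq> {}"
      "\<And>v w a. v \<in> W \<Longrightarrow> w \<in> W \<Longrightarrow> (\<lambda>x. v x + a *\<^sub>R w x) \<in> W"
  defines "L \<equiv> two_phase A1 A2 L1 L2"
  shows "\<exists>w g. (\<forall>n::nat. w n \<in> W) \<and> L2_cell g \<and> (\<lambda>n. sqn (\<lambda>x. w n x - g x)) \<longlonglongrightarrow> 0 \<and>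
    (\<forall>v\<in>W. (LINT x|\<mu>. (L x *v (E0 + g x)) \<bullet> v x) = 0)"
proof -
  define B where "B f g = (LINT x|\<mu>. (L x *v f x) \<bullet> g x)" for f g :: "real^2 \<Rightarrow> real^'n"
  have expand: "B (\<lambda>x. f x + t *\<^sub>R g x) (\<lambda>x. f x + t *\<^sub>R g x) = B f f + 2 * t * B f g + t\<^sup>2 * B g g"
    if "L2_cell f" "L2_cell g" for f g t
    unfolding B_def L_def by (rule two_phase_form_expand[OF cell L1 L2 that])
  obtain c where c: "c > 0" "\<And>f. L2_cell f \<Longrightarrow> c * sqn f \<le> B f f"
    using two_phase_coercive[OF cell L1 L2] unfolding B_def L_def by blast
  have pos: "B f f \<ge> 0" if "L2_cell f" for f
    using c(2)[OF that] c(1) sqn_nonneg[of f] mult_nonneg_nonneg[of c "sqn f"] by linarith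
  define Q where "Q w = B (\<lambda>x. E0 + w x) (\<lambda>x. E0 + w x)" for w
  have L2E: "L2_cell (\<lambda>x. E0 + w x)" if "w \<in> W" for w
    by (intro L2_cell_intros W that)
  define d where "d = Inf (Q ` W)"
  have bdd: "bdd_below (Q ` W)"
    by (rule bdd_belowI[of _ 0]) (auto simp: Q_def intro: pos L2E)
  have d_le: "d \<le> Q w" if "w \<in> W" for w
    unfolding d_def using that bdd by (intro cInf_lower) auto
  have "\<exists>w\<in>W. Q w < d + inverse (real (Suc n))" for n
  proof -
    have "Inf (Q ` W) < d + inverse (real (Suc n))" by (simp add: d_def)
    then show ?thesis using W(2) bdd by (subst (asm) cInf_less_iff) auto
  qed
  then obtain w where w: "\<And>n. w n \<in> W" "\<And>n. Q (w n) < d + inverse (real (Suc n))" by metis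
  have line: "Q (\<lambda>x. v x + t *\<^sub>R u x) = Q v + 2 * t * B (\<lambda>x. E0 + v x) u + t\<^sup>2 * B u u"
    if "v \<in> W" "u \<in> W" for v u t
    using expand[OF L2E[OF that(1)] W(1)[OF that(2)], of t] by (simp add: Q_def add.assoc)
  \<comment> \<open>The midpoint of two almost-minimisers has energy at least \<open>d\<close>, so
    the strictly convex energy bounds their distance by the two defects.\<close>
  have cauchy: "c * sqn (\<lambda>x. w m x - w n x) \<le> 2 * (inverse (real (Suc m)) + inverse (real (Suc n)))" for m n
  proof -
    define u where "u = (\<lambda>x. w m x + (-1) *\<^sub>R w n x)"
    have u: "u \<in> W" unfolding u_def by (intro W w)
    have "(\<lambda>x. w n x + (1/2) *\<^sub>R u x) \<in> W" by (intro W w u)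
    from d_le[OF this] have mid: "d \<le> Q (w n) + B (\<lambda>x. E0 + w n x) u + B u u / 4"
      by (simp add: line[OF w(1) u] power2_eq_square)
    have "(\<lambda>x. w n x + 1 *\<^sub>R u x) = w m" by (simp add: u_def)
    then have "Q (w m) = Q (w n) + 2 * B (\<lambda>x. E0 + w n x) u + B u u"
      using line[OF w(1) u, of n 1] by simp
    with mid have "B u u \<le> 2 * (Q (w m) - d) + 2 * (Q (w n) - d)" by simp
    also have "\<dots> \<le> 2 * (inverse (real (Suc m)) + inverse (real (Suc n)))"
      using w(2)[of m] w(2)[of n] by simp
    finally have "c * sqn u \<le> 2 * (inverse (real (Suc m)) + inverse (real (Suc n)))"
      using c(2)[OF W(1)[OF u]] by linarith
    then show ?thesis by (simp add: u_def)
  qed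
  have "\<exists>N. \<forall>m\<ge>N. \<forall>n\<ge>N. sqn (\<lambda>x. w m x - w n x) < e" if "e > 0" for e
  proof -
    have "0 < c * e / 4" using c(1) that by simp
    then obtain N where N: "inverse (real (Suc N)) < c * e / 4" using reals_Archimedean by blast
    have "sqn (\<lambda>x. w m x - w n x) < e" if "m \<ge> N" "n \<ge> N" for m n
    proof -
      have "inverse (real (Suc k)) \<le> inverse (real (Suc N))" if "k \<ge> N" for k
        using that by (intro le_imp_inverse_le) auto
      then have "2 * (inverse (real (Suc m)) + inverse (real (Suc n))) \<le> 4 * inverse (real (Suc N))"
        using that by (smt (verit))
      also have "\<dots> < c * e" using N by (simp only: mult.commute pos_less_divide_eq)
      finally have "c * sqn (\<lambda>x. w m x - w n x) < c * e"
        using cauchy[of m n] by (rule le_less_trans[rotated])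
      then show ?thesis using c(1) by simp
    qed
    then show ?thesis by blast
  qed
  from L2_cell_complete[OF W(1)[OF w(1)] this]
  obtain g where g: "L2_cell g" "(\<lambda>n. sqn (\<lambda>x. w n x - g x)) \<longlonglongrightarrow> 0" by blast
  have "B (\<lambda>x. E0 + g x) v = 0" if v: "v \<in> W" for v
  proof -
    have B_commute: "B f v = (LINT x|\<mu>. f x \<bullet> (L x *v v x))" for f
      unfolding B_def L_def two_phase_commute[OF L1 L2] ..
    have lim: "(\<lambda>n. B (\<lambda>x. E0 + w n x) v) \<longlonglongrightarrow> B (\<lambda>x. E0 + g x) v"
      unfolding B_commute
    proof (rule tendsto_LINT_inner)
      show "L2_cell (\<lambda>x. E0 + w n x)" for n by (rule L2E[OF w(1)])
      show "L2_cell (\<lambda>x. E0 + g x)" by (rule L2_cell_add[OF L2_cell_const g(1)])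
      show "L2_cell (\<lambda>x. L x *v v x)"
        unfolding L_def by (rule L2_cell_two_phase_mult[OF cell W(1)[OF v]])
      show "(\<lambda>n. sqn (\<lambda>x. (E0 + w n x) - (E0 + g x))) \<longlonglongrightarrow> 0" using g(2) by simp
    qed
    \<comment> \<open>In the limit, minimality leaves a quadratic in \<open>t\<close> without
      constant term that is never negative. Its discriminant kills the linear coefficient, which is
      the weak equation.\<close>
    have "(B (\<lambda>x. E0 + g x) v)\<^sup>2 \<le> 0 * B v v"
    proof (rule nonneg_quadratic_imp_discriminant)
      fix t
      have "0 \<le> inverse (real (Suc n)) + 2 * t * B (\<lambda>x. E0 + w n x) v + t\<^sup>2 * B v v" for n
        using d_le[OF W(3)[OF w(1) v], of n t] w(2)[of n] by (simp add: line[OF w(1) v])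
      moreover have "(\<lambda>n. inverse (real (Suc n)) + 2 * t * B (\<lambda>x. E0 + w n x) v + t\<^sup>2 * B v v)
          \<longlonglongrightarrow> 0 + 2 * t * B (\<lambda>x. E0 + g x) v + t\<^sup>2 * B v v"
        by (intro tendsto_intros lim LIMSEQ_inverse_real_of_nat)
      ultimately show "0 \<le> 0 + 2 * t * B (\<lambda>x. E0 + g x) v + t\<^sup>2 * B v v"
        by (intro LIMSEQ_le_const) auto
    qed (intro pos W v)
    then show ?thesis by simp
  qed
  then show ?thesis unfolding B_def using w(1) g by blast
qed

text \<open>Convergence of gradients says nothing about additive constants in the potentials.
  Normalising every potential to mean zero lets the Poincare inequality turn the Cauchy property of
  gradients into that of potentials.\<close>

lemma H1_per_grad_limit:
  assumes u: "\<And>n. smooth_per (u n)" and g: "L2_cell g"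
    and lim: "(\<lambda>n. sqn (\<lambda>x. grad (u n) x - g x)) \<longlonglongrightarrow> 0"
  shows "\<exists>\<phi>. H1_per_grad \<phi> g"
proof -
  define v where "v n x = u n x - (LINT y|\<mu>. u n y)" for n x
  have one: "smooth_per (\<lambda>x. 1)" using smooth_per_wave[of 1 0 0 0] by (simp add: wave_def[abs_def])
  have L2u: "L2_cell (u n)" "L2_cell (grad (u n))" for n
    by (intro L2_cell_continuous smooth_per_continuous smooth_per_continuous_grad u)+
  have v_eq: "v n = (\<lambda>x. 1 * u n x + (- (LINT y|\<mu>. u n y)) * 1)" for n by (simp add: v_def fun_eq_iff)
  have v: "smooth_per (v n)" for n unfolding v_eq by (intro smooth_per_lincomb u one)
  have "grad (\<lambda>x. 1) x = 0" for x
    by (simp add: grad_def vec_eq_iff partial_eqI[OF has_derivative_const])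
  then have gv: "grad (v n) = grad (u n)" for n
    unfolding v_eq fun_eq_iff grad_lincomb[OF u one] by simp
  have L2v: "L2_cell (v n)" for n by (intro L2_cell_continuous smooth_per_continuous v)
  have le: "sqn (\<lambda>x. v m x - v n x) \<le> 2 * sqn (\<lambda>x. grad (u m) x - grad (u n) x)" for m n
  proof -
    define w where "w x = 1 * u m x + (-1) * u n x" for x
    have "(LINT y|\<mu>. w y) = (LINT y|\<mu>. u m y) - (LINT y|\<mu>. u n y)"
      unfolding w_def using L2_cell_integrable[OF L2u(1)] by simp
    then have "v m x - v n x = w x - (LINT y|\<mu>. w y)" for x by (simp add: v_def w_def)
    then have "sqn (\<lambda>x. v m x - v n x) = sqn (\<lambda>x. w x - (LINT y|\<mu>. w y))" by presburger
    also have "\<dots> \<le> 2 * sqn (grad w)" unfolding w_def by (intro Poincare smooth_per_lincomb u)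
    also have "grad w = (\<lambda>x. grad (u m) x - grad (u n) x)"
      unfolding fun_eq_iff w_def grad_lincomb[OF u u] by simp
    finally show ?thesis .
  qed
  have "\<exists>N. \<forall>m\<ge>N. \<forall>n\<ge>N. sqn (\<lambda>x. v m x - v n x) < e" if "e > 0" for e
  proof -
    have "\<forall>\<^sub>F n in sequentially. sqn (\<lambda>x. grad (u n) x - g x) < e / 8"
      using that by (intro order_tendstoD(2)[OF lim]) simp
    then obtain N where N: "\<And>n. n \<ge> N \<Longrightarrow> sqn (\<lambda>x. grad (u n) x - g x) < e / 8"
      unfolding eventually_sequentially by blast
    have "sqn (\<lambda>x. v m x - v n x) < e" if "m \<ge> N" "n \<ge> N" for m n
    proof -
      have "sqn (\<lambda>x. grad (u m) x - grad (u n) x)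
          = sqn (\<lambda>x. (grad (u m) x - g x) + (g x - grad (u n) x))" by simp
      also have "\<dots> \<le> 2 * sqn (\<lambda>x. grad (u m) x - g x) + 2 * sqn (\<lambda>x. g x - grad (u n) x)"
        by (intro sqn_add_le L2_cell_diff L2u g)
      also have "\<dots> < e / 2"
        using N[OF that(1)] N[OF that(2)] sqn_minus_commute[of g "grad (u n)"] by simp
      finally show ?thesis using le[of m n] by simp
    qed
    then show ?thesis by blast
  qed
  from L2_cell_complete[OF L2v this]
  obtain \<phi> where \<phi>: "L2_cell \<phi>" "(\<lambda>n. sqn (\<lambda>x. v n x - \<phi> x)) \<longlonglongrightarrow> 0" by blast
  have "H1_per_grad \<phi> g"
    unfolding H1_per_grad_def
    using \<phi> g v lim by (intro conjI exI[of _ v]) (simp_all add: sqn_def gv)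
  then show ?thesis by blast
qed

section \<open>Density of trigonometric polynomials\<close>

text \<open>Amplitudes are part of the waves, so sums suffice as a closure rule; closure under
  products follows from the product-to-sum formula for cosines.\<close>

inductive trig_poly :: "(real^2 \<Rightarrow> real) \<Rightarrow> bool" where
  wave: "trig_poly (wave c m n t)"
| add: "trig_poly p \<Longrightarrow> trig_poly q \<Longrightarrow> trig_poly (\<lambda>x. p x + q x)"

lemma wave_mult:
  "wave c m n t x * wave c' m' n' t' x
    = wave (c * c' / 2) (m - m') (n - n') (t - t') x + wave (c * c' / 2) (m + m') (n + n') (t + t') x"
proof -
  define \<alpha> \<beta> where "\<alpha> = 2 * pi * (m * x $ 1 + n * x $ 2) + t" and "\<beta> = 2 * pi * (m' * x $ 1 + n' * x $ 2) + t'"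
  have "2 * pi * ((m - m') * x $ 1 + (n - n') * x $ 2) + (t - t') = \<alpha> - \<beta>"
    "2 * pi * ((m + m') * x $ 1 + (n + n') * x $ 2) + (t + t') = \<alpha> + \<beta>"
    unfolding \<alpha>_def \<beta>_def of_int_add of_int_diff by algebra+
  then show ?thesis
    unfolding wave_def \<alpha>_def[symmetric] \<beta>_def[symmetric]
    by (simp only: of_int_add of_int_diff) (simp add: cos_add cos_diff field_simps)
qed

lemma trig_poly_mult:
  assumes "trig_poly p" "trig_poly q" shows "trig_poly (\<lambda>x. p x * q x)"
proof -
  have w: "trig_poly (\<lambda>x. wave c m n t x * q x)" for c m n t
    using assms(2)
  proof induction
    case (wave c' m' n' t')
    show ?case unfolding wave_mult by (intro trig_poly.intros)
  next
    case (add p q)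
    show ?case using trig_poly.add[OF add.IH] by (simp add: distrib_left)
  qed
  show ?thesis
    using assms(1)
  proof induction
    case (wave c m n t)
    show ?case by (rule w)
  next
    case (add p q)
    show ?case using trig_poly.add[OF add.IH] by (simp add: distrib_right)
  qed
qed

lemma trig_poly_const: "trig_poly (\<lambda>x. c)"
  using trig_poly.wave[of c 0 0 0] by (simp add: wave_def[abs_def])

lemma trig_poly_continuous: "trig_poly p \<Longrightarrow> continuous_on A p"
  by (induction rule: trig_poly.induct)
    (auto intro: continuous_on_add smooth_per_continuous smooth_per_wave)

lemma trig_poly_L2: "trig_poly p \<Longrightarrow> L2_cell p"
  by (intro L2_cell_continuous trig_poly_continuous)

text \<open>Periodic functions cannot separate points on opposite sides of the cell, so
  Stone-Weierstrass does not apply on the cell itself. Mapping the cell onto the product of two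
  circles glues these sides together.\<close>

definition torus :: "real^2 \<Rightarrow> complex \<times> complex" where
  "torus x = (cis (2 * pi * x $ 1), cis (2 * pi * x $ 2))"

lemma continuous_on_torus: "continuous_on A torus"
  unfolding torus_def by (intro continuous_intros)

lemma cis_2pi_eq:
  assumes "cis (2 * pi * s) = cis (2 * pi * t)" "0 \<le> s" "s \<le> 1" "0 < t" "t < 1"
  shows "s = t"
proof -
  have "cis (2 * pi * s - 2 * pi * t) = 1"
    using assms(1) by (simp flip: cis_divide)
  then have "cos (2 * pi * s - 2 * pi * t) = 1" by (simp add: complex_eq_iff)
  then obtain k :: int where k: "2 * pi * s - 2 * pi * t = real_of_int k * 2 * pi"
    unfolding cos_one_2pi_int by blast
  then have "2 * pi * (s - t) = 2 * pi * of_int k" by (simp add: right_diff_distrib)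
  then have st: "s - t = of_int k" by simp
  then have "-1 < real_of_int k" "real_of_int k < 1" using assms by linarith+
  then have "k = 0" by linarith
  then show ?thesis using st by simp
qed

lemma torus_inj:
  assumes "torus x = torus y" "x \<in> cell" "y \<in> box 0 1" shows "x = y"
proof -
  have "0 \<le> x $ i \<and> x $ i \<le> 1 \<and> 0 < y $ i \<and> y $ i < 1" for i
    using assms(2,3) by (simp add: mem_box_cart)
  then show ?thesis
    using assms(1) by (auto simp: torus_def vec_eq_iff forall_2 intro!: cis_2pi_eq)
qed

text \<open>The real and imaginary parts of both circle coordinates pull back to waves. They
  separate the points of the image, so the algebra \<open>R\<close> of functions that pull back
  exactly to trigonometric polynomials is dense.\<close>

lemma torus_approximation:
  assumes "continuous_on (torus ` cell) g" "e > 0"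
  shows "\<exists>p. trig_poly p \<and> (\<forall>x\<in>cell. \<bar>g (torus x) - p x\<bar> < e)"
proof -
  define R where "R = {g. continuous_on (torus ` cell) g \<and> (\<exists>p. trig_poly p \<and> (\<forall>x\<in>cell. g (torus x) = p x))}"
  have coord: "(\<lambda>z. Re (fst z)) \<in> R" "(\<lambda>z. Im (fst z)) \<in> R" "(\<lambda>z. Re (snd z)) \<in> R" "(\<lambda>z. Im (snd z)) \<in> R"
  proof -
    have "Re (fst (torus x)) = wave 1 1 0 0 x" "Im (fst (torus x)) = wave 1 1 0 (- pi / 2) x"
      "Re (snd (torus x)) = wave 1 0 1 0 x" "Im (snd (torus x)) = wave 1 0 1 (- pi / 2) x" for x
      by (simp_all add: torus_def wave_def cos_diff)
    then show "(\<lambda>z. Re (fst z)) \<in> R" "(\<lambda>z. Im (fst z)) \<in> R" "(\<lambda>z. Re (snd z)) \<in> R" "(\<lambda>z. Im (snd z)) \<in> R"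
      unfolding R_def by (auto intro!: continuous_intros) (use trig_poly.wave in blast)+
  qed
  interpret function_ring_on R "torus ` cell"
  proof
    show "compact (torus ` cell)" by (intro compact_continuous_image continuous_on_torus compact_cbox)
    fix f g assume f: "f \<in> R" and g: "g \<in> R"
    show "continuous_on (torus ` cell) f" using f by (simp add: R_def)
    show "(\<lambda>x. f x + g x) \<in> R" "(\<lambda>x. f x * g x) \<in> R"
    proof -
      obtain p q where "trig_poly p" "\<forall>x\<in>cell. f (torus x) = p x" "trig_poly q" "\<forall>x\<in>cell. g (torus x) = q x"
        using f g unfolding R_def by blast
      note pq = this
      show "(\<lambda>x. f x + g x) \<in> R"
        using f g pq unfolding R_def
        by (auto intro!: continuous_on_add exI[of _ "\<lambda>x. p x + q x"] trig_poly.add)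
      show "(\<lambda>x. f x * g x) \<in> R"
        using f g pq unfolding R_def
        by (auto intro!: continuous_on_mult exI[of _ "\<lambda>x. p x * q x"] trig_poly_mult)
    qed
  next
    show "(\<lambda>_. c) \<in> R" for c
      unfolding R_def using trig_poly_const[of c] by (auto intro: continuous_intros)
    show "\<exists>f\<in>R. f x \<noteq> f y" if "x \<noteq> y" for x y
    proof (rule ccontr)
      assume "\<not> (\<exists>f\<in>R. f x \<noteq> f y)"
      then show False using coord that by (auto simp: prod_eq_iff complex_eq_iff)
    qed
  qed
  obtain f where "f \<in> R" "\<forall>z\<in>torus ` cell. \<bar>g z - f z\<bar> < e"
    using Stone_Weierstrass_basic[OF assms] by blast
  moreover then obtain p where "trig_poly p" "\<forall>x\<in>cell. f (torus x) = p x" unfolding R_def by blast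
  ultimately show ?thesis by (intro exI[of _ p]) auto
qed

section \<open>Completeness of the Fourier modes\<close>

context
  fixes f :: "real^2 \<Rightarrow> real"
  assumes f: "L2_cell f" and orth: "\<And>m n t. (LINT x|\<mu>. f x * wave 1 m n t x) = 0"
begin

lemma orthogonal_trig_poly: "trig_poly p \<Longrightarrow> (LINT x|\<mu>. f x * p x) = 0"
proof (induction rule: trig_poly.induct)
  case (wave c m n t)
  have "(\<lambda>x. f x * wave c m n t x) = (\<lambda>x. c * (f x * wave 1 m n t x))"
    by (simp add: wave_def fun_eq_iff)
  then show ?case by (simp only: integral_mult_right_zero orth mult_zero_right)
next
  case (add p q)
  then have "integrable \<mu> (\<lambda>x. f x * p x)" "integrable \<mu> (\<lambda>x. f x * q x)"
    using L2_cell_inner_integrable[OF f trig_poly_L2] by auto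
  then show ?case using add.IH by (simp add: distrib_left)
qed

lemma orthogonal_continuous_on_torus:
  assumes g: "continuous_on (torus ` cell) g"
  shows "(LINT x|\<mu>. f x * g (torus x)) = 0"
proof -
  have "continuous_on cell (\<lambda>x. g (torus x))"
    by (rule continuous_on_compose2[OF g continuous_on_torus]) auto
  then have gL: "L2_cell (\<lambda>x. g (torus x))" by (rule L2_cell_continuous)
  have "\<bar>LINT x|\<mu>. f x * g (torus x)\<bar> \<le> e * (1 + (LINT x|\<mu>. \<bar>f x\<bar>))" if e: "e > 0" for e
  proof -
    obtain p where p: "trig_poly p" "\<And>x. x \<in> cell \<Longrightarrow> \<bar>g (torus x) - p x\<bar> < e"
      using torus_approximation[OF g e] by blast
    have i: "integrable \<mu> (\<lambda>x. f x * g (torus x))" "integrable \<mu> (\<lambda>x. f x * p x)"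
      using L2_cell_inner_integrable[OF f gL] L2_cell_inner_integrable[OF f trig_poly_L2[OF p(1)]] by simp_all
    have a: "integrable \<mu> (\<lambda>x. \<bar>f x\<bar>)" using L2_cell_integrable[OF f] by simp
    have "(LINT x|\<mu>. f x * g (torus x)) = (LINT x|\<mu>. f x * (g (torus x) - p x))"
      using i orthogonal_trig_poly[OF p(1)] by (simp add: right_diff_distrib)
    also have "\<bar>\<dots>\<bar> \<le> (LINT x|\<mu>. e * \<bar>f x\<bar>)"
    proof (rule order_trans[OF integral_abs_bound integral_mono])
      show "integrable \<mu> (\<lambda>x. \<bar>f x * (g (torus x) - p x)\<bar>)" using i by (simp add: right_diff_distrib)
      show "integrable \<mu> (\<lambda>x. e * \<bar>f x\<bar>)" using a by simp
      fix x assume "x \<in> space \<mu>"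
      then have "\<bar>g (torus x) - p x\<bar> \<le> e" using p(2)[of x] by (simp add: space_restrict_space)
      then show "\<bar>f x * (g (torus x) - p x)\<bar> \<le> e * \<bar>f x\<bar>"
        using mult_left_mono[of _ _ "\<bar>f x\<bar>"] by (simp add: abs_mult mult.commute[of e])
    qed
    also have "\<dots> = e * (LINT x|\<mu>. \<bar>f x\<bar>)" by simp
    also have "\<dots> \<le> e * (1 + (LINT x|\<mu>. \<bar>f x\<bar>))" using e by simp
    finally show ?thesis .
  qed
  note bound = this
  \<comment> \<open>The summand 1 keeps \<open>C\<close> positive even if \<open>f\<close> vanishes,
    so that \<open>e / C\<close> is meaningful.\<close>
  define C where "C = 1 + (LINT x|\<mu>. \<bar>f x\<bar>)"
  have "0 \<le> (LINT x|\<mu>. \<bar>f x\<bar>)" by (rule integral_nonneg_AE) simp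
  then have "C > 0" unfolding C_def by linarith
  then have "\<bar>LINT x|\<mu>. f x * g (torus x)\<bar> \<le> e" if "e > 0" for e
    using bound[of "e / C"] that by (simp add: C_def[symmetric])
  then have "\<bar>LINT x|\<mu>. f x * g (torus x)\<bar> \<le> 0" by (rule field_le_epsilon) simp
  then show ?thesis by simp
qed

text \<open>The torus map is injective off the boundary of the cell, so that indicators of compact
  subsets of the open cell are decreasing limits of continuous functions on the torus.\<close>

lemma orthogonal_compact:
  assumes S: "compact S" "S \<subseteq> box 0 1"
  shows "(LINT x|\<mu>. f x * indicator S x) = 0"
proof (cases "S = {}")
  case False
  define K where "K = torus ` S"
  have K: "closed K" "K \<noteq> {}"
    using S False unfolding K_def by (auto intro!: compact_imp_closed compact_continuous_image continuous_on_torus)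
  \<comment> \<open>Tents over the image of \<open>S\<close>, equal to 1 on it and 0 at distance at
    least \<open>1 / n\<close>. They converge to the indicator of \<open>S\<close> because, by
    injectivity, a point of the cell outside \<open>S\<close> is mapped to a positive distance from
    that image.\<close>
  define g where "g n z = max 0 (1 - real n * infdist z K)" for n z
  have gc: "continuous_on A (g n)" for A n unfolding g_def by (intro continuous_intros)
  have g01: "0 \<le> g n z" "g n z \<le> 1" for n z by (auto simp: g_def infdist_nonneg)
  have lim: "(\<lambda>n. f x * g n (torus x)) \<longlonglongrightarrow> f x * indicator S x" if "x \<in> cell" for x
  proof (cases "x \<in> S")
    case True
    then have "torus x \<in> K" by (simp add: K_def)
    then show ?thesis using True by (simp add: g_def)
  next
    case False
    have "torus x \<notin> K"
    proof
      assume "torus x \<in> K"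
      then obtain y where "y \<in> S" "torus x = torus y" by (auto simp: K_def)
      then show False using torus_inj[of x y] that S(2) False by auto
    qed
    then have d: "infdist (torus x) K > 0"
      using in_closed_iff_infdist_zero[OF K] infdist_nonneg[of "torus x" K] by fastforce
    obtain N where N: "1 < real N * infdist (torus x) K" using reals_Archimedean3[OF d] by blast
    have "g n (torus x) = 0" if "n \<ge> N" for n
    proof -
      have "real N * infdist (torus x) K \<le> real n * infdist (torus x) K"
        using that d by (intro mult_right_mono) auto
      then show ?thesis using N by (simp add: g_def)
    qed
    then have "\<forall>\<^sub>F n in sequentially. f x * g n (torus x) = f x * indicator S x"
      using False by (intro eventually_sequentiallyI[of N]) simp
    then show ?thesis by (rule tendsto_eventually)
  qed
  have "(\<lambda>n. LINT x|\<mu>. f x * g n (torus x)) \<longlonglongrightarrow> (LINT x|\<mu>. f x * indicator S x)"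
  proof (rule integral_dominated_convergence)
    have "S \<in> sets lebesgue" using S(1) by (simp add: lmeasurable_compact fmeasurableD)
    then have "(indicator S :: _ \<Rightarrow> real) \<in> borel_measurable \<mu>"
      by (intro measurable_restrict_space1 borel_measurable_indicator)
    then show "(\<lambda>x. f x * indicator S x) \<in> borel_measurable \<mu>"
      using L2_cell_measurable[OF f] by (intro borel_measurable_times)
    have "continuous_on cell (\<lambda>x. g n (torus x))" for n
      by (rule continuous_on_compose2[OF gc continuous_on_torus]) auto
    then show "(\<lambda>x. f x * g n (torus x)) \<in> borel_measurable \<mu>" for n
      using L2_cell_measurable[OF f] L2_cell_measurable[OF L2_cell_continuous]
      by (intro borel_measurable_times) auto
    show "integrable \<mu> (\<lambda>x. \<bar>f x\<bar>)" using L2_cell_integrable[OF f] by simp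
    show "AE x in \<mu>. (\<lambda>n. f x * g n (torus x)) \<longlonglongrightarrow> f x * indicator S x"
      using lim by (intro AE_I2) (simp add: space_restrict_space)
    show "AE x in \<mu>. norm (f x * g n (torus x)) \<le> \<bar>f x\<bar>" for n
      using g01 by (intro AE_I2) (simp add: abs_mult mult_left_le)
  qed
  moreover have "(LINT x|\<mu>. f x * g n (torus x)) = 0" for n
    by (rule orthogonal_continuous_on_torus[OF gc])
  ultimately show ?thesis by (simp add: LIMSEQ_const_iff)
qed simp

text \<open>On a compact part \<open>S\<close> of the positivity set, \<open>f\<close> is positive
  but has integral zero, so \<open>S\<close> is null. Inner regularity then makes the whole
  positivity set null.\<close>

lemma orthogonal_not_positive: "AE x in \<mu>. f x \<le> 0"
proof -
  define P where "P = {x \<in> box 0 1. f x > 0}"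
  have "{x \<in> cell. f x > 0} \<in> sets \<mu>"
    using L2_cell_measurable[OF f] borel_measurable_less[of "\<lambda>_. 0" \<mu> f]
    by (simp add: space_restrict_space)
  then have "{x \<in> cell. f x > 0} \<in> sets lebesgue" by (simp add: sets_restrict_space_iff)
  then have "{x \<in> cell. f x > 0} \<inter> box 0 1 \<in> sets lebesgue" by (intro sets.Int) auto
  moreover have "P = {x \<in> cell. f x > 0} \<inter> box 0 1"
    using box_subset_cbox[of 0 "1::real^2"] by (auto simp: P_def)
  ultimately have P: "P \<in> sets lebesgue" by simp
  have small: "emeasure lebesgue P \<le> ennreal e" if e: "e > 0" for e
  proof -
    obtain S where S: "closed S" "S \<subseteq> P" "P - S \<in> lmeasurable" "emeasure lebesgue (P - S) < ennreal e"
      using sets_lebesgue_inner_closed[OF P e] by metis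
    have "S \<subseteq> cell" using S(2) box_subset_cbox[of 0 "1::real^2"] by (auto simp: P_def)
    then have "compact S" using S(1) bounded_subset[OF bounded_cbox] by (auto simp: compact_eq_bounded_closed)
    then have "(LINT x|\<mu>. f x * indicator S x) = 0" using S(2) by (intro orthogonal_compact) (auto simp: P_def)
    have Sl: "S \<in> sets lebesgue" using S(1) by auto
    have "L2_cell (\<lambda>x. indicator S x *\<^sub>R f x)" by (intro L2_cell_indicator f Sl)
    then have "integrable \<mu> (\<lambda>x. f x * indicator S x)"
      by (simp add: L2_cell_integrable mult.commute)
    moreover have "AE x in \<mu>. 0 \<le> f x * indicator S x"
      using S(2) by (intro AE_I2) (auto simp: P_def indicator_def less_imp_le)
    ultimately have "AE x in \<mu>. f x * indicator S x = 0"
      using \<open>(LINT x|\<mu>. f x * indicator S x) = 0\<close> by (simp add: integral_nonneg_eq_0_iff_AE)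
    then have "AE x in \<mu>. x \<notin> S" by eventually_elim (use S(2) in \<open>auto simp: P_def indicator_def\<close>)
    then have "AE x in lebesgue. x \<notin> S"
      using \<open>S \<subseteq> cell\<close> by (auto simp: AE_restrict_space_iff elim: eventually_mono)
    then have "emeasure lebesgue S = 0" using AE_iff_measurable[OF Sl, of "\<lambda>x. x \<notin> S"] by simp
    moreover have "emeasure lebesgue P \<le> emeasure lebesgue (P - S) + emeasure lebesgue S"
      using emeasure_subadditive[of "P - S" lebesgue S] S(2) P Sl by (simp add: Un_absorb2)
    ultimately show ?thesis using S(4) by (simp add: less_imp_le)
  qed
  have "emeasure lebesgue P \<le> 0"
    by (rule ennreal_le_epsilon) (use small in auto)
  then have "P \<in> null_sets lebesgue" using P by (simp add: null_sets_def)
  \<comment> \<open>The sides of the cell, where the torus map identifies points, were left out of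
    \<open>P\<close>; they form a null set.\<close>
  moreover have "cell - box 0 1 \<in> null_sets lebesgue"
    using negligible_frontier_interval[of 0 "1::real^2"] by (simp add: negligible_iff_null_sets)
  ultimately have "AE x in lebesgue. x \<notin> P \<union> (cell - box 0 1)"
    by (intro AE_not_in null_sets.Un)
  then have "AE x in lebesgue. x \<in> cell \<longrightarrow> f x \<le> 0"
    by eventually_elim (auto simp: P_def not_less)
  then show ?thesis by (simp add: AE_restrict_space_iff)
qed

end

lemma orthogonal_waves_imp_AE_0:
  assumes "L2_cell f" "\<And>m n t. (LINT x|\<mu>. f x * wave 1 m n t x) = 0"
  shows "AE x in \<mu>. f x = 0"
proof -
  have "AE x in \<mu>. f x \<le> 0" by (rule orthogonal_not_positive[OF assms])
  moreover have "AE x in \<mu>. - f x \<le> 0"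
    by (rule orthogonal_not_positive) (use assms in \<open>auto intro: L2_cell_uminus\<close>)
  ultimately show ?thesis by eventually_elim simp
qed

section \<open>Periodic Sobolev and divergence-free fields\<close>

lemma R_perp_simps:
  "R_perp *v (R_perp *v a) = - a"
  "(R_perp *v a) \<bullet> b = - (a \<bullet> (R_perp *v b))"
  by (simp_all add: R_perp_mult vec_eq_iff forall_2 inner_vec_def sum_2)

lemma H1_per_grad_L2: "H1_per_grad \<phi> g \<Longrightarrow> L2_cell g"
  by (simp add: H1_per_grad_def)

lemma H1_per_grad_approx:
  assumes "H1_per_grad \<phi> g"
  obtains u where "\<And>n. smooth_per (u n)" "\<And>n. L2_cell (grad (u n))"
    "\<And>v. L2_cell v \<Longrightarrow> (\<lambda>n. LINT x|\<mu>. grad (u n) x \<bullet> v x) \<longlonglongrightarrow> (LINT x|\<mu>. g x \<bullet> v x)"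
proof -
  obtain u where u: "\<And>n. smooth_per (u n)" "(\<lambda>n. sqn (\<lambda>x. grad (u n) x - g x)) \<longlonglongrightarrow> 0"
    using assms unfolding H1_per_grad_def sqn_def by blast
  have L: "L2_cell (grad (u n))" for n by (intro L2_cell_continuous smooth_per_continuous_grad u)
  show thesis
  proof (rule that)
    show "(\<lambda>n. LINT x|\<mu>. grad (u n) x \<bullet> v x) \<longlonglongrightarrow> (LINT x|\<mu>. g x \<bullet> v x)" if "L2_cell v" for v
      by (rule tendsto_LINT_inner[OF L H1_per_grad_L2[OF assms] that u(2)])
  qed (rule u(1) L)+
qed

lemma LINT_inner_eq_0I:
  assumes "H1_per_grad \<phi> g" "L2_cell v" "\<And>\<psi>. smooth_per \<psi> \<Longrightarrow> (LINT x|\<mu>. grad \<psi> x \<bullet> v x) = 0"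
  shows "(LINT x|\<mu>. g x \<bullet> v x) = 0"
proof -
  obtain u where u: "\<And>n. smooth_per (u n)" and "\<And>n. L2_cell (grad (u n))"
    and "\<And>v. L2_cell v \<Longrightarrow> (\<lambda>n. LINT x|\<mu>. grad (u n) x \<bullet> v x) \<longlonglongrightarrow> (LINT x|\<mu>. g x \<bullet> v x)"
    by (rule H1_per_grad_approx[OF assms(1)]) blast
  from this(3)[OF assms(2)] show ?thesis
    unfolding assms(3)[OF u] by (simp add: LIMSEQ_const_iff)
qed

lemma div_free_L2: "div_free J \<Longrightarrow> L2_cell J"
  by (simp add: div_free_def)

lemma div_free_inner_H1_grad:
  assumes "div_free J" "H1_per_grad \<phi> g" shows "(LINT x|\<mu>. J x \<bullet> g x) = 0"
  unfolding inner_commute[of "J x" "g x" for x]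
  by (rule LINT_inner_eq_0I[OF assms(2) div_free_L2[OF assms(1)]])
    (use assms(1) in \<open>simp add: div_free_def inner_commute\<close>)

lemma div_free_lincomb:
  assumes "div_free J" "div_free K" shows "div_free (\<lambda>x. a *\<^sub>R J x + b *\<^sub>R K x)"
  unfolding div_free_def
proof (intro conjI allI impI)
  note L = div_free_L2[OF assms(1)] div_free_L2[OF assms(2)]
  show "L2_cell (\<lambda>x. a *\<^sub>R J x + b *\<^sub>R K x)" by (intro L2_cell_intros L)
  fix \<psi> assume \<psi>: "smooth_per \<psi>"
  then have "L2_cell (grad \<psi>)" by (intro L2_cell_continuous smooth_per_continuous_grad)
  then have "integrable \<mu> (\<lambda>x. J x \<bullet> grad \<psi> x)" "integrable \<mu> (\<lambda>x. K x \<bullet> grad \<psi> x)"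
    by (intro L2_cell_inner_integrable L; assumption)+
  then show "(LINT x|\<mu>. (a *\<^sub>R J x + b *\<^sub>R K x) \<bullet> grad \<psi> x) = 0"
    using assms \<psi> by (simp add: inner_add_left div_free_def)
qed

lemma div_free_const: "div_free (\<lambda>x. c)"
  unfolding div_free_def
proof (intro conjI allI impI L2_cell_const)
  fix \<psi> assume \<psi>: "smooth_per \<psi>"
  then have "integrable \<mu> (partial k \<psi>)" for k
    by (intro L2_cell_integrable L2_cell_continuous smooth_per_continuous smooth_per_partial)
  then show "(LINT x|\<mu>. c \<bullet> grad \<psi> x) = 0"
    using LINT_smooth_per_partial[OF \<psi>] by (simp add: inner_vec_def sum_2 grad_def)
qed

lemma div_free_add: "div_free J \<Longrightarrow> div_free K \<Longrightarrow> div_free (\<lambda>x. J x + K x)"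
  using div_free_lincomb[of J K 1 1] by simp

lemma div_free_diff: "div_free J \<Longrightarrow> div_free K \<Longrightarrow> div_free (\<lambda>x. J x - K x)"
  using div_free_lincomb[of J K 1 "-1"] by simp

lemma div_free_scaleR: "div_free J \<Longrightarrow> div_free (\<lambda>x. a *\<^sub>R J x)"
  using div_free_lincomb[of J J a 0] by simp

lemma div_free_AE_cong:
  assumes "div_free J" "L2_cell K" "AE x in \<mu>. J x = K x" shows "div_free K"
  unfolding div_free_def
proof (intro conjI allI impI assms(2))
  fix \<psi> assume \<psi>: "smooth_per \<psi>"
  then have "L2_cell (grad \<psi>)" by (intro L2_cell_continuous smooth_per_continuous_grad)
  then have "(LINT x|\<mu>. J x \<bullet> grad \<psi> x) = (LINT x|\<mu>. K x \<bullet> grad \<psi> x)"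
    using assms(3) L2_cell_measurable[OF assms(2)] L2_cell_measurable[OF div_free_L2[OF assms(1)]]
    by (intro integral_cong_AE borel_measurable_inner) (auto dest: L2_cell_measurable)
  then show "(LINT x|\<mu>. K x \<bullet> grad \<psi> x) = 0" using assms(1) \<psi> by (simp add: div_free_def)
qed

text \<open>The mean, taken as a constant field, is itself divergence-free; pairing it with
  \<open>g\<close> gives its squared length, which must vanish.\<close>

lemma H1_per_grad_mean:
  assumes "H1_per_grad \<phi> g" shows "(LINT x|\<mu>. g x) = 0"
proof -
  let ?m = "LINT x|\<mu>. g x"
  have "(LINT x|\<mu>. ?m \<bullet> g x) = 0" by (rule div_free_inner_H1_grad[OF div_free_const assms])
  then have "?m \<bullet> ?m = 0"
    using L2_cell_integrable[OF H1_per_grad_L2[OF assms]] by simp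
  then show ?thesis by simp
qed

lemma H1_per_grad_lincomb:
  assumes H: "H1_per_grad \<phi> g" "H1_per_grad \<phi>' g'"
  shows "H1_per_grad (\<lambda>x. a * \<phi> x + b * \<phi>' x) (\<lambda>x. a *\<^sub>R g x + b *\<^sub>R g' x)"
proof -
  obtain u where u: "\<And>n. smooth_per (u n)" "(\<lambda>n. sqn (\<lambda>x. u n x - \<phi> x)) \<longlonglongrightarrow> 0"
    "(\<lambda>n. sqn (\<lambda>x. grad (u n) x - g x)) \<longlonglongrightarrow> 0"
    using H(1) unfolding H1_per_grad_def sqn_def by auto
  obtain v where v: "\<And>n. smooth_per (v n)" "(\<lambda>n. sqn (\<lambda>x. v n x - \<phi>' x)) \<longlonglongrightarrow> 0"
    "(\<lambda>n. sqn (\<lambda>x. grad (v n) x - g' x)) \<longlonglongrightarrow> 0"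
    using H(2) unfolding H1_per_grad_def sqn_def by auto
  have L: "L2_cell \<phi>" "L2_cell g" "L2_cell \<phi>'" "L2_cell g'" using H by (simp_all add: H1_per_grad_def)
  have Lu: "L2_cell (u n)" "L2_cell (grad (u n))" "L2_cell (v n)" "L2_cell (grad (v n))" for n
    by (intro L2_cell_continuous smooth_per_continuous smooth_per_continuous_grad u v)+
  have sqn_scale: "sqn (\<lambda>x. c *\<^sub>R f x) = c\<^sup>2 * sqn f" for c :: real and f :: "real^2 \<Rightarrow> 'z::euclidean_space"
    by (simp add: sqn_def power_mult_distrib)
  have lim: "(\<lambda>n. sqn (\<lambda>x. (a *\<^sub>R f n x + b *\<^sub>R h n x) - (a *\<^sub>R f' x + b *\<^sub>R h' x))) \<longlonglongrightarrow> 0"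
    if "(\<lambda>n. sqn (\<lambda>x. f n x - f' x)) \<longlonglongrightarrow> 0" "(\<lambda>n. sqn (\<lambda>x. h n x - h' x)) \<longlonglongrightarrow> 0"
      "\<And>n. L2_cell (f n)" "\<And>n. L2_cell (h n)" "L2_cell f'" "L2_cell h'"
    for f h and f' h' :: "real^2 \<Rightarrow> 'z::euclidean_space"
  proof (rule tendsto_sandwich[OF _ _ tendsto_const])
    have "sqn (\<lambda>x. (a *\<^sub>R f n x + b *\<^sub>R h n x) - (a *\<^sub>R f' x + b *\<^sub>R h' x))
        \<le> 2 * (a\<^sup>2 * sqn (\<lambda>x. f n x - f' x)) + 2 * (b\<^sup>2 * sqn (\<lambda>x. h n x - h' x))" for n
    proof -
      have "sqn (\<lambda>x. (a *\<^sub>R f n x + b *\<^sub>R h n x) - (a *\<^sub>R f' x + b *\<^sub>R h' x))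
          = sqn (\<lambda>x. a *\<^sub>R (f n x - f' x) + b *\<^sub>R (h n x - h' x))"
        by (simp add: scaleR_diff_right algebra_simps)
      also have "\<dots> \<le> 2 * sqn (\<lambda>x. a *\<^sub>R (f n x - f' x)) + 2 * sqn (\<lambda>x. b *\<^sub>R (h n x - h' x))"
        by (intro sqn_add_le L2_cell_scaleR L2_cell_diff that)
      finally show ?thesis unfolding sqn_scale .
    qed
    then show "\<forall>\<^sub>F n in sequentially. sqn (\<lambda>x. (a *\<^sub>R f n x + b *\<^sub>R h n x) - (a *\<^sub>R f' x + b *\<^sub>R h' x))
        \<le> 2 * (a\<^sup>2 * sqn (\<lambda>x. f n x - f' x)) + 2 * (b\<^sup>2 * sqn (\<lambda>x. h n x - h' x))"
      by (intro always_eventually allI)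
    show "(\<lambda>n. 2 * (a\<^sup>2 * sqn (\<lambda>x. f n x - f' x)) + 2 * (b\<^sup>2 * sqn (\<lambda>x. h n x - h' x))) \<longlonglongrightarrow> 0"
      using that(1,2) by (auto intro!: tendsto_eq_intros)
  qed (simp add: sqn_nonneg)
  have gr: "grad (\<lambda>x. a * u n x + b * v n x) = (\<lambda>x. a *\<^sub>R grad (u n) x + b *\<^sub>R grad (v n) x)" for n
    by (intro ext grad_lincomb u v)
  show ?thesis
    unfolding H1_per_grad_def
  proof (intro conjI exI[of _ "\<lambda>n x. a * u n x + b * v n x"] allI)
    show "L2_cell (\<lambda>x. a * \<phi> x + b * \<phi>' x)"
      using L2_cell_add[OF L2_cell_scaleR[OF L(1), of a] L2_cell_scaleR[OF L(3), of b]] by simp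
    show "L2_cell (\<lambda>x. a *\<^sub>R g x + b *\<^sub>R g' x)" by (intro L2_cell_intros L)
    show "smooth_per (\<lambda>x. a * u n x + b * v n x)" for n by (intro smooth_per_lincomb u v)
    show "(\<lambda>n. LINT x|\<mu>. (a * u n x + b * v n x - (a * \<phi> x + b * \<phi>' x))\<^sup>2) \<longlonglongrightarrow> 0"
      using lim[OF u(2) v(2) Lu(1,3) L(1,3)] by (simp add: sqn_def)
    show "(\<lambda>n. LINT x|\<mu>. (norm (grad (\<lambda>x. a * u n x + b * v n x) x
        - (a *\<^sub>R g x + b *\<^sub>R g' x)))\<^sup>2) \<longlonglongrightarrow> 0"
      using lim[OF u(3) v(3) Lu(2,4) L(2,4)] by (simp add: sqn_def gr)
  qed
qed

lemma div_free_rotated_grad: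
  assumes "H1_per_grad \<phi> g" shows "div_free (\<lambda>x. R_perp *v g x)"
  unfolding div_free_def
proof (intro conjI allI impI)
  show "L2_cell (\<lambda>x. R_perp *v g x)"
    by (rule L2_cell_linear[OF H1_per_grad_L2[OF assms] matrix_vector_mul_bounded_linear])
  fix \<psi> assume \<psi>: "smooth_per \<psi>"
  have "(LINT x|\<mu>. g x \<bullet> (R_perp *v grad \<psi> x)) = 0"
  proof (rule LINT_inner_eq_0I[OF assms])
    show "L2_cell (\<lambda>x. R_perp *v grad \<psi> x)"
      by (intro L2_cell_linear[OF _ matrix_vector_mul_bounded_linear] L2_cell_continuous
          smooth_per_continuous_grad \<psi>)
    show "(LINT x|\<mu>. grad \<xi> x \<bullet> (R_perp *v grad \<psi> x)) = 0" if "smooth_per \<xi>" for \<xi>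
      using LINT_rotated_grad_inner_grad[OF \<psi> that] by (simp add: inner_commute)
  qed
  then show "(LINT x|\<mu>. (R_perp *v g x) \<bullet> grad \<psi> x) = 0" by (simp add: R_perp_simps(2))
qed

lemma LINT_component:
  fixes f :: "real^2 \<Rightarrow> real^'n"
  assumes "L2_cell f" shows "(LINT x|\<mu>. f x) $ i = (LINT x|\<mu>. f x $ i)"
  by (rule integral_bounded_linear[OF bounded_linear_vec_nth L2_cell_integrable[OF assms], symmetric])

text \<open>Divergence-freeness of the rotated field means that \<open>w\<close> is curl-free.
  Testing with a single mode of frequency \<open>(m, n)\<close> yields two linear equations for the
  coefficients of the two components, with determinant \<open>- (m\<^sup>2 + n\<^sup>2)\<close>. The
  zero frequency is removed by subtracting the mean.\<close>

lemma div_free_rotated_div_free_imp_const: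
  assumes w: "div_free w" and Rw: "div_free (\<lambda>x. R_perp *v w x)"
  shows "AE x in \<mu>. w x = (LINT x|\<mu>. w x)"
proof -
  define c where "c = (LINT x|\<mu>. w x)"
  define v where "v x = w x - c" for x
  note Lw = div_free_L2[OF w]
  have Lv: "L2_cell v" unfolding v_def by (intro L2_cell_intros Lw)
  have v: "div_free v" unfolding v_def by (intro div_free_diff w div_free_const)
  have Rv: "div_free (\<lambda>x. R_perp *v v x)"
    unfolding v_def matrix_vector_mult_diff_distrib by (intro div_free_diff Rw div_free_const)
  define I where "I k m n t = (LINT x|\<mu>. v x $ k * wave 1 m n t x)" for k m n t
  have i: "integrable \<mu> (\<lambda>x. v x $ k * wave 1 m n t x)" for k m n t
    using L2_cell_inner_integrable[OF L2_cell_component[OF Lv] L2_cell_continuous[OF smooth_per_continuous[OF smooth_per_wave]]]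
    by simp
  have I0: "I k m n t = 0" for k m n t
  proof (cases "m = 0 \<and> n = 0")
    case True
    have "(LINT x|\<mu>. v x $ k) = 0"
      using L2_cell_integrable[OF L2_cell_component[OF Lw]] LINT_component[OF Lw, of k] measure_cell
      by (simp add: v_def c_def)
    moreover have "wave 1 m n t = (\<lambda>x. cos t)" using True by (simp add: wave_def fun_eq_iff)
    ultimately show ?thesis by (simp add: I_def)
  next
    case False
    \<comment> \<open>Amplitude and phase are chosen so that the gradient of \<open>\<psi>\<close>
      is exactly \<open>(m, n)\<close> times \<open>wave 1 m n t\<close>.\<close>
    define \<psi> where "\<psi> = wave (1 / (2 * pi)) m n (t - pi / 2)"
    have \<psi>: "smooth_per \<psi>" unfolding \<psi>_def by (rule smooth_per_wave)
    have g: "grad \<psi> x $ 1 = m * wave 1 m n t x" "grad \<psi> x $ 2 = n * wave 1 m n t x" for x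
      by (simp_all add: grad_def \<psi>_def partial_wave) (simp_all add: wave_def)
    have "(LINT x|\<mu>. m * (v x $ 1 * wave 1 m n t x) + n * (v x $ 2 * wave 1 m n t x)) = 0"
    proof -
      have "v x \<bullet> grad \<psi> x = m * (v x $ 1 * wave 1 m n t x) + n * (v x $ 2 * wave 1 m n t x)" for x
        by (simp add: inner_vec_def sum_2 g)
      moreover have "(LINT x|\<mu>. v x \<bullet> grad \<psi> x) = 0"
        using v \<psi> unfolding div_free_def by blast
      ultimately show ?thesis by (simp only:)
    qed
    then have 1: "m * I 1 m n t + n * I 2 m n t = 0" using i by (simp add: I_def)
    have "(LINT x|\<mu>. n * (v x $ 1 * wave 1 m n t x) - m * (v x $ 2 * wave 1 m n t x)) = 0"
    proof -
      have "(R_perp *v v x) \<bullet> grad \<psi> x = n * (v x $ 1 * wave 1 m n t x) - m * (v x $ 2 * wave 1 m n t x)" for x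
        by (simp add: inner_vec_def sum_2 g R_perp_mult)
      moreover have "(LINT x|\<mu>. (R_perp *v v x) \<bullet> grad \<psi> x) = 0"
        using Rv \<psi> unfolding div_free_def by blast
      ultimately show ?thesis by (simp only:)
    qed
    then have 2: "n * I 1 m n t - m * I 2 m n t = 0" using i by (simp add: I_def)
    have "(real_of_int m)\<^sup>2 + (real_of_int n)\<^sup>2 \<noteq> 0" using False by (simp add: sum_power2_eq_zero_iff)
    moreover have "((real_of_int m)\<^sup>2 + (real_of_int n)\<^sup>2) * I 1 m n t = 0"
      "((real_of_int m)\<^sup>2 + (real_of_int n)\<^sup>2) * I 2 m n t = 0"
      using 1 2 by algebra+
    ultimately show ?thesis using exhaust_2[of k] by auto
  qed
  have "AE x in \<mu>. v x $ k = 0" for k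
    by (rule orthogonal_waves_imp_AE_0[OF L2_cell_component[OF Lv]]) (use I0 in \<open>simp add: I_def\<close>)
  from this[of 1] this[of 2] have "AE x in \<mu>. v x = 0"
    by eventually_elim (simp add: vec_eq_iff forall_2)
  then show ?thesis unfolding v_def c_def by simp
qed

section \<open>Effective conductivity\<close>

text \<open>Uniqueness almost everywhere makes the average flux a function of \<open>E0\<close>
  alone, linearity makes this function a matrix, and existence for every \<open>E0\<close> excludes
  a second matrix. The field relation \<open>F\<close> is abstract so that the scalar problem and
  the one on \<T> are served by the same argument.\<close>

lemma the_effective_matrix:
  fixes F :: "real^'n \<Rightarrow> (real^2 \<Rightarrow> real^'n) \<Rightarrow> bool"
    and L1 L2 :: "real^'n^'n"
  assumes cell: "two_phase_cell A1 A2"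
    and ex: "\<And>E0. \<exists>E. F E0 E"
    and F_L2: "\<And>E0 E. F E0 E \<Longrightarrow> L2_cell E"
    and lin: "\<And>E0 E E0' E' a b. F E0 E \<Longrightarrow> F E0' E' \<Longrightarrow> F (a *\<^sub>R E0 + b *\<^sub>R E0') (\<lambda>x. a *\<^sub>R E x + b *\<^sub>R E' x)"
    and uniq: "\<And>E0 E E'. F E0 E \<Longrightarrow> F E0 E' \<Longrightarrow> AE x in \<mu>. E x = E' x"
    and F: "F E0 E"
  defines "L \<equiv> two_phase A1 A2 L1 L2"
  shows "(THE M. \<forall>E0. \<exists>E. F E0 E \<and> M *v E0 = (LINT x|\<mu>. L x *v E x)) *v E0 = (LINT x|\<mu>. L x *v E x)"
proof -
  define J where "J E = (LINT x|\<mu>. L x *v E x)" for E :: "real^2 \<Rightarrow> real^'n"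
  have LL: "L2_cell (\<lambda>x. L x *v E x)" if "L2_cell E" for E
    unfolding L_def by (rule L2_cell_two_phase_mult[OF cell that])
  have J_eq: "J E = J E'" if "F E0 E" "F E0 E'" for E0 E E'
    unfolding J_def using uniq[OF that] L2_cell_measurable[OF LL[OF F_L2]] that
    by (intro integral_cong_AE) auto
  have J_lin: "J (\<lambda>x. a *\<^sub>R E x + b *\<^sub>R E' x) = a *\<^sub>R J E + b *\<^sub>R J E'"
    if "L2_cell E" "L2_cell E'" for E E' a b
    using L2_cell_integrable[OF LL[OF that(1)]] L2_cell_integrable[OF LL[OF that(2)]]
    by (simp add: J_def matrix_vector_right_distrib matrix_vector_mult_scaleR)
  define S where "S E0 = (SOME E. F E0 E)" for E0
  have S: "F E0 (S E0)" for E0 unfolding S_def using ex by (rule someI_ex)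
  have JS: "J (S (a *\<^sub>R u + b *\<^sub>R v)) = a *\<^sub>R J (S u) + b *\<^sub>R J (S v)" for u v a b
    using J_eq[OF S lin[OF S S]] J_lin[OF F_L2[OF S] F_L2[OF S]] by simp
  have "linear (\<lambda>E0. J (S E0))"
    using JS[of 1 _ 1] JS[of _ _ 0 0] by (intro linearI) auto
  then have M: "matrix (\<lambda>E0. J (S E0)) *v E0 = J (S E0)" for E0
    by (simp only: fun_cong[OF matrix_vector_mul(2)])
  have "(THE M. \<forall>E0. \<exists>E. F E0 E \<and> M *v E0 = J E) = matrix (\<lambda>E0. J (S E0))"
  proof (rule the_equality)
    show "\<forall>E0. \<exists>E. F E0 E \<and> matrix (\<lambda>E0. J (S E0)) *v E0 = J E" using S M by blast
    fix M' assume M': "\<forall>E0. \<exists>E. F E0 E \<and> M' *v E0 = J E"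
    have "M' *v E0 = matrix (\<lambda>E0. J (S E0)) *v E0" for E0
      using M' J_eq[OF S] unfolding M by metis
    then show "M' = matrix (\<lambda>E0. J (S E0))" by (simp add: matrix_eq)
  qed
  then show ?thesis using M J_eq[OF S F] unfolding J_def by simp
qed

lemma conduction_field_L2: "conduction_field \<sigma> e0 e \<Longrightarrow> L2_cell e"
proof -
  assume "conduction_field \<sigma> e0 e"
  then have "L2_cell (\<lambda>x. e x - e0)" unfolding conduction_field_def using H1_per_grad_L2 by blast
  from L2_cell_add[OF this L2_cell_const[of e0]] show "L2_cell e" by simp
qed

lemma conduction_field_lincomb:
  assumes "conduction_field \<sigma> e0 e" "conduction_field \<sigma> e0' e'"
  shows "conduction_field \<sigma> (a *\<^sub>R e0 + b *\<^sub>R e0') (\<lambda>x. a *\<^sub>R e x + b *\<^sub>R e' x)"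
proof -
  obtain \<phi> \<phi>' where "H1_per_grad \<phi> (\<lambda>x. e x - e0)" "H1_per_grad \<phi>' (\<lambda>x. e' x - e0')"
    using assms unfolding conduction_field_def by blast
  from H1_per_grad_lincomb[OF this, of a b]
  have "H1_per_grad (\<lambda>x. a * \<phi> x + b * \<phi>' x) (\<lambda>x. (a *\<^sub>R e x + b *\<^sub>R e' x) - (a *\<^sub>R e0 + b *\<^sub>R e0'))"
    by (simp add: scaleR_diff_right algebra_simps)
  moreover have "div_free (\<lambda>x. \<sigma> x *v (a *\<^sub>R e x + b *\<^sub>R e' x))"
    using assms div_free_lincomb[of "\<lambda>x. \<sigma> x *v e x" "\<lambda>x. \<sigma> x *v e' x" a b]
    by (simp add: conduction_field_def matrix_vector_right_distrib matrix_vector_mult_scaleR)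
  ultimately show ?thesis unfolding conduction_field_def by blast
qed

lemma conduction_field_mean:
  assumes "conduction_field \<sigma> e0 e" shows "(LINT x|\<mu>. e x) = e0"
proof -
  obtain \<phi> where "H1_per_grad \<phi> (\<lambda>x. e x - e0)" using assms unfolding conduction_field_def by blast
  then have "(LINT x|\<mu>. e x - e0) = 0" by (rule H1_per_grad_mean)
  then show ?thesis
    using L2_cell_integrable[OF conduction_field_L2[OF assms]] LINT_cell_const[of e0] by simp
qed

context
  fixes A1 A2 :: "(real^2) set" and s1 s2 :: "real^2^2"
  assumes cell: "two_phase_cell A1 A2" and s1: "sym_pos_def s1" and s2: "sym_pos_def s2"
begin

lemma conduction_field_exists: "\<exists>e. conduction_field (two_phase A1 A2 s1 s2) e0 e"
proof -
  define W where "W = {grad u | u. smooth_per u}"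
  have "\<exists>w g. (\<forall>n::nat. w n \<in> W) \<and> L2_cell g \<and> (\<lambda>n. sqn (\<lambda>x. w n x - g x)) \<longlonglongrightarrow> 0 \<and>
      (\<forall>v\<in>W. (LINT x|\<mu>. (two_phase A1 A2 s1 s2 x *v (e0 + g x)) \<bullet> v x) = 0)"
  proof (rule variational_solution[OF cell s1 s2])
    show "L2_cell w" if "w \<in> W" for w
      using that unfolding W_def by (auto intro: L2_cell_continuous smooth_per_continuous_grad)
    show "W \<noteq> {}" unfolding W_def using smooth_per_wave by blast
    fix v w a assume "v \<in> W" "w \<in> W"
    then obtain p q where pq: "v = grad p" "w = grad q" "smooth_per p" "smooth_per q" unfolding W_def by blast
    have "(\<lambda>x. v x + a *\<^sub>R w x) = grad (\<lambda>x. 1 * p x + a * q x)"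
      unfolding fun_eq_iff grad_lincomb[OF pq(3,4)] by (simp add: pq)
    then show "(\<lambda>x. v x + a *\<^sub>R w x) \<in> W" unfolding W_def using smooth_per_lincomb[OF pq(3,4)] by blast
  qed
  then obtain w g where w: "\<forall>n::nat. w n \<in> W" and g: "L2_cell g" "(\<lambda>n. sqn (\<lambda>x. w n x - g x)) \<longlonglongrightarrow> 0"
    and EL: "\<And>v. v \<in> W \<Longrightarrow> (LINT x|\<mu>. (two_phase A1 A2 s1 s2 x *v (e0 + g x)) \<bullet> v x) = 0" by blast
  have "\<exists>u. \<forall>n. smooth_per (u n) \<and> w n = grad (u n)"
    using w unfolding W_def by (intro choice) blast
  then obtain u where u: "\<And>n. smooth_per (u n)" "\<And>n. w n = grad (u n)" by blast
  have "(\<lambda>n. sqn (\<lambda>x. grad (u n) x - g x)) \<longlonglongrightarrow> 0" using g(2) by (simp add: u(2))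
  from H1_per_grad_limit[OF u(1) g(1) this] obtain \<phi> where "H1_per_grad \<phi> g" by blast
  moreover have "div_free (\<lambda>x. two_phase A1 A2 s1 s2 x *v (e0 + g x))"
    unfolding div_free_def
    using EL by (auto simp: W_def intro!: L2_cell_two_phase_mult cell L2_cell_intros g(1))
  ultimately show ?thesis
    unfolding conduction_field_def by (intro exI[of _ "\<lambda>x. e0 + g x"]) auto
qed

lemma conduction_field_unique:
  assumes "conduction_field (two_phase A1 A2 s1 s2) e0 e" "conduction_field (two_phase A1 A2 s1 s2) e0 e'"
  shows "AE x in \<mu>. e x = e' x"
proof -
  let ?d = "\<lambda>x. e x - e' x"
  have "conduction_field (two_phase A1 A2 s1 s2) 0 ?d"
    using conduction_field_lincomb[OF assms, of 1 "-1"] by simp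
  note d = this
  obtain \<phi> where "H1_per_grad \<phi> ?d" "div_free (\<lambda>x. two_phase A1 A2 s1 s2 x *v ?d x)"
    using d by (auto simp: conduction_field_def)
  then have "(LINT x|\<mu>. (two_phase A1 A2 s1 s2 x *v ?d x) \<bullet> ?d x) = 0"
    by (intro div_free_inner_H1_grad)
  note zero = this
  have L: "L2_cell ?d" by (rule conduction_field_L2[OF d])
  obtain c where c: "c > 0"
    "\<And>f. L2_cell f \<Longrightarrow> c * sqn f \<le> (LINT x|\<mu>. (two_phase A1 A2 s1 s2 x *v f x) \<bullet> f x)"
    using two_phase_coercive[OF cell s1 s2] by blast
  have "c * sqn ?d \<le> 0" using c(2)[OF L] unfolding zero .
  then have "sqn ?d = 0" using c(1) sqn_nonneg[of ?d] by (simp add: mult_le_0_iff)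
  then show ?thesis using L by (simp add: sqn_eq_0_iff)
qed

lemma effective_conductivity_mult:
  assumes "conduction_field (two_phase A1 A2 s1 s2) e0 e"
  shows "effective_conductivity (two_phase A1 A2 s1 s2) *v e0 = (LINT x|\<mu>. two_phase A1 A2 s1 s2 x *v e x)"
  unfolding effective_conductivity_def
proof (rule the_effective_matrix[where F="conduction_field (two_phase A1 A2 s1 s2)", OF cell])
  show "\<exists>e. conduction_field (two_phase A1 A2 s1 s2) e0 e" for e0 by (rule conduction_field_exists)
qed (fact assms | erule conduction_field_L2 | erule (1) conduction_field_lincomb
    | erule (1) conduction_field_unique)+

text \<open>Hill's identity: the current is orthogonal to the fluctuation \<open>e' - e0'\<close>, a
  periodic gradient, so the mean of a product of current and field equals the product of their
  means.\<close>

lemma conduction_field_energy: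
  assumes "conduction_field (two_phase A1 A2 s1 s2) e0 e" "conduction_field (two_phase A1 A2 s1 s2) e0' e'"
  shows "(LINT x|\<mu>. (two_phase A1 A2 s1 s2 x *v e x) \<bullet> e' x)
    = (effective_conductivity (two_phase A1 A2 s1 s2) *v e0) \<bullet> e0'"
proof -
  let ?J = "\<lambda>x. two_phase A1 A2 s1 s2 x *v e x"
  have L: "L2_cell ?J" "L2_cell e'"
    using assms conduction_field_L2 by (auto simp: conduction_field_def div_free_L2)
  obtain \<phi> where "H1_per_grad \<phi> (\<lambda>x. e' x - e0')" "div_free ?J"
    using assms unfolding conduction_field_def by blast
  then have "(LINT x|\<mu>. ?J x \<bullet> (e' x - e0')) = 0" by (intro div_free_inner_H1_grad)
  moreover have "(LINT x|\<mu>. ?J x \<bullet> (e' x - e0')) = (LINT x|\<mu>. ?J x \<bullet> e' x) - (LINT x|\<mu>. ?J x) \<bullet> e0'"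
    unfolding inner_diff_right
    using L2_cell_inner_integrable[OF L] L2_cell_integrable[OF L(1)] by simp
  ultimately show ?thesis by (simp add: effective_conductivity_mult[OF assms(1)])
qed

lemma effective_conductivity_symmetric:
  "(effective_conductivity (two_phase A1 A2 s1 s2) *v u) \<bullet> v
    = (effective_conductivity (two_phase A1 A2 s1 s2) *v v) \<bullet> u"
proof -
  obtain e e' where e: "conduction_field (two_phase A1 A2 s1 s2) u e" "conduction_field (two_phase A1 A2 s1 s2) v e'"
    using conduction_field_exists by blast
  have "(two_phase A1 A2 s1 s2 x *v e x) \<bullet> e' x = (two_phase A1 A2 s1 s2 x *v e' x) \<bullet> e x" for x
    by (subst two_phase_commute[OF s1 s2]) (rule inner_commute)
  then show ?thesis
    by (simp only: conduction_field_energy[OF e, symmetric] conduction_field_energy[OF e(2,1), symmetric])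
qed

end

section \<open>Bounds on the spectrum of the effective conductivity\<close>

lemma norm_mean_le_sqn:
  fixes f :: "real^2 \<Rightarrow> 'a::euclidean_space"
  assumes "L2_cell f" shows "(norm (LINT x|\<mu>. f x))\<^sup>2 \<le> sqn f"
proof -
  define m where "m = (LINT x|\<mu>. f x)"
  have i: "(LINT x|\<mu>. f x \<bullet> m) = m \<bullet> m"
    using L2_cell_integrable[OF assms] by (simp add: m_def)
  have "sqn (\<lambda>x. m) = m \<bullet> m"
    unfolding sqn_def LINT_cell_const power2_norm_eq_inner ..
  then have "sqn (\<lambda>x. f x + (-1) *\<^sub>R m) = sqn f - m \<bullet> m"
    using sqn_add_scaled[OF assms L2_cell_const, of "-1" m] by (simp add: i)
  then show ?thesis
    using sqn_nonneg[of "\<lambda>x. f x + (-1) *\<^sub>R m"] by (simp add: m_def power2_norm_eq_inner)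
qed

lemma sym_pos_def_scaled_identity: "h > 0 \<Longrightarrow> sym_pos_def (h *\<^sub>R mat 1 :: real^'n^'n)"
  by (simp add: sym_pos_def_def transpose_scalar transpose_mat flip: scaleR_matrix_vector_assoc)

lemma sym_pos_def_identity: "sym_pos_def (mat 1 :: real^'n^'n)"
  using sym_pos_def_scaled_identity[of 1] by simp

text \<open>For an eigenvector the energy is \<open>t * (v \<bullet> v)\<close>. Jensen's inequality
  for the field, whose mean is \<open>v\<close>, gives the lower bound; the same inequality for the
  current, whose mean is \<open>t *\<^sub>R v\<close>, gives the upper one.\<close>

lemma Sigma_eff_eigenvalue_bounds:
  assumes cell: "two_phase_cell A1 A2" and h: "h > 0"
    and v: "Sigma_eff A1 A2 h *v v = t *\<^sub>R v" "v \<noteq> 0"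
  shows "min 1 h \<le> t" "t \<le> max 1 h"
proof -
  let ?\<sigma> = "two_phase A1 A2 (mat 1) (h *\<^sub>R mat 1) :: real^2 \<Rightarrow> real^2^2"
  note spd = sym_pos_def_identity sym_pos_def_scaled_identity[OF h]
  obtain e where e: "conduction_field ?\<sigma> v e"
    using conduction_field_exists[OF cell spd] by blast
  have Le: "L2_cell e" by (rule conduction_field_L2[OF e])
  have LJ: "L2_cell (\<lambda>x. ?\<sigma> x *v e x)" by (rule L2_cell_two_phase_mult[OF cell Le])
  have energy: "(LINT x|\<mu>. (?\<sigma> x *v e x) \<bullet> e x) = t * (v \<bullet> v)"
    unfolding conduction_field_energy[OF cell spd e e] using v(1) by (simp add: Sigma_eff_def)
  have mean: "(LINT x|\<mu>. ?\<sigma> x *v e x) = t *\<^sub>R v"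
    using effective_conductivity_mult[OF cell spd e] v(1) by (simp add: Sigma_eff_def)
  have vv: "v \<bullet> v > 0" using v(2) by simp
  have \<sigma>: "\<exists>k. (k = 1 \<or> k = h) \<and> ?\<sigma> x *v e x = k *\<^sub>R e x" if "x \<in> cell" for x
  proof -
    have "x \<in> A1 \<or> x \<in> A2" using that cell by (auto simp: two_phase_cell_def)
    then have "?\<sigma> x = mat 1 \<or> ?\<sigma> x = h *\<^sub>R mat 1" using two_phase_simps[OF cell] by blast
    then show ?thesis
      by (elim disjE) (auto intro: exI[of _ 1] exI[of _ h] simp flip: scaleR_matrix_vector_assoc)
  qed
  have "min 1 h * (v \<bullet> v) \<le> min 1 h * sqn e"
    using norm_mean_le_sqn[OF Le] h by (simp add: conduction_field_mean[OF e] power2_norm_eq_inner)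
  also have "\<dots> = (LINT x|\<mu>. min 1 h * (norm (e x))\<^sup>2)" by (simp add: sqn_def)
  also have "\<dots> \<le> (LINT x|\<mu>. (?\<sigma> x *v e x) \<bullet> e x)"
  proof (intro integral_mono integrable_mult_right L2_cell_sq_integrable Le L2_cell_inner_integrable LJ)
    fix x assume "x \<in> space \<mu>"
    then obtain k where k: "k = 1 \<or> k = h" "?\<sigma> x *v e x = k *\<^sub>R e x"
      using \<sigma>[of x] by (auto simp: space_restrict_space)
    then have "min 1 h \<le> k" by auto
    then show "min 1 h * (norm (e x))\<^sup>2 \<le> (?\<sigma> x *v e x) \<bullet> e x"
      unfolding k(2) inner_scaleR_left power2_norm_eq_inner by (intro mult_right_mono) auto
  qed
  finally show lower: "min 1 h \<le> t" unfolding energy using vv by simp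
  have t: "t > 0" using lower h by linarith
  have "t\<^sup>2 * (v \<bullet> v) \<le> sqn (\<lambda>x. ?\<sigma> x *v e x)"
    using norm_mean_le_sqn[OF LJ] unfolding mean
    by (simp add: power_mult_distrib flip: power2_norm_eq_inner)
  also have "\<dots> \<le> (LINT x|\<mu>. max 1 h * ((?\<sigma> x *v e x) \<bullet> e x))"
    unfolding sqn_def
  proof (intro integral_mono integrable_mult_right L2_cell_sq_integrable Le L2_cell_inner_integrable LJ)
    fix x assume "x \<in> space \<mu>"
    then obtain k where k: "k = 1 \<or> k = h" "?\<sigma> x *v e x = k *\<^sub>R e x"
      using \<sigma>[of x] by (auto simp: space_restrict_space)
    then have "k * k \<le> max 1 h * k" using h by (intro mult_right_mono) auto
    then have "(k * k) * (e x \<bullet> e x) \<le> (max 1 h * k) * (e x \<bullet> e x)" by (rule mult_right_mono) simp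
    then show "(norm (?\<sigma> x *v e x))\<^sup>2 \<le> max 1 h * ((?\<sigma> x *v e x) \<bullet> e x)"
      unfolding k(2) power2_norm_eq_inner by (simp add: mult.assoc)
  qed
  also have "\<dots> = max 1 h * (t * (v \<bullet> v))" using energy by simp
  finally have "t * (t * (v \<bullet> v)) \<le> max 1 h * (t * (v \<bullet> v))" by (simp add: power2_eq_square mult.assoc)
  then show "t \<le> max 1 h" using t vv by (simp add: mult_le_cancel_right)
qed

section \<open>Fields in \<open>\<T>\<close> and effective tensors\<close>

lemma sum_UNIV_pairs: "(\<Sum>p\<in>UNIV. f p) = (\<Sum>i\<in>UNIV. \<Sum>j\<in>UNIV. f (i, j))"
  for f :: "'a::finite \<times> 'b::finite \<Rightarrow> 'c::comm_monoid_add"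
  by (simp add: sum.cartesian_product flip: UNIV_Times_UNIV)

lemma component_simps:
  "component i (E + F) = component i E + component i F"
  "component i (E - F) = component i E - component i F"
  "component i (a *\<^sub>R E) = a *\<^sub>R component i E"
  "component i 0 = 0"
  by (simp_all add: component_def vec_eq_iff)

lemma bounded_linear_component: "bounded_linear (component i)"
  by (intro linear_conv_bounded_linear[THEN iffD1] linearI) (simp_all add: component_simps)

lemma component_eqI: "(\<And>i. component i E = component i F) \<Longrightarrow> E = F"
  by (auto simp: component_def vec_eq_iff)

lemma inner_eq_sum_component: "E \<bullet> F = (\<Sum>i\<in>UNIV. component i E \<bullet> component i F)"
  by (simp add: inner_vec_def sum_UNIV_pairs component_def)

lemma norm_component_le: "norm (component i E) \<le> norm E"
proof (rule power2_le_imp_le)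
  have "component i E \<bullet> component i E \<le> (\<Sum>j\<in>UNIV. component j E \<bullet> component j E)"
    by (rule member_le_sum) auto
  then show "(norm (component i E))\<^sup>2 \<le> (norm E)\<^sup>2"
    by (simp only: power2_norm_eq_inner inner_eq_sum_component[of E])
qed simp

lemma component_kron: "component i ((A \<otimes> B) *v E) = (\<Sum>j\<in>UNIV. A $ i $ j *\<^sub>R (B *v component j E))"
  by (simp add: vec_eq_iff component_def kron_def matrix_vector_mult_def sum_UNIV_pairs sum_distrib_left mult.assoc)

lemma component_TT:
  "component 1 (TT *v E) = - (R_perp *v component 2 E)"
  "component 2 (TT *v E) = R_perp *v component 1 E"
  by (simp_all add: TT_def component_kron sum_2 R_perp_def)

definition inject :: "2 \<Rightarrow> real^2 \<Rightarrow> \<T>" where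
  "inject i v = (\<chi> p. if fst p = i then v $ snd p else 0)"

lemma component_inject: "component i (inject j v) = (if i = j then v else 0)"
  by (simp add: component_def inject_def vec_eq_iff)

lemma bounded_linear_inject: "bounded_linear (inject i)"
  by (intro linear_conv_bounded_linear[THEN iffD1] linearI) (simp_all add: inject_def vec_eq_iff)

lemma L2_cell_block: "L2_cell E \<Longrightarrow> L2_cell (\<lambda>x. component i (E x))"
  using L2_cell_linear bounded_linear_component by blast

lemma cell_field_L2:
  assumes "cell_field L E0 E" shows "L2_cell E"
proof -
  have "L2_cell (\<lambda>x. component i (E x - E0))" for i
    using assms H1_per_grad_L2 unfolding cell_field_def by blast
  then have "L2_cell (\<lambda>x. inject i (component i (E x - E0)))" for i
    using L2_cell_linear bounded_linear_inject by blast
  from L2_cell_add[OF L2_cell_add[OF this[of 1] this[of 2]] L2_cell_const[of E0]]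
  have "L2_cell (\<lambda>x. inject 1 (component 1 (E x - E0)) + inject 2 (component 2 (E x - E0)) + E0)" .
  moreover have "inject 1 (component 1 (E x - E0)) + inject 2 (component 2 (E x - E0)) + E0 = E x" for x
    by (rule component_eqI, rename_tac i, case_tac "i = 1")
      (use exhaust_2 in \<open>auto simp: component_simps component_inject\<close>)
  ultimately show ?thesis by simp
qed

lemma cell_field_lincomb:
  assumes "cell_field L E0 E" "cell_field L E0' E'"
  shows "cell_field L (a *\<^sub>R E0 + b *\<^sub>R E0') (\<lambda>x. a *\<^sub>R E x + b *\<^sub>R E' x)"
  unfolding cell_field_def
proof (intro conjI allI)
  fix i
  obtain \<phi> \<phi>' where "H1_per_grad \<phi> (\<lambda>x. component i (E x - E0))" "H1_per_grad \<phi>' (\<lambda>x. component i (E' x - E0'))"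
    using assms unfolding cell_field_def by blast
  from H1_per_grad_lincomb[OF this, of a b]
  have "H1_per_grad (\<lambda>x. a * \<phi> x + b * \<phi>' x)
      (\<lambda>x. component i ((a *\<^sub>R E x + b *\<^sub>R E' x) - (a *\<^sub>R E0 + b *\<^sub>R E0')))"
    by (simp add: component_simps scaleR_diff_right algebra_simps)
  then show "\<exists>\<phi>. H1_per_grad \<phi> (\<lambda>x. component i ((a *\<^sub>R E x + b *\<^sub>R E' x) - (a *\<^sub>R E0 + b *\<^sub>R E0')))"
    by blast
  show "div_free (\<lambda>x. component i (L x *v (a *\<^sub>R E x + b *\<^sub>R E' x)))"
    using assms div_free_lincomb[of "\<lambda>x. component i (L x *v E x)" "\<lambda>x. component i (L x *v E' x)" a b]
    by (simp add: cell_field_def matrix_vector_right_distrib matrix_vector_mult_scaleR component_simps)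
qed

context
  fixes A1 A2 :: "(real^2) set" and L1 L2 :: "op\<T>"
  assumes cell: "two_phase_cell A1 A2" and L1: "sym_pos_def L1" and L2: "sym_pos_def L2"
begin

lemma cell_field_exists: "\<exists>E. cell_field (two_phase A1 A2 L1 L2) E0 E"
proof -
  let ?L = "two_phase A1 A2 L1 L2"
  define G where "G u = (\<lambda>x. inject 1 (grad (u (1::2)) x) + inject 2 (grad (u 2) x))" for u
  have cG: "component i (G u x) = grad (u i) x" for u i x
    using exhaust_2[of i] by (auto simp: G_def component_simps component_inject)
  define W where "W = {G u | u. \<forall>i. smooth_per (u i)}"
  have "\<exists>w g. (\<forall>n::nat. w n \<in> W) \<and> L2_cell g \<and> (\<lambda>n. sqn (\<lambda>x. w n x - g x)) \<longlonglongrightarrow> 0 \<and>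
      (\<forall>v\<in>W. (LINT x|\<mu>. (?L x *v (E0 + g x)) \<bullet> v x) = 0)"
  proof (rule variational_solution[OF cell L1 L2])
    show "L2_cell w" if wW: "w \<in> W" for w
    proof -
      obtain u where u: "w = G u" "\<And>i. smooth_per (u i)" using wW unfolding W_def by blast
      show ?thesis
        unfolding u(1) G_def
        by (intro L2_cell_add L2_cell_linear[OF _ bounded_linear_inject] L2_cell_continuous
            smooth_per_continuous_grad u(2))
    qed
    have "G (\<lambda>_. wave 0 0 0 0) \<in> W" unfolding W_def using smooth_per_wave by blast
    then show "W \<noteq> {}" by blast
    fix v w a assume "v \<in> W" "w \<in> W"
    then obtain p q where pq: "v = G p" "w = G q" "\<And>i. smooth_per (p i)" "\<And>i. smooth_per (q i)"
      unfolding W_def by blast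
    have "(\<lambda>x. v x + a *\<^sub>R w x) = G (\<lambda>i x. 1 * p i x + a * q i x)"
      by (intro ext component_eqI) (simp add: component_simps pq(1,2) cG grad_lincomb[OF pq(3,4), where a=1, simplified])
    moreover have "\<forall>i. smooth_per (\<lambda>x. 1 * p i x + a * q i x)" by (intro allI smooth_per_lincomb pq)
    ultimately show "(\<lambda>x. v x + a *\<^sub>R w x) \<in> W" unfolding W_def by (intro CollectI exI conjI)
  qed
  then obtain w g where w: "\<And>n::nat. w n \<in> W" and g: "L2_cell g" "(\<lambda>n. sqn (\<lambda>x. w n x - g x)) \<longlonglongrightarrow> 0"
    and EL: "\<And>v. v \<in> W \<Longrightarrow> (LINT x|\<mu>. (?L x *v (E0 + g x)) \<bullet> v x) = 0" by blast
  have "\<exists>u. \<forall>n. (\<forall>i. smooth_per (u n i)) \<and> w n = G (u n)"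
    using w unfolding W_def by (intro choice allI) blast
  then obtain u where u: "\<And>n i. smooth_per (u n i)" "\<And>n. w n = G (u n)" by blast
  have Lg: "L2_cell (\<lambda>x. component i (g x))" for i by (rule L2_cell_block[OF g(1)])
  have LJ: "L2_cell (\<lambda>x. ?L x *v (E0 + g x))"
    by (intro L2_cell_two_phase_mult cell L2_cell_add L2_cell_const g(1))
  have "\<exists>\<phi>. H1_per_grad \<phi> (\<lambda>x. component i (g x))" for i
  proof (rule H1_per_grad_limit[OF u(1) Lg])
    show "(\<lambda>n. sqn (\<lambda>x. grad (u n i) x - component i (g x))) \<longlonglongrightarrow> 0"
    proof (rule tendsto_sandwich[OF _ _ tendsto_const g(2)])
      have "sqn (\<lambda>x. grad (u n i) x - component i (g x)) \<le> sqn (\<lambda>x. w n x - g x)" for n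
        unfolding sqn_def
      proof (rule integral_mono)
        have Ld: "L2_cell (\<lambda>x. w n x - g x)"
          unfolding u(2) G_def
          by (intro L2_cell_diff g(1) L2_cell_add L2_cell_linear[OF _ bounded_linear_inject] L2_cell_continuous
            smooth_per_continuous_grad u(1))
        then show "integrable \<mu> (\<lambda>x. (norm (w n x - g x))\<^sup>2)" by (rule L2_cell_sq_integrable)
        show "integrable \<mu> (\<lambda>x. (norm (grad (u n i) x - component i (g x)))\<^sup>2)"
          using L2_cell_sq_integrable[OF L2_cell_block[OF Ld, of i]] by (simp add: component_simps u(2) cG)
        show "(norm (grad (u n i) x - component i (g x)))\<^sup>2 \<le> (norm (w n x - g x))\<^sup>2" for x
          using norm_component_le[of i "w n x - g x"] by (simp add: component_simps u(2) cG)
      qed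
      then show "\<forall>\<^sub>F n in sequentially. sqn (\<lambda>x. grad (u n i) x - component i (g x)) \<le> sqn (\<lambda>x. w n x - g x)"
        by (intro always_eventually allI)
    qed (simp add: sqn_nonneg)
  qed
  moreover have "div_free (\<lambda>x. component i (?L x *v (E0 + g x)))" for i
    unfolding div_free_def
  proof (intro conjI allI impI L2_cell_block LJ)
    fix \<psi> assume \<psi>: "smooth_per \<psi>"
    \<comment> \<open>A test potential with only the \<open>i\<close>-th component nonzero
      (\<open>wave 0 0 0 0\<close> is the zero function) isolates one component of the weak
      equation.\<close>
    define q where "q j = (if j = i then \<psi> else wave 0 0 0 0)" for j
    have "G q \<in> W" unfolding W_def q_def using \<psi> smooth_per_wave by auto
    from EL[OF this] have "(LINT x|\<mu>. (\<Sum>j\<in>UNIV. component j (?L x *v (E0 + g x)) \<bullet> grad (q j) x)) = 0"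
      by (simp only: inner_eq_sum_component cG)
    moreover have "grad (wave 0 0 0 0) x = 0" for x
      by (simp add: grad_def vec_eq_iff forall_2 partial_wave) (simp add: wave_def)
    then have "component j (?L x *v (E0 + g x)) \<bullet> grad (q j) x
        = (if j = i then component i (?L x *v (E0 + g x)) \<bullet> grad \<psi> x else 0)" for j x
      by (simp add: q_def)
    ultimately show "(LINT x|\<mu>. component i (?L x *v (E0 + g x)) \<bullet> grad \<psi> x) = 0"
      by (simp add: sum.delta)
  qed
  ultimately show ?thesis
    unfolding cell_field_def by (intro exI[of _ "\<lambda>x. E0 + g x"]) simp
qed

lemma cell_field_unique:
  assumes "cell_field (two_phase A1 A2 L1 L2) E0 E" "cell_field (two_phase A1 A2 L1 L2) E0 E'"
  shows "AE x in \<mu>. E x = E' x"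
proof -
  let ?L = "two_phase A1 A2 L1 L2"
  let ?d = "\<lambda>x. E x - E' x"
  have d: "cell_field ?L 0 ?d" using cell_field_lincomb[OF assms, of 1 "-1"] by simp
  have L: "L2_cell ?d" by (rule cell_field_L2[OF d])
  have LJ: "L2_cell (\<lambda>x. ?L x *v ?d x)" by (rule L2_cell_two_phase_mult[OF cell L])
  have 0: "(LINT x|\<mu>. component i (?L x *v ?d x) \<bullet> component i (?d x)) = 0" for i
  proof -
    obtain \<phi> where "H1_per_grad \<phi> (\<lambda>x. component i (?d x - 0))" "div_free (\<lambda>x. component i (?L x *v ?d x))"
      using d unfolding cell_field_def by blast
    then show ?thesis using div_free_inner_H1_grad by fastforce
  qed
  have "(LINT x|\<mu>. (?L x *v ?d x) \<bullet> ?d x)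
      = (\<Sum>i\<in>UNIV. LINT x|\<mu>. component i (?L x *v ?d x) \<bullet> component i (?d x))"
    unfolding inner_eq_sum_component
    by (intro Bochner_Integration.integral_sum L2_cell_inner_integrable L2_cell_block L LJ)
  then have zero: "(LINT x|\<mu>. (?L x *v ?d x) \<bullet> ?d x) = 0" by (simp only: 0 sum.neutral_const)
  obtain c where c: "c > 0" "\<And>f. L2_cell f \<Longrightarrow> c * sqn f \<le> (LINT x|\<mu>. (?L x *v f x) \<bullet> f x)"
    using two_phase_coercive[OF cell L1 L2] by blast
  have "c * sqn ?d \<le> 0" using c(2)[OF L] unfolding zero .
  then have "sqn ?d = 0" using c(1) sqn_nonneg[of ?d] by (simp add: mult_le_0_iff)
  then show ?thesis using L by (simp add: sqn_eq_0_iff)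
qed

lemma effective_tensor_mult:
  assumes "cell_field (two_phase A1 A2 L1 L2) E0 E"
  shows "effective_tensor (two_phase A1 A2 L1 L2) *v E0 = (LINT x|\<mu>. two_phase A1 A2 L1 L2 x *v E x)"
  unfolding effective_tensor_def
proof (rule the_effective_matrix[where F="cell_field (two_phase A1 A2 L1 L2)", OF cell])
  show "\<exists>E. cell_field (two_phase A1 A2 L1 L2) E0 E" for E0 by (rule cell_field_exists)
qed (fact assms | erule cell_field_L2 | erule (1) cell_field_lincomb | erule (1) cell_field_unique)+

end

text \<open>The \<open>TT\<close> term contributes the indefinite expression
  \<open>2 * r * (a * d - b * c)\<close> to the quadratic form. The bound on
  \<open>r\<^sup>2\<close> is what keeps the remainder positive after two of the four variables have
  been eliminated.\<close>

lemma sym_pos_def_phase: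
  assumes \<sigma>: "sym_pos_def \<sigma>" and r: "r\<^sup>2 < det \<sigma>"
  shows "sym_pos_def (\<sigma> \<otimes> mat 1 + r *\<^sub>R TT)"
proof -
  have sym: "\<sigma> $ 2 $ 1 = \<sigma> $ 1 $ 2"
  proof -
    have "transpose \<sigma> $ 1 $ 2 = \<sigma> $ 1 $ 2" using \<sigma> by (simp add: sym_pos_def_def)
    then show ?thesis by (simp add: transpose_def)
  qed
  have "0 < axis 1 1 \<bullet> (\<sigma> *v axis 1 1)" using \<sigma> by (auto simp: sym_pos_def_def axis_eq_0_iff)
  then have s11: "\<sigma> $ 1 $ 1 > 0"
    by (simp add: inner_axis' matrix_vector_mult_basis column_def)
  have det: "r\<^sup>2 < \<sigma> $ 1 $ 1 * \<sigma> $ 2 $ 2 - (\<sigma> $ 1 $ 2)\<^sup>2"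
    using r by (simp add: det_2 sym power2_eq_square)
  have "transpose (\<sigma> \<otimes> mat 1 + r *\<^sub>R TT) = \<sigma> \<otimes> mat 1 + r *\<^sub>R TT"
    by (simp add: vec_eq_iff transpose_def kron_def TT_def forall_2 R_perp_def mat_def sym)
  moreover have "0 < E \<bullet> ((\<sigma> \<otimes> mat 1 + r *\<^sub>R TT) *v E)" if "E \<noteq> 0" for E
  proof -
    define a b c d where "a = E $ (1, 1)" and "b = E $ (1, 2)" and "c = E $ (2, 1)" and "d = E $ (2, 2)"
    have norm_E: "E \<bullet> E = a\<^sup>2 + b\<^sup>2 + (c\<^sup>2 + d\<^sup>2)"
      by (simp add: inner_eq_sum_component sum_2 inner_vec_def component_def a_def b_def c_def d_def
          power2_eq_square)
    have q: "E \<bullet> ((\<sigma> \<otimes> mat 1 + r *\<^sub>R TT) *v E)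
        = \<sigma> $ 1 $ 1 * (a\<^sup>2 + b\<^sup>2) + 2 * \<sigma> $ 1 $ 2 * (a * c + b * d) + \<sigma> $ 2 $ 2 * (c\<^sup>2 + d\<^sup>2) + 2 * r * (a * d - b * c)"
      by (simp add: inner_eq_sum_component matrix_vector_mult_add_rdistrib component_simps
          component_kron component_TT sum_2 R_perp_mult sym inner_vec_def
          flip: scaleR_matrix_vector_assoc)
        (simp add: component_def a_def b_def c_def d_def power2_eq_square algebra_simps)
    \<comment> \<open>Completion of the squares in \<open>a\<close> and \<open>b\<close> with pivot
      \<open>\<sigma> $ 1 $ 1\<close>; the coefficient that remains in front of
      \<open>c\<^sup>2 + d\<^sup>2\<close> is \<open>det \<sigma> - r\<^sup>2\<close>.\<close>
    have "\<sigma> $ 1 $ 1 * (E \<bullet> ((\<sigma> \<otimes> mat 1 + r *\<^sub>R TT) *v E)) = (\<sigma> $ 1 $ 1 * a + \<sigma> $ 1 $ 2 * c + r * d)\<^sup>2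
        + (\<sigma> $ 1 $ 1 * b + \<sigma> $ 1 $ 2 * d - r * c)\<^sup>2
        + (\<sigma> $ 1 $ 1 * \<sigma> $ 2 $ 2 - (\<sigma> $ 1 $ 2)\<^sup>2 - r\<^sup>2) * (c\<^sup>2 + d\<^sup>2)"
      unfolding q by (simp add: power2_eq_square algebra_simps)
    also have "\<dots> > 0"
    proof (cases "c = 0 \<and> d = 0")
      case True
      have "\<not> (a = 0 \<and> b = 0)"
      proof
        assume "a = 0 \<and> b = 0"
        then have "E \<bullet> E = 0" unfolding norm_E using True by simp
        then show False using that by simp
      qed
      then have "a\<^sup>2 + b\<^sup>2 > 0" by (simp add: sum_power2_gt_zero_iff)
      then have "(\<sigma> $ 1 $ 1)\<^sup>2 * (a\<^sup>2 + b\<^sup>2) > 0" using s11 by simp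
      then show ?thesis using True by (simp add: power_mult_distrib distrib_left)
    next
      case False
      then have "c\<^sup>2 + d\<^sup>2 > 0" by (simp add: sum_power2_gt_zero_iff)
      then have "(\<sigma> $ 1 $ 1 * \<sigma> $ 2 $ 2 - (\<sigma> $ 1 $ 2)\<^sup>2 - r\<^sup>2) * (c\<^sup>2 + d\<^sup>2) > 0"
        using det by (intro mult_pos_pos) auto
      then show ?thesis by (intro add_nonneg_pos add_nonneg_nonneg zero_le_power2)
    qed
    finally show ?thesis using s11 by (simp add: zero_less_mult_iff)
  qed
  ultimately show ?thesis by (simp add: sym_pos_def_def)
qed

section \<open>Reduction of the coupled problem to a scalar one\<close>

lemma H1_per_grad_field_mean:
  assumes "H1_per_grad \<phi> (\<lambda>x. e x - m)" shows "L2_cell e" "(LINT x|\<mu>. e x) = m"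
proof -
  show L: "L2_cell e" using L2_cell_add[OF H1_per_grad_L2[OF assms] L2_cell_const[of m]] by simp
  show "(LINT x|\<mu>. e x) = m"
    using H1_per_grad_mean[OF assms] L2_cell_integrable[OF L] LINT_cell_const[of m] by simp
qed

lemma div_free_rotated_field:
  assumes "H1_per_grad \<phi> (\<lambda>x. e x - m)" shows "div_free (\<lambda>x. R_perp *v e x)"
  using div_free_add[OF div_free_rotated_grad[OF assms] div_free_const[of "R_perp *v m"]]
  by (simp add: matrix_vector_mult_diff_distrib)

lemma LINT_matrix_mult:
  fixes A :: "real^'n^'m"
  assumes "L2_cell f" shows "(LINT x|\<mu>. A *v f x) = A *v (LINT x|\<mu>. f x)"
  by (rule integral_bounded_linear[OF matrix_vector_mul_bounded_linear L2_cell_integrable[OF assms]])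

text \<open>The field produced by the reduction obeys the scalar constitutive law only almost
  everywhere, since constancy is known only in that sense. Divergence-freeness therefore has to be
  carried from \<open>j\<close> to the actual product of coefficient and field.\<close>

lemma conductivity_from_pointwise_relation:
  assumes cell: "two_phase_cell A1 A2" and h: "h > 0"
    and e: "H1_per_grad \<phi> (\<lambda>x. e x - e0)" and j: "div_free j"
    and AE: "AE x in \<mu>. two_phase A1 A2 (mat 1) (h *\<^sub>R mat 1) x *v e x = j x"
  shows "(LINT x|\<mu>. j x) = Sigma_eff A1 A2 h *v e0"
proof -
  let ?\<sigma> = "two_phase A1 A2 (mat 1) (h *\<^sub>R mat 1) :: real^2 \<Rightarrow> real^2^2"
  have L: "L2_cell (\<lambda>x. ?\<sigma> x *v e x)"
    by (rule L2_cell_two_phase_mult[OF cell H1_per_grad_field_mean(1)[OF e]])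
  have "div_free (\<lambda>x. ?\<sigma> x *v e x)"
    by (rule div_free_AE_cong[OF j L]) (use AE in \<open>eventually_elim, simp\<close>)
  then have "conduction_field ?\<sigma> e0 e" using e unfolding conduction_field_def by blast
  then have "Sigma_eff A1 A2 h *v e0 = (LINT x|\<mu>. ?\<sigma> x *v e x)"
    unfolding Sigma_eff_def
    by (rule effective_conductivity_mult[OF cell sym_pos_def_identity sym_pos_def_scaled_identity[OF h]])
  also have "\<dots> = (LINT x|\<mu>. j x)"
    using AE L2_cell_measurable[OF L] L2_cell_measurable[OF div_free_L2[OF j]] by (intro integral_cong_AE)
  finally show ?thesis ..
qed

text \<open>The combination \<open>w = K\<^sub>2 + a R e\<^sub>1\<close> is divergence-free, and the rank-one relation between the
  phases makes it equal to the curl-free field \<open>e\<^sub>2 + a R K\<^sub>1\<close>; so it is constant, which reduces the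
  coupled problem to a scalar conductivity problem for a shift of \<open>e\<^sub>2\<close>.\<close>

lemma rank_one_reduction:
  fixes e1 e2 K1 K2 :: "real^2 \<Rightarrow> real^2"
  assumes cell: "two_phase_cell A1 A2"
    and e1: "H1_per_grad \<phi>1 (\<lambda>x. e1 x - m1)" and e2: "H1_per_grad \<phi>2 (\<lambda>x. e2 x - m2)"
    and K1: "div_free K1" and K2: "div_free K2"
    and ph1: "\<And>x. x \<in> A1 \<Longrightarrow> K1 x = e1 x" "\<And>x. x \<in> A1 \<Longrightarrow> K2 x = e2 x"
    and ph2: "\<And>x. x \<in> A2 \<Longrightarrow> K1 x = d1 *\<^sub>R e1 x - \<rho> *\<^sub>R (R_perp *v e2 x)"
      "\<And>x. x \<in> A2 \<Longrightarrow> K2 x = d2 *\<^sub>R e2 x + \<rho> *\<^sub>R (R_perp *v e1 x)"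
    and d: "d1 > 0" "d2 > 0" "d1 \<noteq> d2" and \<rho>: "\<rho> \<noteq> 0" "(d1 - 1) * (d2 - 1) = \<rho>\<^sup>2"
  defines "a \<equiv> (d2 - 1) / \<rho>" and "s \<equiv> Sigma_eff A1 A2 (d2 / d1)"
  shows "\<exists>e0 y. m2 = e0 + y \<and> a *\<^sub>R m1 = R_perp *v (s *v e0 + a\<^sup>2 *\<^sub>R y) \<and>
    (LINT x|\<mu>. K2 x) = s *v e0 + y \<and> a *\<^sub>R (LINT x|\<mu>. K1 x) = R_perp *v (e0 + a\<^sup>2 *\<^sub>R y)"
proof -
  have a\<rho>: "a * \<rho> = d2 - 1" using \<rho>(1) by (simp add: a_def)
  then have "a * (d1 - 1) * \<rho> = \<rho> * \<rho>" using \<rho>(2) by algebra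
  then have \<rho>_eq: "\<rho> = a * (d1 - 1)" using \<rho>(1) by simp
  have d2_eq: "d2 = 1 + a\<^sup>2 * (d1 - 1)" using a\<rho> \<rho>_eq by (simp add: power2_eq_square)
  \<comment> \<open>The shift \<open>y = \<kappa> *\<^sub>R c\<close> must make
    \<open>K2 - y\<close> equal to \<open>h *\<^sub>R (e2 - y)\<close> in the second phase; in the
    first phase any common shift is harmless. Comparing the coefficients of the rotated
    \<open>e1\<close> gives this value of \<open>\<kappa>\<close>, and the coefficients of
    \<open>e2\<close> then match as well.\<close>
  define \<kappa> where "\<kappa> = (d1 - 1) / (d1 - d2)"
  have \<kappa>a: "\<kappa> - 1 = a\<^sup>2 * \<kappa>" using d(3) d2_eq by (simp add: \<kappa>_def field_simps)
  define w where "w x = K2 x + a *\<^sub>R (R_perp *v e1 x)" for x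
  have w_eq: "w x = e2 x + a *\<^sub>R (R_perp *v K1 x)" if "x \<in> cell" for x
  proof -
    have "x \<in> A1 \<or> x \<in> A2" using that cell by (auto simp: two_phase_cell_def)
    then show ?thesis
    proof
      assume "x \<in> A1"
      then show ?thesis by (simp add: w_def ph1)
    next
      assume "x \<in> A2"
      then show ?thesis
        unfolding w_def ph2[OF \<open>x \<in> A2\<close>]
        by (simp add: vec_eq_iff forall_2 R_perp_mult) (simp add: d2_eq \<rho>_eq power2_eq_square algebra_simps)
    qed
  qed
  note Le1 = H1_per_grad_field_mean(1)[OF e1] and Le2 = H1_per_grad_field_mean(1)[OF e2]
  note LK1 = div_free_L2[OF K1] and LK2 = div_free_L2[OF K2]
  have dw: "div_free w"
    unfolding w_def by (intro div_free_add K2 div_free_scaleR div_free_rotated_field[OF e1])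
  have dRw: "div_free (\<lambda>x. R_perp *v w x)"
  proof (rule div_free_AE_cong)
    show "div_free (\<lambda>x. R_perp *v e2 x - a *\<^sub>R K1 x)"
      by (intro div_free_diff div_free_scaleR K1 div_free_rotated_field[OF e2])
    show "L2_cell (\<lambda>x. R_perp *v w x)"
      by (rule L2_cell_linear[OF div_free_L2[OF dw] matrix_vector_mul_bounded_linear])
    show "AE x in \<mu>. R_perp *v e2 x - a *\<^sub>R K1 x = R_perp *v w x"
      by (rule AE_I2) (simp add: space_restrict_space w_eq matrix_vector_right_distrib
          matrix_vector_mult_scaleR R_perp_simps(1))
  qed
  define c where "c = (LINT x|\<mu>. w x)"
  have AEc: "AE x in \<mu>. w x = c"
    unfolding c_def by (rule div_free_rotated_div_free_imp_const[OF dw dRw])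
  have c1: "c = (LINT x|\<mu>. K2 x) + a *\<^sub>R (R_perp *v m1)"
  proof -
    have "L2_cell (\<lambda>x. a *\<^sub>R (R_perp *v e1 x))"
      by (intro L2_cell_scaleR L2_cell_linear[OF Le1 matrix_vector_mul_bounded_linear])
    from L2_cell_integrable[OF this] L2_cell_integrable[OF LK2] show ?thesis
      unfolding c_def w_def by (simp add: LINT_matrix_mult[OF Le1] H1_per_grad_field_mean(2)[OF e1])
  qed
  have c2: "c = m2 + a *\<^sub>R (R_perp *v (LINT x|\<mu>. K1 x))"
  proof -
    have "c = (LINT x|\<mu>. e2 x + a *\<^sub>R (R_perp *v K1 x))"
      unfolding c_def by (intro Bochner_Integration.integral_cong refl w_eq) (simp add: space_restrict_space)
    note eq = this
    have "L2_cell (\<lambda>x. a *\<^sub>R (R_perp *v K1 x))"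
      by (intro L2_cell_scaleR L2_cell_linear[OF LK1 matrix_vector_mul_bounded_linear])
    from L2_cell_integrable[OF this] L2_cell_integrable[OF Le2] show ?thesis
      unfolding eq by (simp add: LINT_matrix_mult[OF LK1] H1_per_grad_field_mean(2)[OF e2])
  qed
  define y where "y = \<kappa> *\<^sub>R c"
  define e0 where "e0 = m2 - y"
  define h where "h = d2 / d1"
  have h: "h > 0" using d by (simp add: h_def)
  have coeff: "d2 - \<kappa> * d2 = h - h * \<kappa> * d2" "\<rho> - \<kappa> * (a * d1) = - (h * \<kappa> * (a * d1))"
  proof -
    have k: "\<kappa> * (d1 - d2) = d1 - 1" "h * d1 = d2" using d by (simp_all add: \<kappa>_def h_def)
    have "d1 * (d2 - \<kappa> * d2) = d1 * (h - h * \<kappa> * d2)" using k by algebra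
    then show "d2 - \<kappa> * d2 = h - h * \<kappa> * d2" using d(1) by simp
    show "\<rho> - \<kappa> * (a * d1) = - (h * \<kappa> * (a * d1))" unfolding \<rho>_eq using k by algebra
  qed
  have rel: "two_phase A1 A2 (mat 1) (h *\<^sub>R mat 1) x *v (e2 x - y) = K2 x - y"
    if "x \<in> cell" "w x = c" for x
  proof -
    have "x \<in> A1 \<or> x \<in> A2" using that cell by (auto simp: two_phase_cell_def)
    then show ?thesis
    proof
      assume "x \<in> A1"
      then show ?thesis by (simp add: two_phase_simps[OF cell] ph1)
    next
      assume x: "x \<in> A2"
      define X where "X = R_perp *v e1 x"
      have c: "c = d2 *\<^sub>R e2 x + (a * d1) *\<^sub>R X"
        using that(2) unfolding w_def ph2(2)[OF x] X_def[symmetric] \<rho>_eq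
        by (simp add: algebra_simps)
      have "h * (t - \<kappa> * (d2 * t + a * d1 * z)) = d2 * t + \<rho> * z - \<kappa> * (d2 * t + a * d1 * z)" for t z
        using coeff by algebra
      then show ?thesis
        unfolding ph2(2)[OF x] X_def[symmetric] y_def c
        by (simp add: two_phase_simps[OF cell] x vec_eq_iff flip: scaleR_matrix_vector_assoc)
    qed
  qed
  have "(LINT x|\<mu>. K2 x - y) = s *v e0"
    unfolding s_def h_def[symmetric]
  proof (rule conductivity_from_pointwise_relation[OF cell h])
    show "H1_per_grad \<phi>2 (\<lambda>x. (e2 x - y) - e0)" using e2 by (simp add: e0_def)
    show "div_free (\<lambda>x. K2 x - y)" by (intro div_free_diff K2 div_free_const)
    have "AE x in \<mu>. x \<in> cell" by (rule AE_I2) (simp add: space_restrict_space)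
    with AEc show "AE x in \<mu>. two_phase A1 A2 (mat 1) (h *\<^sub>R mat 1) x *v (e2 x - y) = K2 x - y"
      by eventually_elim (rule rel)
  qed
  then have k2: "(LINT x|\<mu>. K2 x) = s *v e0 + y"
    using L2_cell_integrable[OF LK2] LINT_cell_const[of y] by (simp add: algebra_simps)
  have yc: "y - c = a\<^sup>2 *\<^sub>R y"
  proof -
    have "y - c = (\<kappa> - 1) *\<^sub>R c" by (simp add: y_def algebra_simps)
    then show ?thesis unfolding \<kappa>a by (simp add: y_def)
  qed
  have rot: "a *\<^sub>R v = R_perp *v (u - c)" if "c = u + a *\<^sub>R (R_perp *v v)" for u v
    by (simp add: that matrix_vector_mult_scaleR R_perp_simps(1) linear_neg[OF matrix_vector_mul_linear])
  have "a *\<^sub>R m1 = R_perp *v (s *v e0 + a\<^sup>2 *\<^sub>R y)"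
    using rot[OF c1] yc unfolding k2 by (simp add: add_diff_eq[symmetric])
  moreover have "a *\<^sub>R (LINT x|\<mu>. K1 x) = R_perp *v (e0 + a\<^sup>2 *\<^sub>R y)"
    using rot[OF c2] unfolding yc[symmetric] by (simp add: e0_def)
  ultimately show ?thesis using k2 by (intro exI[of _ e0] exI[of _ y]) (simp add: e0_def)
qed

section \<open>Symmetry and nondegeneracy of the scalar effective conductivity\<close>

lemma Sigma_eff_symmetric:
  assumes "two_phase_cell A1 A2" "h > 0"
  shows "Sigma_eff A1 A2 h $ 2 $ 1 = Sigma_eff A1 A2 h $ 1 $ 2"
  using effective_conductivity_symmetric[OF assms(1) sym_pos_def_identity sym_pos_def_scaled_identity[OF assms(2)],
      of "axis 1 1" "axis 2 1"]
  by (simp add: Sigma_eff_def inner_axis matrix_vector_mult_basis column_def)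

lemma det_eq_0_imp_kernel:
  fixes A :: "real^'n^'n"
  assumes "det A = 0" shows "\<exists>v. v \<noteq> 0 \<and> A *v v = 0"
proof -
  have "\<not> (\<exists>B. B ** A = mat 1)"
    using assms by (simp add: invertible_det_nz flip: invertible_left_inverse)
  then show ?thesis unfolding matrix_left_invertible_ker by blast
qed

text \<open>A zero determinant would make \<open>(d2 - 1) / (d1 - 1)\<close> an eigenvalue between 1
  and \<open>d2 / d1\<close>. As \<open>d1\<close> and \<open>d2\<close> lie on the same side of 1,
  this is impossible: for \<open>d1 > 1\<close> the quotient is farther from 1 than
  \<open>d2 / d1\<close> in the same direction, and for \<open>d1 < 1\<close> it lies on the
  opposite side of 1.\<close>

lemma det_Sigma_eff_shift_nonzero:
  assumes cell: "two_phase_cell A1 A2"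
    and d: "d1 > 0" "d2 > 0" "d1 \<noteq> d2" and \<rho>: "\<rho> \<noteq> 0" "(d1 - 1) * (d2 - 1) = \<rho>\<^sup>2"
  shows "det (Sigma_eff A1 A2 (d2 / d1) - ((d2 - 1) / \<rho>)\<^sup>2 *\<^sub>R mat 1) \<noteq> 0"
proof
  define t where "t = ((d2 - 1) / \<rho>)\<^sup>2"
  assume "det (Sigma_eff A1 A2 (d2 / d1) - ((d2 - 1) / \<rho>)\<^sup>2 *\<^sub>R mat 1) = 0"
  then obtain v where v: "v \<noteq> 0" "(Sigma_eff A1 A2 (d2 / d1) - t *\<^sub>R mat 1) *v v = 0"
    unfolding t_def using det_eq_0_imp_kernel by blast
  have "Sigma_eff A1 A2 (d2 / d1) *v v = t *\<^sub>R v"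
    using v(2) by (simp add: matrix_vector_mult_diff_rdistrib flip: scaleR_matrix_vector_assoc)
  from Sigma_eff_eigenvalue_bounds[OF cell _ this v(1)] d
  have bounds: "min 1 (d2 / d1) \<le> t" "t \<le> max 1 (d2 / d1)" by simp_all
  have pos: "(d1 - 1) * (d2 - 1) > 0" using \<rho> by simp
  have t: "t = (d2 - 1) / (d1 - 1)"
    using pos unfolding t_def power_divide \<rho>(2)[symmetric] by (simp add: power2_eq_square)
  show False
  proof (cases "d1 > 1")
    case True
    then have "d2 > 1" using pos by (simp add: zero_less_mult_iff)
    show False
    proof (cases "d1 < d2")
      case True
      then have "d2 / d1 < t" "1 < d2 / d1"
        using \<open>d1 > 1\<close> d unfolding t by (simp_all add: field_simps)
      then show False using bounds(2) by simp
    next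
      case False
      then have "t < d2 / d1" "d2 / d1 < 1"
        using \<open>d1 > 1\<close> d unfolding t by (simp_all add: field_simps)
      then show False using bounds(1) by simp
    qed
  next
    case False
    then have "d1 < 1" "d2 < 1" using pos by (auto simp: zero_less_mult_iff)
    have t': "t = (1 - d2) / (1 - d1)"
      unfolding t using minus_divide_divide[of "1 - d2" "1 - d1"] by simp
    show False
    proof (cases "d1 < d2")
      case True
      then have "t < 1" "1 < d2 / d1"
        using \<open>d1 < 1\<close> d unfolding t' by (simp_all add: field_simps)
      then show False using bounds(1) by simp
    next
      case False
      then have "1 < t" "d2 / d1 < 1"
        using \<open>d1 < 1\<close> d unfolding t' by (simp_all add: field_simps)
      then show False using bounds(2) by simp
    qed
  qed
qed

text \<open>The relations for \<open>m1\<close> and \<open>m2\<close> form a linear system for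
  \<open>e0\<close> and \<open>y\<close>, solved by the adjugate of
  \<open>s - a\<^sup>2 *\<^sub>R mat 1\<close>; this explains the factor \<open>1 / D\<close>. The
  trace-free part \<open>s - x *\<^sub>R mat 1\<close> anticommutes with \<open>R_perp\<close>,
  whereas multiples of the identity commute with it, so the mixed terms split into a pure rotation
  with coefficient \<open>b\<close> and a trace-free coupling.\<close>

lemma flux_formula_algebra:
  fixes s :: "real^2^2" and e0 y m1 m2 k1 k2 :: "real^2" and a :: real
  assumes sym: "s $ 2 $ 1 = s $ 1 $ 2" and a: "a \<noteq> 0"
    and m2: "m2 = e0 + y" and m1: "a *\<^sub>R m1 = R_perp *v (s *v e0 + a\<^sup>2 *\<^sub>R y)"
    and k2: "k2 = s *v e0 + y" and k1: "a *\<^sub>R k1 = R_perp *v (e0 + a\<^sup>2 *\<^sub>R y)"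
  defines "x \<equiv> trace s / 2" and "D \<equiv> det (s - a\<^sup>2 *\<^sub>R mat 1)"
  assumes D: "D \<noteq> 0"
  defines "b \<equiv> a * ((1 - a\<^sup>2) * (x - a\<^sup>2) / D - 1)"
  shows "k1 = - b *\<^sub>R (R_perp *v m2)
      + ((1 - a\<^sup>2) / D) *\<^sub>R ((s - a\<^sup>2 *\<^sub>R mat 1) *v m1 + a *\<^sub>R (R_perp *v ((s - x *\<^sub>R mat 1) *v m2)))"
    and "k2 = b *\<^sub>R (R_perp *v m1)
      + ((1 - a\<^sup>2) / D) *\<^sub>R ((det s *\<^sub>R mat 1 - a\<^sup>2 *\<^sub>R s) *v m2 + a *\<^sub>R (R_perp *v ((s - x *\<^sub>R mat 1) *v m1)))"
proof -
  define p q r where "p = s $ 1 $ 1" and "q = s $ 1 $ 2" and "r = s $ 2 $ 2"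
  define u1 u2 y1 y2 where "u1 = e0 $ 1" and "u2 = e0 $ 2" and "y1 = y $ 1" and "y2 = y $ 2"
  note c = p_def[symmetric] q_def[symmetric] r_def[symmetric] u1_def[symmetric] u2_def[symmetric]
    y1_def[symmetric] y2_def[symmetric]
  \<comment> \<open>The reciprocal is treated as a variable with one polynomial relation, which
    turns the claims into polynomial identities. They are proved after multiplication by
    \<open>a\<close>, because \<open>m1\<close> and \<open>k1\<close> are known only in that
    form.\<close>
  define I where "I = 1 / D"
  have D_eq: "D = (p - a\<^sup>2) * (r - a\<^sup>2) - q * q"
    by (simp add: D_def det_2 sym mat_def c)
  have I: "((p - a\<^sup>2) * (r - a\<^sup>2) - q * q) * I = 1" using D unfolding D_eq[symmetric] by (simp add: I_def)
  have x: "2 * x = p + r" by (simp add: x_def trace_def sum_2 c)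
  have b: "b = a * ((1 - a\<^sup>2) * (x - a\<^sup>2) * I - 1)" by (simp add: b_def I_def)
  have di: "(1 - a\<^sup>2) / D = (1 - a\<^sup>2) * I" by (simp add: I_def)
  have M1: "a * m1 $ 1 = - (q * u1 + r * u2 + a\<^sup>2 * y2)" "a * m1 $ 2 = p * u1 + q * u2 + a\<^sup>2 * y1"
    using arg_cong[OF m1, of "\<lambda>v. v $ 1"] arg_cong[OF m1, of "\<lambda>v. v $ 2"]
    unfolding R_perp_mult by (simp_all add: matrix_vector_mult_def sum_2 sym c)
  have K1: "a * k1 $ 1 = - (u2 + a\<^sup>2 * y2)" "a * k1 $ 2 = u1 + a\<^sup>2 * y1"
    using arg_cong[OF k1, of "\<lambda>v. v $ 1"] arg_cong[OF k1, of "\<lambda>v. v $ 2"]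
    by (simp_all add: R_perp_mult c)
  have M2: "m2 $ 1 = u1 + y1" "m2 $ 2 = u2 + y2" by (simp_all add: m2 c)
  have K2: "k2 $ 1 = p * u1 + q * u2 + y1" "k2 $ 2 = q * u1 + r * u2 + y2"
    by (simp_all add: k2 matrix_vector_mult_def sum_2 sym c)
  show "k1 = - b *\<^sub>R (R_perp *v m2)
      + ((1 - a\<^sup>2) / D) *\<^sub>R ((s - a\<^sup>2 *\<^sub>R mat 1) *v m1 + a *\<^sub>R (R_perp *v ((s - x *\<^sub>R mat 1) *v m2)))"
  proof -
    have "a * k1 $ 1 = a * (b * m2 $ 2 + ((1 - a\<^sup>2) * I) * ((p - a\<^sup>2) * m1 $ 1 + q * m1 $ 2 + a * (- (q * m2 $ 1) - (r - x) * m2 $ 2)))"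
      using M1 K1 x I unfolding M2 b by algebra
    moreover have "a * k1 $ 2 = a * (- b * m2 $ 1 + ((1 - a\<^sup>2) * I) * (q * m1 $ 1 + (r - a\<^sup>2) * m1 $ 2 + a * ((p - x) * m2 $ 1 + q * m2 $ 2)))"
      using M1 K1 x I unfolding M2 b by algebra
    ultimately show ?thesis
      using a unfolding di R_perp_mult by (simp add: vec_eq_iff forall_2 matrix_vector_mult_def sum_2 sym c mat_def)
  qed
  show "k2 = b *\<^sub>R (R_perp *v m1)
      + ((1 - a\<^sup>2) / D) *\<^sub>R ((det s *\<^sub>R mat 1 - a\<^sup>2 *\<^sub>R s) *v m2 + a *\<^sub>R (R_perp *v ((s - x *\<^sub>R mat 1) *v m1)))"
  proof -
    have "a * k2 $ 1 = a * (- b * m1 $ 2 + ((1 - a\<^sup>2) * I) * ((p * r - q * q - a\<^sup>2 * p) * m2 $ 1 - a\<^sup>2 * q * m2 $ 2 + a * (- (q * m1 $ 1) - (r - x) * m1 $ 2)))"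
      using M1 x I unfolding K2 M2 b by algebra
    moreover have "a * k2 $ 2 = a * (b * m1 $ 1 + ((1 - a\<^sup>2) * I) * (- (a\<^sup>2 * q * m2 $ 1) + (p * r - q * q - a\<^sup>2 * r) * m2 $ 2 + a * ((p - x) * m1 $ 1 + q * m1 $ 2)))"
      using M1 x I unfolding K2 M2 b by algebra
    ultimately show ?thesis
      using a unfolding di R_perp_mult by (simp add: vec_eq_iff forall_2 matrix_vector_mult_def sum_2 sym c mat_def det_2)
  qed
qed

section \<open>Simultaneous diagonalisation of the phases\<close>

text \<open>Contraction of the component index with \<open>v\<close>. A change of basis in the space
  of components is expressed by the choice of \<open>v\<close>, on which operators act by the
  transpose, so no tensor has to be conjugated.\<close>

definition comb :: "real^2 \<Rightarrow> \<T> \<Rightarrow> real^2" where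
  "comb v E = v $ 1 *\<^sub>R component 1 E + v $ 2 *\<^sub>R component 2 E"

lemma comb_right_simps:
  "comb v (E + F) = comb v E + comb v F"
  "comb v (E - F) = comb v E - comb v F"
  "comb v (a *\<^sub>R E) = a *\<^sub>R comb v E"
  by (simp_all add: comb_def component_simps algebra_simps)

lemma comb_left_simps:
  "comb (u + v) E = comb u E + comb v E"
  "comb (u - v) E = comb u E - comb v E"
  "comb (- v) E = - comb v E"
  "comb (a *\<^sub>R v) E = a *\<^sub>R comb v E"
  "comb 0 E = 0"
  by (simp_all add: comb_def algebra_simps)

lemma comb_kron: "comb v ((A \<otimes> B) *v E) = B *v comb (transpose A *v v) E"
proof -
  have "(transpose A *v v) $ j = A $ 1 $ j * v $ 1 + A $ 2 $ j * v $ 2" for j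
    by (simp add: matrix_vector_mult_def transpose_def sum_2)
  then show ?thesis
    by (simp add: comb_def component_kron sum_2 matrix_vector_right_distrib matrix_vector_mult_scaleR
        algebra_simps)
qed

lemma comb_TT: "comb v (TT *v E) = - (R_perp *v comb (R_perp *v v) E)"
proof -
  have "transpose R_perp *v v = - (R_perp *v v)"
    by (simp add: vec_eq_iff forall_2 matrix_vector_mult_def transpose_def sum_2 R_perp_def)
  then show ?thesis
    unfolding TT_def comb_kron by (simp add: comb_left_simps linear_neg[OF matrix_vector_mul_linear])
qed

lemma cell_field_comb:
  assumes "cell_field L E0 E"
  shows "\<exists>\<phi>. H1_per_grad \<phi> (\<lambda>x. comb v (E x) - comb v E0)" "div_free (\<lambda>x. comb v (L x *v E x))"
proof -
  obtain \<phi>1 \<phi>2 where "H1_per_grad \<phi>1 (\<lambda>x. component 1 (E x - E0))" "H1_per_grad \<phi>2 (\<lambda>x. component 2 (E x - E0))"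
    using assms unfolding cell_field_def by blast
  from H1_per_grad_lincomb[OF this, of "v $ 1" "v $ 2"]
  show "\<exists>\<phi>. H1_per_grad \<phi> (\<lambda>x. comb v (E x) - comb v E0)"
    unfolding comb_def[symmetric] comb_right_simps by blast
  show "div_free (\<lambda>x. comb v (L x *v E x))"
    unfolding comb_def using assms by (intro div_free_lincomb) (simp_all add: cell_field_def)
qed

lemma LINT_comb:
  assumes "L2_cell E" shows "(LINT x|\<mu>. comb v (E x)) = comb v (LINT x|\<mu>. E x)"
proof -
  have "bounded_linear (comb v)"
    by (intro linear_conv_bounded_linear[THEN iffD1] linearI) (simp_all add: comb_right_simps)
  then show ?thesis by (rule integral_bounded_linear[OF _ L2_cell_integrable[OF assms]])
qed

text \<open>The generalised eigenvalue problem of \<open>\<sigma>2\<close> relative to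
  \<open>\<sigma>1\<close>. The labels are crossed, with \<open>p\<close> belonging to \<mu>2 and
  \<open>q\<close> to \<mu>1, so that later \<open>S1\<close> annihilates \<open>q\<close> and
  \<open>S2\<close> annihilates \<open>p\<close>. Fixing the orientation of the basis determines the
  sign with which \<open>TT\<close> acts in it.\<close>

lemma simultaneous_diagonalisation:
  fixes \<sigma>1 \<sigma>2 :: "real^2^2"
  assumes s1: "sym_pos_def \<sigma>1" and s2: "sym_pos_def \<sigma>2"
    and np: "\<And>c. \<sigma>2 \<noteq> c *\<^sub>R \<sigma>1"
    and roots: "{z. det (\<sigma>2 - z *\<^sub>R \<sigma>1) = 0} = {\<mu>1, \<mu>2}"
  obtains p q where "\<mu>1 \<noteq> \<mu>2" "\<mu>1 > 0" "\<mu>2 > 0"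
    "(\<mu>1 - 1) * (\<mu>2 - 1) * det \<sigma>1 = det (\<sigma>1 - \<sigma>2)"
    "\<sigma>2 *v p = \<mu>2 *\<^sub>R (\<sigma>1 *v p)" "\<sigma>2 *v q = \<mu>1 *\<^sub>R (\<sigma>1 *v q)"
    "p \<bullet> (\<sigma>1 *v p) = 1" "q \<bullet> (\<sigma>1 *v q) = 1" "p \<bullet> (\<sigma>1 *v q) = 0"
    "p $ 1 * q $ 2 - p $ 2 * q $ 1 > 0" "det \<sigma>1 * (p $ 1 * q $ 2 - p $ 2 * q $ 1)\<^sup>2 = 1"
proof -
  have sym: "\<sigma> $ 2 $ 1 = \<sigma> $ 1 $ 2" if "sym_pos_def \<sigma>" for \<sigma> :: "real^2^2"
  proof -
    have "transpose \<sigma> $ 1 $ 2 = \<sigma> $ 1 $ 2" using that by (simp add: sym_pos_def_def)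
    then show ?thesis by (simp add: transpose_def)
  qed
  define A B C where "A = \<sigma>1 $ 1 $ 1" and "B = \<sigma>1 $ 1 $ 2" and "C = \<sigma>1 $ 2 $ 2"
  define A' B' C' where "A' = \<sigma>2 $ 1 $ 1" and "B' = \<sigma>2 $ 1 $ 2" and "C' = \<sigma>2 $ 2 $ 2"
  note cs = A_def[symmetric] B_def[symmetric] C_def[symmetric] A'_def[symmetric] B'_def[symmetric] C'_def[symmetric]
  have form: "v \<bullet> (\<sigma>1 *v v) = A * (v $ 1)\<^sup>2 + 2 * B * v $ 1 * v $ 2 + C * (v $ 2)\<^sup>2" for v
    by (simp add: inner_vec_def matrix_vector_mult_def sum_2 sym[OF s1] cs power2_eq_square algebra_simps)
  have det1: "det \<sigma>1 = A * C - B\<^sup>2" by (simp add: det_2 sym[OF s1] cs power2_eq_square)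
  have "0 < vector [1, 0] \<bullet> (\<sigma>1 *v vector [1, 0])"
  proof -
    have "(vector [1, 0] :: real^2) \<noteq> 0" by (simp add: vec_eq_iff forall_2)
    then show ?thesis using s1 by (simp add: sym_pos_def_def)
  qed
  then have A: "A > 0" unfolding form by simp
  \<comment> \<open>This vector is orthogonal to the first axis for the form of
    \<open>\<sigma>1\<close>; its energy is \<open>A\<close> times the determinant.\<close>
  have "0 < vector [- B, A] \<bullet> (\<sigma>1 *v vector [- B, A])"
  proof -
    have "(vector [- B, A] :: real^2) \<noteq> 0" using A by (simp add: vec_eq_iff forall_2)
    then show ?thesis using s1 by (simp add: sym_pos_def_def)
  qed
  then have "0 < A * (A * C - B\<^sup>2)" unfolding form by (simp add: power2_eq_square algebra_simps)
  then have det_pos: "A * C - B\<^sup>2 > 0" using A by (simp add: zero_less_mult_iff)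
  define T where "T = A * C' + C * A' - 2 * B * B'"
  have quad: "det (\<sigma>2 - z *\<^sub>R \<sigma>1) = (A * C - B\<^sup>2) * z\<^sup>2 - T * z + (A' * C' - B'\<^sup>2)" for z
    by (simp add: det_2 sym[OF s1] sym[OF s2] cs T_def power2_eq_square algebra_simps)
  have root: "(A * C - B\<^sup>2) * z\<^sup>2 - T * z + (A' * C' - B'\<^sup>2) = 0 \<longleftrightarrow> z = \<mu>1 \<or> z = \<mu>2" for z
    using eqset_imp_iff[OF roots, of z] unfolding quad[symmetric]
    by (simp only: mem_Collect_eq insert_iff empty_iff simp_thms)
  have ne: "\<mu>1 \<noteq> \<mu>2"
  proof
    assume eq: "\<mu>1 = \<mu>2"
    define m where "m = \<mu>1"
    have r: "(A * C - B\<^sup>2) * m\<^sup>2 - T * m + (A' * C' - B'\<^sup>2) = 0" using root[of m] by (simp add: m_def)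
    \<comment> \<open>The companion of \<open>m\<close> under Vieta's formula. It is a root too,
      hence equal to \<open>m\<close> if the root set is a singleton, so the quadratic has a double
      root.\<close>
    define z where "z = T / (A * C - B\<^sup>2) - m"
    have z: "(A * C - B\<^sup>2) * (z + m) = T" using det_pos by (simp add: z_def)
    have "(A * C - B\<^sup>2) * z\<^sup>2 - T * z + (A' * C' - B'\<^sup>2) = 0" using r z by algebra
    then have "z = m" using root[of z] eq by (simp add: m_def)
    then have T: "2 * (A * C - B\<^sup>2) * m = T" using z by (simp add: algebra_simps)
    define M11 M12 M22 where "M11 = A' - m * A" and "M12 = B' - m * B" and "M22 = C' - m * C"
    have M: "M11 * M22 = M12\<^sup>2" using r T unfolding M11_def M12_def M22_def T_def by algebra
    have mix: "A * M22 + C * M11 = 2 * B * M12" using T unfolding M11_def M12_def M22_def T_def by algebra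
    \<comment> \<open>At a double root \<open>\<sigma>2 - m *\<^sub>R \<sigma>1\<close> is singular
      and also trace-free relative to \<open>\<sigma>1\<close>. For a positive definite
      \<open>\<sigma>1\<close> these two facts combine into a vanishing sum of squares, which forces
      proportional phases.\<close>
    have "(A * M12 - B * M11)\<^sup>2 + (A * C - B\<^sup>2) * M11\<^sup>2 = 0" using M mix by algebra
    moreover have "(A * C - B\<^sup>2) * M11\<^sup>2 \<ge> 0" using det_pos by simp
    ultimately have "(A * C - B\<^sup>2) * M11\<^sup>2 = 0" "(A * M12 - B * M11)\<^sup>2 = 0"
      using zero_le_power2[of "A * M12 - B * M11"] by linarith+
    then have "M11 = 0" "M12 = 0" using det_pos A by auto
    then have "M22 = 0" using mix A by simp
    have "\<sigma>2 = m *\<^sub>R \<sigma>1"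
      using \<open>M11 = 0\<close> \<open>M12 = 0\<close> \<open>M22 = 0\<close>
      by (simp add: vec_eq_iff forall_2 sym[OF s1] sym[OF s2] cs M11_def M12_def M22_def)
    then show False using np by blast
  qed
  have kernel: "\<exists>v. v \<noteq> 0 \<and> \<sigma>2 *v v = z *\<^sub>R (\<sigma>1 *v v)" if "z = \<mu>1 \<or> z = \<mu>2" for z
  proof -
    have "det (\<sigma>2 - z *\<^sub>R \<sigma>1) = 0" using that root[of z] quad[of z] by simp
    from det_eq_0_imp_kernel[OF this] show ?thesis
      by (auto simp: matrix_vector_mult_diff_rdistrib scaleR_matrix_vector_assoc)
  qed
  have normalised: "\<exists>v. v \<bullet> (\<sigma>1 *v v) = 1 \<and> \<sigma>2 *v v = z *\<^sub>R (\<sigma>1 *v v)" if "z = \<mu>1 \<or> z = \<mu>2" for z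
  proof -
    obtain v where v: "v \<noteq> 0" "\<sigma>2 *v v = z *\<^sub>R (\<sigma>1 *v v)" using kernel[OF \<open>z = \<mu>1 \<or> z = \<mu>2\<close>] by blast
    define n where "n = v \<bullet> (\<sigma>1 *v v)"
    have "n > 0" using s1 v(1) by (simp add: sym_pos_def_def n_def)
    then have "(inverse (sqrt n) *\<^sub>R v) \<bullet> (\<sigma>1 *v (inverse (sqrt n) *\<^sub>R v)) = 1"
      by (simp add: matrix_vector_mult_scaleR n_def[symmetric] field_simps)
    then show ?thesis
      using v(2) by (intro exI[of _ "inverse (sqrt n) *\<^sub>R v"]) (simp add: matrix_vector_mult_scaleR)
  qed
  obtain p where p: "p \<bullet> (\<sigma>1 *v p) = 1" "\<sigma>2 *v p = \<mu>2 *\<^sub>R (\<sigma>1 *v p)" using normalised[of \<mu>2] by blast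
  obtain q0 where q0: "q0 \<bullet> (\<sigma>1 *v q0) = 1" "\<sigma>2 *v q0 = \<mu>1 *\<^sub>R (\<sigma>1 *v q0)" using normalised[of \<mu>1] by blast
  have pos: "z > 0" if "v \<bullet> (\<sigma>1 *v v) = 1" "\<sigma>2 *v v = z *\<^sub>R (\<sigma>1 *v v)" for z v
  proof -
    have "v \<noteq> 0" using that(1) by auto
    then have "0 < v \<bullet> (\<sigma>2 *v v)" using s2 by (simp add: sym_pos_def_def)
    then show ?thesis using that by simp
  qed
  have "\<mu>1 * (p \<bullet> (\<sigma>1 *v q0)) = p \<bullet> (\<sigma>2 *v q0)" using q0(2) by simp
  also have "\<dots> = \<mu>2 * (p \<bullet> (\<sigma>1 *v q0))"
    unfolding sym_pos_def_commute[OF s2, symmetric] p(2) inner_scaleR_left sym_pos_def_commute[OF s1] ..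
  finally have orth: "p \<bullet> (\<sigma>1 *v q0) = 0" using ne by simp
  define \<delta> where "\<delta> v = p $ 1 * v $ 2 - p $ 2 * v $ 1" for v :: "real^2"
  \<comment> \<open>The Gram determinant of \<open>p\<close> and \<open>v\<close> for the form of
    \<open>\<sigma>1\<close>; for an orthonormal pair it equals 1.\<close>
  have det\<delta>: "det \<sigma>1 * (\<delta> v)\<^sup>2 = (p \<bullet> (\<sigma>1 *v p)) * (v \<bullet> (\<sigma>1 *v v)) - (p \<bullet> (\<sigma>1 *v v))\<^sup>2" for v
    unfolding det1 \<delta>_def
    by (simp add: inner_vec_def matrix_vector_mult_def sum_2 sym[OF s1] cs power2_eq_square algebra_simps)
  have d1: "det \<sigma>1 * (\<delta> q0)\<^sup>2 = 1" unfolding det\<delta> p q0 orth by simp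
  \<comment> \<open>Reversing the sign makes the basis positively oriented and affects neither the
    eigenvalue equation nor the normalisation.\<close>
  define q where "q = (if \<delta> q0 > 0 then q0 else - q0)"
  have "\<delta> q0 \<noteq> 0" using d1 by auto
  then have \<delta>q: "\<delta> q > 0" by (simp add: q_def \<delta>_def)
  have q: "q \<bullet> (\<sigma>1 *v q) = 1" "\<sigma>2 *v q = \<mu>1 *\<^sub>R (\<sigma>1 *v q)" "p \<bullet> (\<sigma>1 *v q) = 0"
    using q0 orth by (auto simp: q_def linear_neg[OF matrix_vector_mul_linear])
  have d: "det \<sigma>1 * (\<delta> q)\<^sup>2 = 1" unfolding det\<delta> p q by simp
  \<comment> \<open>The characteristic quadratic, factored through its two roots and evaluated at
    \<open>z = 1\<close>; in dimension two the sign of the matrix does not affect its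
    determinant.\<close>
  have "(\<mu>1 - 1) * (\<mu>2 - 1) * det \<sigma>1 = det (\<sigma>1 - \<sigma>2)"
  proof -
    have r: "(A * C - B\<^sup>2) * \<mu>1\<^sup>2 - T * \<mu>1 + (A' * C' - B'\<^sup>2) = 0"
      "(A * C - B\<^sup>2) * \<mu>2\<^sup>2 - T * \<mu>2 + (A' * C' - B'\<^sup>2) = 0"
      using root[of \<mu>1] root[of \<mu>2] by simp_all
    have "(\<mu>1 - \<mu>2) * ((A * C - B\<^sup>2) * (\<mu>1 + \<mu>2) - T) = 0" using r by algebra
    then have T: "(A * C - B\<^sup>2) * (\<mu>1 + \<mu>2) = T" using ne by simp
    have "(\<mu>1 - 1) * (\<mu>2 - 1) * (A * C - B\<^sup>2) = (A * C - B\<^sup>2) - T + (A' * C' - B'\<^sup>2)"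
      using r(1) unfolding T[symmetric] by (simp add: power2_eq_square algebra_simps)
    also have "\<dots> = det (\<sigma>1 - \<sigma>2)"
      by (simp add: det_2 sym[OF s1] sym[OF s2] cs T_def power2_eq_square algebra_simps)
    finally show ?thesis by (simp add: det1)
  qed
  from that[OF ne pos[OF q(1,2)] pos[OF p] this p(2) q(2) p(1) q(1) q(3)] \<delta>q d
  show thesis by (simp add: \<delta>_def)
qed

text \<open>The vectors \<open>\<sigma> *v p\<close> and \<open>\<sigma> *v q\<close> are the basis
  dual to \<open>p\<close>, \<open>q\<close>, so the coefficients of \<open>v\<close> are its inner
  products with \<open>p\<close> and \<open>q\<close>. A remainder orthogonal to both vanishes since
  they are independent.\<close>

lemma comb_expand:
  assumes "sym_pos_def \<sigma>" "p \<bullet> (\<sigma> *v p) = 1" "q \<bullet> (\<sigma> *v q) = 1" "p \<bullet> (\<sigma> *v q) = 0"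
    and \<delta>: "p $ 1 * q $ 2 - p $ 2 * q $ 1 \<noteq> 0"
  shows "comb v E = (v \<bullet> p) *\<^sub>R comb (\<sigma> *v p) E + (v \<bullet> q) *\<^sub>R comb (\<sigma> *v q) E"
proof -
  define z where "z = v - ((v \<bullet> p) *\<^sub>R (\<sigma> *v p) + (v \<bullet> q) *\<^sub>R (\<sigma> *v q))"
  have "q \<bullet> (\<sigma> *v p) = 0" using assms(4) sym_pos_def_commute[OF assms(1), of q p] by (simp add: inner_commute)
  then have "p \<bullet> z = 0" "q \<bullet> z = 0"
    by (simp_all add: z_def inner_diff_right inner_add_right assms inner_commute[of v])
  then have 0: "p $ 1 * z $ 1 + p $ 2 * z $ 2 = 0" "q $ 1 * z $ 1 + q $ 2 * z $ 2 = 0"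
    by (simp_all add: inner_vec_def sum_2)
  have "(p $ 1 * q $ 2 - p $ 2 * q $ 1) * z $ 1 = 0" "(p $ 1 * q $ 2 - p $ 2 * q $ 1) * z $ 2 = 0"
    using 0 by algebra+
  then have "z = 0" using \<delta> by (simp add: vec_eq_iff forall_2)
  then have "v = (v \<bullet> p) *\<^sub>R (\<sigma> *v p) + (v \<bullet> q) *\<^sub>R (\<sigma> *v q)" by (simp add: z_def)
  then have "comb v E = comb ((v \<bullet> p) *\<^sub>R (\<sigma> *v p) + (v \<bullet> q) *\<^sub>R (\<sigma> *v q)) E" by simp
  then show ?thesis by (simp add: comb_left_simps)
qed

lemma comb_eqI:
  assumes "comb p X = comb p Y" "comb q X = comb q Y" and \<delta>: "p $ 1 * q $ 2 - p $ 2 * q $ 1 \<noteq> 0"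
  shows "X = Y"
proof -
  define Z where "Z = X - Y"
  have "comb p Z = 0" "comb q Z = 0" using assms(1,2) by (simp_all add: Z_def comb_right_simps)
  then have "p $ 1 * component 1 Z $ k + p $ 2 * component 2 Z $ k = 0"
    "q $ 1 * component 1 Z $ k + q $ 2 * component 2 Z $ k = 0" for k
    by (simp_all add: comb_def vec_eq_iff)
  note 0 = this
  have "(p $ 1 * q $ 2 - p $ 2 * q $ 1) * component 1 Z $ k = 0"
    "(p $ 1 * q $ 2 - p $ 2 * q $ 1) * component 2 Z $ k = 0" for k
    using 0[of k] by algebra+
  then have "component 1 Z = 0 \<and> component 2 Z = 0" using \<delta> by (simp add: vec_eq_iff)
  then have "component i Z = component i 0" for i
    using exhaust_2[of i] by (auto simp: component_simps)
  then have "Z = 0" by (rule component_eqI)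
  then show ?thesis by (simp add: Z_def)
qed

section \<open>The composite in coordinates adapted to both phases\<close>

locale normalised_phases =
  fixes A1 A2 :: "(real^2) set" and \<sigma>1 \<sigma>2 :: "real^2^2" and r1 r2 \<mu>1 \<mu>2 :: real and p q :: "real^2"
  assumes cell: "two_phase_cell A1 A2"
    and s1: "sym_pos_def \<sigma>1" and s2: "sym_pos_def \<sigma>2"
    and r1: "r1\<^sup>2 < det \<sigma>1" and r2: "r2\<^sup>2 < det \<sigma>2"
    and \<mu>: "\<mu>1 \<noteq> \<mu>2" "\<mu>1 > 0" "\<mu>2 > 0"
    and eigen: "\<sigma>2 *v p = \<mu>2 *\<^sub>R (\<sigma>1 *v p)" "\<sigma>2 *v q = \<mu>1 *\<^sub>R (\<sigma>1 *v q)"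
    and orth: "p \<bullet> (\<sigma>1 *v p) = 1" "q \<bullet> (\<sigma>1 *v q) = 1" "p \<bullet> (\<sigma>1 *v q) = 0"
    and orient: "p $ 1 * q $ 2 - p $ 2 * q $ 1 > 0"
    and vol: "det \<sigma>1 * (p $ 1 * q $ 2 - p $ 2 * q $ 1)\<^sup>2 = 1"
begin

definition \<delta> :: real where "\<delta> = p $ 1 * q $ 2 - p $ 2 * q $ 1"

lemma \<delta>_pos: "\<delta> > 0"
  using orient by (simp add: \<delta>_def)

lemma det_mult_orient_sq: "det \<sigma>1 * \<delta>\<^sup>2 = 1"
  using vol unfolding \<delta>_def .

lemma sqrt_det: "sqrt (det \<sigma>1) = 1 / \<delta>"
proof -
  have "det \<sigma>1 = (1 / \<delta>)\<^sup>2" using det_mult_orient_sq \<delta>_pos by (simp add: field_simps power_divide)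
  then show ?thesis using \<delta>_pos by (simp add: real_sqrt_divide power_divide)
qed

abbreviation L where
  "L \<equiv> two_phase A1 A2 (\<sigma>1 \<otimes> mat 1 + r1 *\<^sub>R TT) (\<sigma>2 \<otimes> mat 1 + r2 *\<^sub>R TT)"

abbreviation "S1 \<equiv> (1 / (\<mu>2 - \<mu>1)) *\<^sub>R (\<sigma>2 - \<mu>1 *\<^sub>R \<sigma>1)"
abbreviation "S2 \<equiv> (1 / (\<mu>1 - \<mu>2)) *\<^sub>R (\<sigma>2 - \<mu>2 *\<^sub>R \<sigma>1)"

text \<open>Fields are contracted with the dual basis \<open>\<sigma>1 *v p\<close>,
  \<open>\<sigma>1 *v q\<close>, fluxes with \<open>p\<close>, \<open>q\<close>. In this pairing
  \<open>\<sigma>1\<close> acts as the identity and \<open>\<sigma>2\<close> as a diagonal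
  matrix.\<close>

abbreviation e1 :: "\<T> \<Rightarrow> real^2" where "e1 \<equiv> comb (\<sigma>1 *v p)"
abbreviation e2 :: "\<T> \<Rightarrow> real^2" where "e2 \<equiv> comb (\<sigma>1 *v q)"

lemma \<sigma>_transpose: "transpose \<sigma>1 = \<sigma>1" "transpose \<sigma>2 = \<sigma>2"
  using s1 s2 by (simp_all add: sym_pos_def_def)

lemma S_mult:
  "S1 *v p = \<sigma>1 *v p" "S1 *v q = 0" "S2 *v p = 0" "S2 *v q = \<sigma>1 *v q"
proof -
  have "S1 *v v = (1 / (\<mu>2 - \<mu>1)) *\<^sub>R (\<sigma>2 *v v - \<mu>1 *\<^sub>R (\<sigma>1 *v v))"
    "S2 *v v = (1 / (\<mu>1 - \<mu>2)) *\<^sub>R (\<sigma>2 *v v - \<mu>2 *\<^sub>R (\<sigma>1 *v v))" for v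
    by (simp_all add: matrix_vector_mult_diff_rdistrib flip: scaleR_matrix_vector_assoc)
  then show "S1 *v p = \<sigma>1 *v p" "S1 *v q = 0" "S2 *v p = 0" "S2 *v q = \<sigma>1 *v q"
    using \<mu>(1) by (simp_all add: eigen flip: scaleR_diff_left)
qed

lemma S_transpose: "transpose S1 = S1" "transpose S2 = S2"
  using \<sigma>_transpose by (simp_all add: vec_eq_iff transpose_def)

lemma comb_TT_basis:
  "comb p (TT *v E) = - \<delta> *\<^sub>R (R_perp *v e2 E)"
  "comb q (TT *v E) = \<delta> *\<^sub>R (R_perp *v e1 E)"
proof -
  note ex = comb_expand[OF s1 orth less_imp_neq[OF orient, symmetric]]
  have "(R_perp *v p) \<bullet> p = 0" "(R_perp *v p) \<bullet> q = \<delta>" "(R_perp *v q) \<bullet> p = - \<delta>" "(R_perp *v q) \<bullet> q = 0"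
    by (simp_all add: R_perp_mult inner_vec_def sum_2 \<delta>_def)
  then show "comb p (TT *v E) = - \<delta> *\<^sub>R (R_perp *v e2 E)" "comb q (TT *v E) = \<delta> *\<^sub>R (R_perp *v e1 E)"
    unfolding comb_TT ex[of "R_perp *v p"] ex[of "R_perp *v q"]
    by (simp_all add: matrix_vector_mult_scaleR linear_neg[OF matrix_vector_mul_linear])
qed

lemma comb_phase:
  "comb p ((\<sigma>1 \<otimes> mat 1 + r *\<^sub>R TT) *v E) = e1 E - (r * \<delta>) *\<^sub>R (R_perp *v e2 E)"
  "comb q ((\<sigma>1 \<otimes> mat 1 + r *\<^sub>R TT) *v E) = e2 E + (r * \<delta>) *\<^sub>R (R_perp *v e1 E)"
  "comb p ((\<sigma>2 \<otimes> mat 1 + r *\<^sub>R TT) *v E) = \<mu>2 *\<^sub>R e1 E - (r * \<delta>) *\<^sub>R (R_perp *v e2 E)"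
  "comb q ((\<sigma>2 \<otimes> mat 1 + r *\<^sub>R TT) *v E) = \<mu>1 *\<^sub>R e2 E + (r * \<delta>) *\<^sub>R (R_perp *v e1 E)"
  by (simp_all add: matrix_vector_mult_add_rdistrib comb_right_simps comb_kron \<sigma>_transpose eigen
      comb_left_simps comb_TT_basis flip: scaleR_matrix_vector_assoc)

lemma comb_S:
  "comb p ((S1 \<otimes> X) *v E) = X *v e1 E" "comb q ((S1 \<otimes> X) *v E) = 0"
  "comb p ((S2 \<otimes> X) *v E) = 0" "comb q ((S2 \<otimes> X) *v E) = X *v e2 E"
  by (simp_all only: comb_kron S_transpose S_mult comb_left_simps matrix_vector_mult_0_right)

text \<open>In the adapted basis the inverse of \<open>\<sigma>1\<close> times
  \<open>S1 - S2\<close> acts as the diagonal matrix with entries 1 and -1. Its minus sign cancels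
  the one in \<open>comb_TT_basis\<close>, so the coupling enters both equations with the same
  sign.\<close>

lemma comb_coupling:
  defines "X \<equiv> \<lambda>B. TT ** ((matrix_inv \<sigma>1 ** (S1 - S2)) \<otimes> B)"
  shows "comb p (X B *v E) = \<delta> *\<^sub>R (R_perp *v (B *v e2 E))"
    and "comb q (X B *v E) = \<delta> *\<^sub>R (R_perp *v (B *v e1 E))"
proof -
  have "det \<sigma>1 \<noteq> 0" using vol by auto
  then have "\<exists>B. \<sigma>1 ** B = mat 1 \<and> B ** \<sigma>1 = mat 1"
    by (simp add: invertible_det_nz flip: invertible_def)
  then have "\<sigma>1 ** matrix_inv \<sigma>1 = mat 1" unfolding matrix_inv_def by (rule someI2_ex) blast
  then have "transpose (matrix_inv \<sigma>1) ** \<sigma>1 = mat 1"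
    by (metis matrix_transpose_mul transpose_mat \<sigma>_transpose(1))
  then have inv: "transpose (matrix_inv \<sigma>1) *v (\<sigma>1 *v v) = v" for v
    by (simp add: matrix_vector_mul_assoc)
  have "transpose (S1 - S2) = S1 - S2"
    using \<sigma>_transpose by (simp add: vec_eq_iff transpose_def)
  then have "transpose (matrix_inv \<sigma>1 ** (S1 - S2)) *v (\<sigma>1 *v v) = (S1 - S2) *v v" for v
    by (simp only: matrix_transpose_mul matrix_vector_mul_assoc[symmetric] inv)
  then have "e1 (((matrix_inv \<sigma>1 ** (S1 - S2)) \<otimes> B) *v E) = B *v e1 E"
    "e2 (((matrix_inv \<sigma>1 ** (S1 - S2)) \<otimes> B) *v E) = - (B *v e2 E)"
    unfolding comb_kron
    by (simp_all only: matrix_vector_mult_diff_rdistrib S_mult)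
      (simp_all add: comb_left_simps linear_neg[OF matrix_vector_mul_linear])
  then show "comb p (X B *v E) = \<delta> *\<^sub>R (R_perp *v (B *v e2 E))"
    "comb q (X B *v E) = \<delta> *\<^sub>R (R_perp *v (B *v e1 E))"
    by (simp_all add: X_def comb_TT_basis linear_neg[OF matrix_vector_mul_linear] flip: matrix_vector_mul_assoc)
qed

lemma L_pos: "sym_pos_def (\<sigma>1 \<otimes> mat 1 + r1 *\<^sub>R TT)" "sym_pos_def (\<sigma>2 \<otimes> mat 1 + r2 *\<^sub>R TT)"
  by (intro sym_pos_def_phase s1 s2 r1 r2)+

text \<open>The correction terms are multiples of rotated fields, whose averages are fixed by
  \<open>E0\<close>. They can thus be added to the fluxes without losing divergence-freeness, and
  the last two conclusions remove them again from the averages.\<close>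

lemma reduced_fields:
  assumes E: "cell_field L E0 E"
  defines "K1 \<equiv> \<lambda>x. comb p (L x *v E x) + (r1 * \<delta>) *\<^sub>R (R_perp *v e2 (E x))"
    and "K2 \<equiv> \<lambda>x. comb q (L x *v E x) - (r1 * \<delta>) *\<^sub>R (R_perp *v e1 (E x))"
  shows "div_free K1" "div_free K2"
    and "x \<in> A1 \<Longrightarrow> K1 x = e1 (E x)" "x \<in> A1 \<Longrightarrow> K2 x = e2 (E x)"
    and "x \<in> A2 \<Longrightarrow> K1 x = \<mu>2 *\<^sub>R e1 (E x) - ((r2 - r1) * \<delta>) *\<^sub>R (R_perp *v e2 (E x))"
    and "x \<in> A2 \<Longrightarrow> K2 x = \<mu>1 *\<^sub>R e2 (E x) + ((r2 - r1) * \<delta>) *\<^sub>R (R_perp *v e1 (E x))"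
    and "comb p (effective_tensor L *v E0) = (LINT x|\<mu>. K1 x) - (r1 * \<delta>) *\<^sub>R (R_perp *v e2 E0)"
    and "comb q (effective_tensor L *v E0) = (LINT x|\<mu>. K2 x) + (r1 * \<delta>) *\<^sub>R (R_perp *v e1 E0)"
proof -
  have R: "div_free (\<lambda>x. R_perp *v comb v (E x))" for v
  proof -
    obtain \<phi> where "H1_per_grad \<phi> (\<lambda>x. comb v (E x) - comb v E0)" using cell_field_comb(1)[OF E] by blast
    then show ?thesis by (rule div_free_rotated_field)
  qed
  note J = cell_field_comb(2)[OF E]
  show K: "div_free K1" "div_free K2"
    unfolding K1_def K2_def by (intro div_free_add div_free_diff div_free_scaleR J R)+
  show "x \<in> A1 \<Longrightarrow> K1 x = e1 (E x)" "x \<in> A1 \<Longrightarrow> K2 x = e2 (E x)"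
    by (simp_all add: K1_def K2_def two_phase_simps[OF cell] comb_phase)
  show "x \<in> A2 \<Longrightarrow> K1 x = \<mu>2 *\<^sub>R e1 (E x) - ((r2 - r1) * \<delta>) *\<^sub>R (R_perp *v e2 (E x))"
    "x \<in> A2 \<Longrightarrow> K2 x = \<mu>1 *\<^sub>R e2 (E x) + ((r2 - r1) * \<delta>) *\<^sub>R (R_perp *v e1 (E x))"
    by (simp_all only: K1_def K2_def two_phase_simps(2)[OF cell] comb_phase) (simp_all add: algebra_simps)
  have LE: "L2_cell E" by (rule cell_field_L2[OF E])
  have LJ: "L2_cell (\<lambda>x. L x *v E x)" by (rule L2_cell_two_phase_mult[OF cell LE])
  have mean: "L2_cell (\<lambda>x. comb v (E x))" "(LINT x|\<mu>. comb v (E x)) = comb v E0" for v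
  proof -
    obtain \<phi> where "H1_per_grad \<phi> (\<lambda>x. comb v (E x) - comb v E0)" using cell_field_comb(1)[OF E] by blast
    then show "L2_cell (\<lambda>x. comb v (E x))" "(LINT x|\<mu>. comb v (E x)) = comb v E0"
      by (rule H1_per_grad_field_mean)+
  qed
  have i: "integrable \<mu> (\<lambda>x. comb v (L x *v E x))" "integrable \<mu> (\<lambda>x. R_perp *v comb v (E x))" for v
    by (rule L2_cell_integrable[OF div_free_L2[OF J]], rule L2_cell_integrable[OF div_free_L2[OF R]])
  have eff: "comb v (effective_tensor L *v E0) = (LINT x|\<mu>. comb v (L x *v E x))" for v
    by (simp only: effective_tensor_mult[OF cell L_pos E] LINT_comb[OF LJ])
  show "comb p (effective_tensor L *v E0) = (LINT x|\<mu>. K1 x) - (r1 * \<delta>) *\<^sub>R (R_perp *v e2 E0)"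
    "comb q (effective_tensor L *v E0) = (LINT x|\<mu>. K2 x) + (r1 * \<delta>) *\<^sub>R (R_perp *v e1 E0)"
    unfolding eff K1_def K2_def using i by (simp_all add: LINT_matrix_mult[OF mean(1)] mean(2))
qed

lemma effective_tensor_coupled:
  assumes ne: "r1 \<noteq> r2" and eq: "(\<mu>1 - 1) * (\<mu>2 - 1) * det \<sigma>1 = (r1 - r2)\<^sup>2"
  defines "a \<equiv> (\<mu>1 - 1) / ((r2 - r1) / sqrt (det \<sigma>1))" and "s \<equiv> Sigma_eff A1 A2 (\<mu>1 / \<mu>2)"
  defines "x \<equiv> trace s / 2" and "D \<equiv> det (s - a\<^sup>2 *\<^sub>R mat 1)"
  shows "effective_tensor L =
    (r1 + a * ((1 - a\<^sup>2) * (x - a\<^sup>2) / D - 1) * sqrt (det \<sigma>1)) *\<^sub>R TT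
    + ((1 - a\<^sup>2) / D) *\<^sub>R (S1 \<otimes> (s - a\<^sup>2 *\<^sub>R mat 1) + S2 \<otimes> (det s *\<^sub>R mat 1 - a\<^sup>2 *\<^sub>R s)
      + (a * sqrt (det \<sigma>1)) *\<^sub>R (TT ** ((matrix_inv \<sigma>1 ** (S1 - S2)) \<otimes> (s - x *\<^sub>R mat 1))))"
    (is "_ = ?M")
proof -
  define \<rho> where "\<rho> = (r2 - r1) * \<delta>"
  have \<rho>0: "\<rho> \<noteq> 0" using ne \<delta>_pos by (simp add: \<rho>_def)
  have a_eq: "a = (\<mu>1 - 1) / \<rho>" by (simp add: a_def \<rho>_def sqrt_det)
  have "(\<mu>1 - 1) * (\<mu>2 - 1) = (\<mu>1 - 1) * (\<mu>2 - 1) * det \<sigma>1 * \<delta>\<^sup>2"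
    using det_mult_orient_sq by (simp add: mult.assoc)
  then have \<rho>: "(\<mu>2 - 1) * (\<mu>1 - 1) = \<rho>\<^sup>2"
    unfolding eq by (simp add: \<rho>_def power_mult_distrib power2_commute mult.commute)
  have "(\<mu>1 - 1) \<noteq> 0" using \<rho> \<rho>0 by auto
  then have a0: "a \<noteq> 0" using \<rho>0 by (simp add: a_eq)
  have D0: "D \<noteq> 0"
    unfolding D_def s_def a_eq by (rule det_Sigma_eff_shift_nonzero[OF cell \<mu>(3,2) \<mu>(1)[symmetric] \<rho>0 \<rho>])
  have sym: "s $ 2 $ 1 = s $ 1 $ 2"
    unfolding s_def using \<mu> by (intro Sigma_eff_symmetric cell) simp
  have "effective_tensor L *v E0 = ?M *v E0" for E0
  proof -
    obtain E where E: "cell_field L E0 E" using cell_field_exists[OF cell L_pos] by blast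
    obtain \<phi>1 \<phi>2 where \<phi>: "H1_per_grad \<phi>1 (\<lambda>x. e1 (E x) - e1 E0)" "H1_per_grad \<phi>2 (\<lambda>x. e2 (E x) - e2 E0)"
      using cell_field_comb(1)[OF E] by blast
    note K = reduced_fields[OF E]
    define k1 where "k1 = (LINT x|\<mu>. comb p (L x *v E x) + (r1 * \<delta>) *\<^sub>R (R_perp *v e2 (E x)))"
    define k2 where "k2 = (LINT x|\<mu>. comb q (L x *v E x) - (r1 * \<delta>) *\<^sub>R (R_perp *v e1 (E x)))"
    \<comment> \<open>The reduction is used with \<open>d1 = \<mu>2\<close> and
      \<open>d2 = \<mu>1\<close>, since \<open>p\<close> belongs to \<mu>2; its contrast
      \<open>d2 / d1\<close> then becomes \<open>\<mu>1 / \<mu>2\<close>.\<close>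
    obtain e0 y where ey: "e2 E0 = e0 + y" "a *\<^sub>R e1 E0 = R_perp *v (s *v e0 + a\<^sup>2 *\<^sub>R y)"
      "k2 = s *v e0 + y" "a *\<^sub>R k1 = R_perp *v (e0 + a\<^sup>2 *\<^sub>R y)"
      using rank_one_reduction[OF cell \<phi> K(1-6)[folded \<rho>_def] \<mu>(3,2) \<mu>(1)[symmetric] \<rho>0 \<rho>]
      unfolding k1_def k2_def a_eq s_def by blast
    define b where "b = a * ((1 - a\<^sup>2) * (x - a\<^sup>2) / D - 1)"
    note F = flux_formula_algebra[OF sym a0 ey(1,2,3,4) D0[unfolded D_def], folded D_def x_def, folded b_def]
    have \<delta>1: "(r1 + b * sqrt (det \<sigma>1)) * \<delta> = r1 * \<delta> + b" "a * sqrt (det \<sigma>1) * \<delta> = a"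
      using \<delta>_pos by (simp_all add: sqrt_det field_simps)
    show ?thesis
    proof (rule comb_eqI[OF _ _ less_imp_neq[OF orient, symmetric]])
      have "comb p (?M *v E0) = - ((r1 + b * sqrt (det \<sigma>1)) * \<delta>) *\<^sub>R (R_perp *v e2 E0)
          + ((1 - a\<^sup>2) / D) *\<^sub>R ((s - a\<^sup>2 *\<^sub>R mat 1) *v e1 E0
            + (a * sqrt (det \<sigma>1) * \<delta>) *\<^sub>R (R_perp *v ((s - x *\<^sub>R mat 1) *v e2 E0)))"
        unfolding b_def[symmetric]
        by (simp only: matrix_vector_mult_add_rdistrib scaleR_matrix_vector_assoc[symmetric] comb_right_simps
            comb_TT_basis comb_S comb_coupling scaleR_scaleR) simp
      then show "comb p (effective_tensor L *v E0) = comb p (?M *v E0)"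
        unfolding K(7) k1_def[symmetric] F(1) \<delta>1 by (simp add: algebra_simps)
      have "comb q (?M *v E0) = ((r1 + b * sqrt (det \<sigma>1)) * \<delta>) *\<^sub>R (R_perp *v e1 E0)
          + ((1 - a\<^sup>2) / D) *\<^sub>R ((det s *\<^sub>R mat 1 - a\<^sup>2 *\<^sub>R s) *v e2 E0
            + (a * sqrt (det \<sigma>1) * \<delta>) *\<^sub>R (R_perp *v ((s - x *\<^sub>R mat 1) *v e1 E0)))"
        unfolding b_def[symmetric]
        by (simp only: matrix_vector_mult_add_rdistrib scaleR_matrix_vector_assoc[symmetric] comb_right_simps
            comb_TT_basis comb_S comb_coupling scaleR_scaleR) simp
      then show "comb q (effective_tensor L *v E0) = comb q (?M *v E0)"
        unfolding K(8) k2_def[symmetric] F(2) \<delta>1 by (simp add: algebra_simps)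
    qed
  qed
  then show ?thesis by (simp add: matrix_eq)
qed

text \<open>Without a jump of \<open>r\<close> the two components do not interact after the shift.
  The one belonging to the root 1 sees a homogeneous medium, so its flux is the field itself; the
  other solves the scalar problem with contrast \<mu>1. No division by the coupling is
  involved.\<close>

lemma effective_tensor_uncoupled:
  assumes r: "r2 = r1" and "\<mu>2 = 1"
  shows "effective_tensor L = r1 *\<^sub>R TT + S1 \<otimes> mat 1 + S2 \<otimes> Sigma_eff A1 A2 \<mu>1"
    (is "_ = ?M")
proof -
  have "effective_tensor L *v E0 = ?M *v E0" for E0
  proof -
    obtain E where E: "cell_field L E0 E" using cell_field_exists[OF cell L_pos] by blast
    obtain \<phi>1 \<phi>2 where \<phi>: "H1_per_grad \<phi>1 (\<lambda>x. e1 (E x) - e1 E0)" "H1_per_grad \<phi>2 (\<lambda>x. e2 (E x) - e2 E0)"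
      using cell_field_comb(1)[OF E] by blast
    define K1 where "K1 x = comb p (L x *v E x) + (r1 * \<delta>) *\<^sub>R (R_perp *v e2 (E x))" for x
    define K2 where "K2 x = comb q (L x *v E x) - (r1 * \<delta>) *\<^sub>R (R_perp *v e1 (E x))" for x
    note K = reduced_fields[OF E, folded K1_def K2_def]
    have phase: "x \<in> A1 \<or> x \<in> A2" if "x \<in> space \<mu>" for x
      using that cell by (auto simp: two_phase_cell_def space_restrict_space)
    have "(LINT x|\<mu>. K1 x) = (LINT x|\<mu>. e1 (E x))"
      using phase K(3,5) assms by (intro Bochner_Integration.integral_cong refl) fastforce
    then have k1: "(LINT x|\<mu>. K1 x) = e1 E0" using H1_per_grad_field_mean(2)[OF \<phi>(1)] by simp
    have k2: "(LINT x|\<mu>. K2 x) = Sigma_eff A1 A2 \<mu>1 *v e2 E0"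
    proof (rule conductivity_from_pointwise_relation[OF cell \<mu>(2) \<phi>(2) K(2)], rule AE_I2)
      fix x assume "x \<in> space \<mu>"
      from phase[OF this] show "two_phase A1 A2 (mat 1) (\<mu>1 *\<^sub>R mat 1) x *v e2 (E x) = K2 x"
      proof
        assume "x \<in> A1"
        then show ?thesis by (simp add: two_phase_simps[OF cell] K(4))
      next
        assume "x \<in> A2"
        then show ?thesis
          by (simp add: two_phase_simps[OF cell] K(6) r flip: scaleR_matrix_vector_assoc)
      qed
    qed
    show ?thesis
    proof (rule comb_eqI[OF _ _ less_imp_neq[OF orient, symmetric]])
      have "comb p (?M *v E0) = e1 E0 - (r1 * \<delta>) *\<^sub>R (R_perp *v e2 E0)"
        by (simp only: matrix_vector_mult_add_rdistrib scaleR_matrix_vector_assoc[symmetric] comb_right_simps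
            comb_TT_basis comb_S scaleR_scaleR) simp
      then show "comb p (effective_tensor L *v E0) = comb p (?M *v E0)" unfolding K(7) k1 by simp
      have "comb q (?M *v E0) = Sigma_eff A1 A2 \<mu>1 *v e2 E0 + (r1 * \<delta>) *\<^sub>R (R_perp *v e1 E0)"
        by (simp only: matrix_vector_mult_add_rdistrib scaleR_matrix_vector_assoc[symmetric] comb_right_simps
            comb_TT_basis comb_S scaleR_scaleR) simp
      then show "comb q (effective_tensor L *v E0) = comb q (?M *v E0)" unfolding K(8) k2 by simp
    qed
  qed
  then show ?thesis by (simp add: matrix_eq)
qed

end

theorem mainTheorem9:
  fixes A1 A2 :: "(real^2) set"
    and \<sigma>\<^sub>1 \<sigma>\<^sub>2 S\<^sub>1 S\<^sub>2 :: "real^2^2"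
    and r\<^sub>1 r\<^sub>2 \<mu>\<^sub>1 \<mu>\<^sub>2 :: real
    and L\<^sub>1 L\<^sub>2 Leff :: "real^(2 \<times> 2)^(2 \<times> 2)"
  assumes "two_phase_cell A1 A2"
    and "sym_pos_def \<sigma>\<^sub>1" and "sym_pos_def \<sigma>\<^sub>2"
    and "r\<^sub>1\<^sup>2 < det \<sigma>\<^sub>1" and "r\<^sub>2\<^sup>2 < det \<sigma>\<^sub>2"
    and "L\<^sub>1 = \<sigma>\<^sub>1 \<otimes> mat 1 + r\<^sub>1 *\<^sub>R TT"
    and "L\<^sub>2 = \<sigma>\<^sub>2 \<otimes> mat 1 + r\<^sub>2 *\<^sub>R TT"
    and "\<forall>c. \<sigma>\<^sub>1 \<noteq> c *\<^sub>R \<sigma>\<^sub>2" and "\<forall>c. \<sigma>\<^sub>2 \<noteq> c *\<^sub>R \<sigma>\<^sub>1"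
    and "\<bar>r\<^sub>1 - r\<^sub>2\<bar> < \<bar>sqrt (det \<sigma>\<^sub>1) - sqrt (det \<sigma>\<^sub>2)\<bar>"
    and "\<bar>r\<^sub>1 - r\<^sub>2\<bar>\<^sup>2 = det (\<sigma>\<^sub>1 - \<sigma>\<^sub>2)"
    and "{z. det (\<sigma>\<^sub>2 - z *\<^sub>R \<sigma>\<^sub>1) = 0} = {\<mu>\<^sub>1, \<mu>\<^sub>2}"
    and "S\<^sub>1 = (1 / (\<mu>\<^sub>2 - \<mu>\<^sub>1)) *\<^sub>R (\<sigma>\<^sub>2 - \<mu>\<^sub>1 *\<^sub>R \<sigma>\<^sub>1)"
    and "S\<^sub>2 = (1 / (\<mu>\<^sub>1 - \<mu>\<^sub>2)) *\<^sub>R (\<sigma>\<^sub>2 - \<mu>\<^sub>2 *\<^sub>R \<sigma>\<^sub>1)"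
    and "Leff = effective_tensor (two_phase A1 A2 L\<^sub>1 L\<^sub>2)"
  shows "(r\<^sub>1 \<noteq> r\<^sub>2 \<longrightarrow>
      (let \<rho> = (r\<^sub>2 - r\<^sub>1) / sqrt (det \<sigma>\<^sub>1);
           a\<^sub>0 = (\<mu>\<^sub>1 - 1) / \<rho>;
           s = Sigma_eff A1 A2 (\<mu>\<^sub>1 / \<mu>\<^sub>2);
           x = trace s / 2;
           D = det (s - a\<^sub>0\<^sup>2 *\<^sub>R mat 1);
           N = S\<^sub>1 \<otimes> (s - a\<^sub>0\<^sup>2 *\<^sub>R mat 1)
             + S\<^sub>2 \<otimes> (det s *\<^sub>R mat 1 - a\<^sub>0\<^sup>2 *\<^sub>R s)
             + (a\<^sub>0 * sqrt (det \<sigma>\<^sub>1)) *\<^sub>R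
                 (TT ** ((matrix_inv \<sigma>\<^sub>1 ** (S\<^sub>1 - S\<^sub>2)) \<otimes> (s - x *\<^sub>R mat 1)))
       in Leff = (r\<^sub>1 + a\<^sub>0 * ((1 - a\<^sub>0\<^sup>2) * (x - a\<^sub>0\<^sup>2) / D - 1) * sqrt (det \<sigma>\<^sub>1)) *\<^sub>R TT
               + ((1 - a\<^sub>0\<^sup>2) / D) *\<^sub>R N))
    \<and> (\<forall>r\<^sub>0. r\<^sub>1 = r\<^sub>0 \<and> r\<^sub>2 = r\<^sub>0 \<and> \<mu>\<^sub>1 \<noteq> 1 \<and> \<mu>\<^sub>2 = 1 \<longrightarrow>
      Leff = r\<^sub>0 *\<^sub>R TT + S\<^sub>1 \<otimes> mat 1 + S\<^sub>2 \<otimes> Sigma_eff A1 A2 \<mu>\<^sub>1)"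
proof -
  have "\<sigma>\<^sub>2 \<noteq> c *\<^sub>R \<sigma>\<^sub>1" for c using assms(9) by blast
  then obtain p q where pq: "\<mu>\<^sub>1 \<noteq> \<mu>\<^sub>2" "\<mu>\<^sub>1 > 0" "\<mu>\<^sub>2 > 0"
    "(\<mu>\<^sub>1 - 1) * (\<mu>\<^sub>2 - 1) * det \<sigma>\<^sub>1 = det (\<sigma>\<^sub>1 - \<sigma>\<^sub>2)"
    "\<sigma>\<^sub>2 *v p = \<mu>\<^sub>2 *\<^sub>R (\<sigma>\<^sub>1 *v p)" "\<sigma>\<^sub>2 *v q = \<mu>\<^sub>1 *\<^sub>R (\<sigma>\<^sub>1 *v q)"
    "p \<bullet> (\<sigma>\<^sub>1 *v p) = 1" "q \<bullet> (\<sigma>\<^sub>1 *v q) = 1" "p \<bullet> (\<sigma>\<^sub>1 *v q) = 0"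
    "p $ 1 * q $ 2 - p $ 2 * q $ 1 > 0" "det \<sigma>\<^sub>1 * (p $ 1 * q $ 2 - p $ 2 * q $ 1)\<^sup>2 = 1"
    using simultaneous_diagonalisation[OF assms(2,3) _ assms(12)] by metis
  interpret normalised_phases A1 A2 \<sigma>\<^sub>1 \<sigma>\<^sub>2 r\<^sub>1 r\<^sub>2 \<mu>\<^sub>1 \<mu>\<^sub>2 p q
    by unfold_locales (fact assms pq)+
  \<comment> \<open>The hypothesis on \<open>det (\<sigma>\<^sub>1 - \<sigma>\<^sub>2)\<close>
    rewritten in terms of the roots, which is the form of degeneracy that the coupled case
    uses.\<close>
  have "(\<mu>\<^sub>1 - 1) * (\<mu>\<^sub>2 - 1) * det \<sigma>\<^sub>1 = (r\<^sub>1 - r\<^sub>2)\<^sup>2"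
    using assms(11) pq(4) by simp
  note coupled = effective_tensor_coupled[OF _ this]
  show ?thesis
    unfolding Let_def assms(15) assms(6,7,13,14)
    using coupled effective_tensor_uncoupled by blast
qed

end
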